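(* The hybrid oversampling expanded mixed multiscale problem (HOS) has a unique solution $(\bar\theta_h^{os},\bar u_h^{os},\bar p_h^{os},\lambda_h^{os})\in X_{1,h}^{os}\times\tilde X_{2,h}^{os}\times Q_h\times\Pi_h^l$. Moreover, $((\bar\theta_h^{os},\bar u_h^{os}),\bar p_h^{os})=((\theta_h^{os},u_h^{os}),p_h^{os})$, where $((\theta_h^{os},u_h^{os}),p_h^{os})\in (X_{1,h}^{os}\times X_{2,h}^{os})\times Q_h$ is the unique solution of the oversampling expanded mixed multiscale problem (OS). (Problems (OS) and (HOS) are written out in the context.)
   Context: $\Omega\subset\mathbb R^d$ ($d=2,3$) is a bounded Lipschitz domain, $f\in L^2(\Omega)$, and $k$ is a symmetric matrix field with $k_{\min}|\zeta|^2\le\zeta^Tk(x)\zeta\le k_{\max}|\zeta|^2$ for all $\zeta\in\mathbb R^d$, $x\in\Omega$, with constants $0<k_{\min}\le k_{\max}$. $(\cdot,\cdot)_D$ is the $L^2(D)$ inner product, $(\cdot,\cdot)=(\cdot,\cdot)_\Omega$. Mesh: $\mathfrak T_h$ is a quasi-uniform partition of $\Omega$ into cells $K$, $h$ the maximal cell diameter, $\mathcal F_h$ the set of interior faces. $V_h\subset H(div,\Omega)$ is the lowest-order Raviart–Thomas space $RT_0$ on $\mathfrak T_h$, with local basis $\chi_j^K$ of $V_h(K)=V_h|_K$ (one for each face $e_j\subset\partial K$) satisfying $div\,\chi_j^K=1/|K|$, $\chi_j^K\cdot n=1/|e_j|$ on $e_j$ and $0$ on the other faces. $Q_h$ is the space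 of piecewise constants. Oversampling spaces: for each $K$ let $S\supset K$ be a larger block with $RT_0$ basis functions $\chi_l^S$. For $\chi=\chi_l^S$ let $(\eta_\chi^S,\psi_\chi^S,\phi_\chi^S)$ solve ($\phi_\chi^S$ up to a constant) $\psi_\chi^S+k\eta_\chi^S=0$, $\eta_\chi^S-\nabla\phi_\chi^S=0$, $div\,\psi_\chi^S=div\,\chi$ in $S$, $\psi_\chi^S\cdot n=\chi\cdot n$ on $\partial S$. Let constants $c_{jl}$ satisfy $\chi_j^K=\sum_l c_{jl}\chi_l^S|_K$, and set $\bar\psi_{\chi_j}^K=\sum_l c_{jl}\psi_{\chi_l}^S|_K$, $\bar\eta_{\chi_j}^K=\sum_l c_{jl}\eta_{\chi_l}^S|_K$. $\tilde X_{2,h}^{os}=\{u\in[L^2(\Omega)]^d:u|_K\in\mathrm{span}\{\bar\psi_{\chi_j}^K\}\ \forall K\}$. The operator $\mathcal M_h$ on $\tilde X_{2,h}^{os}$ is defined cellwise by $\mathcal M_h|_K(\sum_jc_j\bar\psi_{\chi_j}^K)=\sum_jc_j\chi_j^K$ (it is implicit that this is well defined, i.e. that the $\bar\psi_{\chi_j}^K$ are linearly independent on each $K$). $X_{1,h}^{os}=\{\theta\in[L^2(\Omega)]^d:\theta|_K\in\mathrm{span}\{\bar\eta_{\chi_j}^K\}\ \forall K\}$, $X_{2,h}^{os}=\{u_h\in\tilde X_{2,h}^{os}:\mathcal M_hu_h\in V_h\subset H(div,\Omega)\}$. The multiplier space is $\Pi_h^l=\{\pi\in L^2(\mathcal F_h):\pi|_e\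 \text{is constant (a normal trace of an } RT_0 \text{ function) for each } e\in\mathcal F_h\}$, with $\pi=0$ on faces $e\subset\partial\Omega$. $[C_h^{os}(\tau_h),\pi_h]=\sum_K(\mathcal M_h(\tau_h)\cdot n,\pi_h)_{\partial K}$ for $\tau_h\in\tilde X_{2,h}^{os}$, $\pi_h\in\Pi_h^l$. Problem (OS): find $(\theta_h^{os},u_h^{os},p_h^{os})\in X_{1,h}^{os}\times X_{2,h}^{os}\times Q_h$ with $(k\theta_h^{os},\xi_h)+(u_h^{os},\xi_h)=0$ for all $\xi_h\in X_{1,h}^{os}$; $(\theta_h^{os},\tau_h)+\sum_K(p_h^{os},div\,\tau_h)_K=0$ for all $\tau_h\in X_{2,h}^{os}$; $\sum_K(div\,u_h^{os},q_h)_K=(f,q_h)$ for all $q_h\in Q_h$. Problem (HOS): find $(\bar\theta_h^{os},\bar u_h^{os},\bar p_h^{os},\lambda_h^{os})\in X_{1,h}^{os}\times\tilde X_{2,h}^{os}\times Q_h\times\Pi_h^l$ with $(k\bar\theta_h^{os},\xi_h)+(\bar u_h^{os},\xi_h)=0$ for all $\xi_h\in X_{1,h}^{os}$; $(\bar\theta_h^{os},\tau_h)+\sum_K(\bar p_h^{os},div\,\tau_h)_K=[C_h^{os}(\tau_h),\lambda_h^{os}]$ for all $\tau_h\in\tilde X_{2,h}^{os}$; $\sum_K(div\,\bar u_h^{os},q_h)_K=(f,q_h)$ for all $q_h\in Q_h$; $[C_h^{os}(\bar u_h^{os}),\pi_h]=0$ for all $\pi_h\in\Pi_h^l$. *)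

theory Defs
  imports "HOL-Analysis.Analysis"
begin

section \<open>Function spaces\<close>

definition L2 :: "'a measure \<Rightarrow> ('a \<Rightarrow> 'b::real_normed_vector) \<Rightarrow> bool" where
  "L2 M u \<longleftrightarrow> u \<in> borel_measurable M \<and> integrable M (\<lambda>x. (norm (u x))\<^sup>2)"

definition ip :: "(real^'n) set \<Rightarrow> (real^'n \<Rightarrow> 'b::real_inner) \<Rightarrow> (real^'n \<Rightarrow> 'b) \<Rightarrow> real" where
  "ip D u v = (LINT x|lebesgue_on D. u x \<bullet> v x)"

definition ae_eq :: "(real^'n) set \<Rightarrow> (real^'n \<Rightarrow> 'b) \<Rightarrow> (real^'n \<Rightarrow> 'b) \<Rightarrow> bool" where
  "ae_eq D u v \<longleftrightarrow> (AE x in lebesgue_on D. u x = v x)"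

definition partial :: "'n \<Rightarrow> (real^'n \<Rightarrow> real) \<Rightarrow> real^'n \<Rightarrow> real" where
  "partial i \<phi> x = frechet_derivative \<phi> (at x) (axis i 1)"

definition grad :: "(real^'n \<Rightarrow> real) \<Rightarrow> real^'n \<Rightarrow> real^'n" where
  "grad \<phi> x = (\<chi> i. partial i \<phi> x)"

primrec Ck :: "nat \<Rightarrow> (real^'n \<Rightarrow> real) \<Rightarrow> bool" where
  "Ck 0 \<phi> \<longleftrightarrow> continuous_on UNIV \<phi>"
| "Ck (Suc m) \<phi> \<longleftrightarrow> (\<forall>x. \<phi> differentiable (at x)) \<and> (\<forall>i. Ck m (partial i \<phi>))"

text \<open>Smooth functions with compact support in \<open>U\<close>.\<close>

definition test_fun :: "(real^'n) set \<Rightarrow> (real^'n \<Rightarrow> real) set" where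
  "test_fun U = {\<phi>. (\<forall>m. Ck m \<phi>) \<and>
     compact (closure {x. \<phi> x \<noteq> 0}) \<and> closure {x. \<phi> x \<noteq> 0} \<subseteq> U}"

text \<open>Distributional gradient and divergence in an open set \<open>U\<close>.\<close>

definition weak_grad :: "(real^'n) set \<Rightarrow> (real^'n \<Rightarrow> real) \<Rightarrow> (real^'n \<Rightarrow> real^'n) \<Rightarrow> bool" where
  "weak_grad U w G \<longleftrightarrow> (\<forall>\<phi>\<in>test_fun U. \<forall>i.
     (LINT x|lebesgue_on U. w x * partial i \<phi> x) = - (LINT x|lebesgue_on U. G x $ i * \<phi> x))"

definition weak_div :: "(real^'n) set \<Rightarrow> (real^'n \<Rightarrow> real^'n) \<Rightarrow> (real^'n \<Rightarrow> real) \<Rightarrow> bool" where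
  "weak_div U v g \<longleftrightarrow> (\<forall>\<phi>\<in>test_fun U. ip U v (grad \<phi>) = - ip U g \<phi>)"

definition Hdiv :: "(real^'n) set \<Rightarrow> (real^'n \<Rightarrow> real^'n) set" where
  "Hdiv U = {v. L2 (lebesgue_on U) v \<and> (\<exists>g. L2 (lebesgue_on U) g \<and> weak_div U v g)}"

text \<open>A representative of the divergence of a field in \<open>Hdiv U\<close>, unique almost everywhere.\<close>

definition wdiv :: "(real^'n) set \<Rightarrow> (real^'n \<Rightarrow> real^'n) \<Rightarrow> real^'n \<Rightarrow> real" where
  "wdiv U v = (SOME g. L2 (lebesgue_on U) g \<and> weak_div U v g)"

text \<open>
  The normal trace of \<open>v\<close> in \<open>Hdiv U\<close> is the functional
  \<open>w \<mapsto> (v, grad w) + (div v, w)\<close> on the Sobolev space \<open>H\<^sup>1(U)\<close>; two fields have the same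
  normal trace on the boundary of \<open>U\<close> if these functionals agree.
\<close>

definition same_normal_trace ::
    "(real^'n) set \<Rightarrow> (real^'n \<Rightarrow> real^'n) \<Rightarrow> (real^'n \<Rightarrow> real^'n) \<Rightarrow> bool" where
  "same_normal_trace U u v \<longleftrightarrow>
     (\<forall>w G. L2 (lebesgue_on U) w \<and> L2 (lebesgue_on U) G \<and> weak_grad U w G \<longrightarrow>
        ip U u G + ip U (wdiv U u) w = ip U v G + ip U (wdiv U v) w)"

section \<open>Domain, cells and mesh\<close>

text \<open>
  Near each boundary point \<open>\<Omega>\<close> is the strict epigraph, in direction \<open>\<nu>\<close>, of a Lipschitz function
  on the hyperplane orthogonal to \<open>\<nu>\<close>.
\<close>

definition lipschitz_domain :: "(real^'n) set \<Rightarrow> bool" where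
  "lipschitz_domain \<Omega> \<longleftrightarrow> open \<Omega> \<and> connected \<Omega> \<and> \<Omega> \<noteq> {} \<and>
     (\<forall>p\<in>frontier \<Omega>. \<exists>r>0. \<exists>\<nu> L. \<exists>\<gamma>::real^'n \<Rightarrow> real.
        norm \<nu> = 1 \<and> L-lipschitz_on {y. y \<bullet> \<nu> = 0} \<gamma> \<and>
        (\<forall>x\<in>ball p r. x \<in> \<Omega> \<longleftrightarrow> \<gamma> (x - (x \<bullet> \<nu>) *\<^sub>R \<nu>) < x \<bullet> \<nu>))"

definition parallelotope :: "real^'n \<Rightarrow> real^'n^'n \<Rightarrow> (real^'n) set" where
  "parallelotope b B = (\<lambda>y. b + B *v y) ` cbox 0 One"

text \<open>The (closed) cells are the affine images of the reference simplex or of the reference cube.\<close>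

definition cell :: "(real^'n) set \<Rightarrow> bool" where
  "cell K \<longleftrightarrow> int CARD('n) simplex K \<or> (\<exists>b B. invertible B \<and> K = parallelotope b B)"

text \<open>
  Lowest-order Raviart--Thomas space of a cell: \<open>a + c x\<close> on a simplex; on a parallelotope the Piola
  images of the fields with components \<open>a\<^sub>i + c\<^sub>i y\<^sub>i\<close> on the reference cube (the determinant is
  absorbed in \<open>a\<close> and \<open>c\<close>). The fields are taken as polynomials on the whole space.
\<close>

definition RT0 :: "(real^'n) set \<Rightarrow> (real^'n \<Rightarrow> real^'n) set" where
  "RT0 K = {v. (int CARD('n) simplex K \<and> (\<exists>a c. \<forall>x. v x = a + c *\<^sub>R x)) \<or>
               (\<exists>b B a c. invertible B \<and> K = parallelotope b B \<and>
                  (\<forall>y. v (b + B *v y) = B *v (\<chi> i. a $ i + c $ i * y $ i)))}"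

abbreviation facets :: "(real^'n) set \<Rightarrow> (real^'n) set set" where
  "facets K \<equiv> {e. e facet_of K}"

definition outer_normal :: "(real^'n) set \<Rightarrow> (real^'n) set \<Rightarrow> real^'n" where
  "outer_normal K e =
     (THE n. norm n = 1 \<and> (\<exists>b. K \<subseteq> {x. n \<bullet> x \<le> b} \<and> e = K \<inter> {x. n \<bullet> x = b}))"

text \<open>
  Surface measure on a flat piece \<open>e\<close> of a hyperplane: the image of Lebesgue measure on the prism
  of height one over \<open>e\<close> under orthogonal projection onto \<open>e\<close>. The choice of the base point and of
  the sign of the normal is immaterial.
\<close>

definition unit_normal :: "(real^'n) set \<Rightarrow> real^'n" where
  "unit_normal e = (SOME n. norm n = 1 \<and> (\<exists>b. \<forall>x\<in>e. n \<bullet> x = b))"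

definition surf :: "(real^'n) set \<Rightarrow> (real^'n) measure" where
  "surf e = (let n = unit_normal e; x\<^sub>0 = (SOME x. x \<in> e) in
     distr (lebesgue_on {x + t *\<^sub>R n | x t. x \<in> e \<and> 0 \<le> t \<and> t \<le> 1}) (restrict_space borel e)
       (\<lambda>y. y - (n \<bullet> (y - x\<^sub>0)) *\<^sub>R n))"

definition mesh :: "(real^'n) set \<Rightarrow> (real^'n) set set \<Rightarrow> bool" where
  "mesh \<Omega> T \<longleftrightarrow> finite T \<and> (\<forall>K\<in>T. cell K) \<and> \<Union>T = closure \<Omega> \<and>
     (\<forall>K\<in>T. \<forall>K'\<in>T. K \<noteq> K' \<longrightarrow> (K \<inter> K') face_of K \<and> (K \<inter> K') face_of K')"

definition mesh_size :: "(real^'n) set set \<Rightarrow> real" where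
  "mesh_size T = Max (diameter ` T)"

definition quasi_uniform :: "real \<Rightarrow> (real^'n) set set \<Rightarrow> bool" where
  "quasi_uniform \<sigma> T \<longleftrightarrow> 0 < \<sigma> \<and> (\<forall>K\<in>T. \<exists>x. cball x (\<sigma> * mesh_size T) \<subseteq> K)"

definition faces :: "(real^'n) set set \<Rightarrow> (real^'n) set set" where
  "faces T = {e. \<exists>K\<in>T. e facet_of K}"

definition interior_faces :: "(real^'n) set \<Rightarrow> (real^'n) set set \<Rightarrow> (real^'n) set set" where
  "interior_faces \<Omega> T = {e \<in> faces T. \<not> e \<subseteq> frontier \<Omega>}"

definition rt0_basis :: "(real^'n) set \<Rightarrow> ((real^'n) set \<Rightarrow> real^'n \<Rightarrow> real^'n) \<Rightarrow> bool" where
  "rt0_basis K rt \<longleftrightarrow> (\<forall>e\<in>facets K. rt e \<in> RT0 K \<and>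
     weak_div (interior K) (rt e) (\<lambda>x. 1 / measure lebesgue K) \<and>
     (\<forall>e'\<in>facets K. \<forall>x\<in>e'. rt e x \<bullet> outer_normal K e' =
        (if e' = e then 1 / measure (surf e) e else 0)))"

text \<open>Elements of \<open>L\<^sup>2\<close> are represented by functions, so all memberships are up to null sets.\<close>

definition Vh :: "(real^'n) set \<Rightarrow> (real^'n) set set \<Rightarrow> (real^'n \<Rightarrow> real^'n) set" where
  "Vh \<Omega> T = {v \<in> Hdiv \<Omega>. \<forall>K\<in>T. \<exists>r\<in>RT0 K. ae_eq K v r}"

definition Qh :: "(real^'n) set set \<Rightarrow> (real^'n \<Rightarrow> real) set" where
  "Qh T = {q. \<forall>K\<in>T. \<exists>c. ae_eq K q (\<lambda>x. c)}"

definition Pi_h :: "(real^'n) set \<Rightarrow> (real^'n) set set \<Rightarrow> (real^'n \<Rightarrow> real) set" where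
  "Pi_h \<Omega> T = {\<pi>. (\<forall>e\<in>interior_faces \<Omega> T. L2 (surf e) \<pi> \<and> (\<exists>c. AE x in surf e. \<pi> x = c)) \<and>
                 (\<forall>e\<in>faces T. e \<subseteq> frontier \<Omega> \<longrightarrow> (AE x in surf e. \<pi> x = 0))}"

section \<open>Oversampling spaces\<close>

definition local_problem ::
    "(real^'n \<Rightarrow> real^'n^'n) \<Rightarrow> (real^'n) set \<Rightarrow> (real^'n \<Rightarrow> real^'n) \<Rightarrow>
     (real^'n \<Rightarrow> real^'n) \<Rightarrow> (real^'n \<Rightarrow> real^'n) \<Rightarrow> (real^'n \<Rightarrow> real) \<Rightarrow> bool" where
  "local_problem k S rt \<eta> \<psi> \<phi> \<longleftrightarrow>
     L2 (lebesgue_on (interior S)) \<eta> \<and> \<psi> \<in> Hdiv (interior S) \<and> L2 (lebesgue_on (interior S)) \<phi> \<and>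
     ae_eq (interior S) (\<lambda>x. \<psi> x + k x *v \<eta> x) (\<lambda>x. 0) \<and>
     weak_grad (interior S) \<phi> \<eta> \<and>
     ae_eq (interior S) (wdiv (interior S) \<psi>) (wdiv (interior S) rt) \<and>
     same_normal_trace (interior S) \<psi> rt"

text \<open>
  The restrictions to \<open>K\<close> of the combinations of the functions \<open>F S\<^sub>K l\<close> on the oversampling block
  \<open>S\<^sub>K\<close> of \<open>K\<close>.
\<close>

definition os_bar ::
    "((real^'n) set \<Rightarrow> (real^'n) set) \<Rightarrow> ((real^'n) set \<Rightarrow> (real^'n) set \<Rightarrow> (real^'n) set \<Rightarrow> real) \<Rightarrow>
     ((real^'n) set \<Rightarrow> (real^'n) set \<Rightarrow> real^'n \<Rightarrow> real^'n) \<Rightarrow>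
     (real^'n) set \<Rightarrow> (real^'n) set \<Rightarrow> real^'n \<Rightarrow> real^'n" where
  "os_bar S c F K e x = (\<Sum>l\<in>facets (S K). c K e l *\<^sub>R F (S K) l x)"

text \<open>
  For local functions \<open>b K e\<close> (one for each facet \<open>e\<close> of \<open>K\<close>): the square integrable fields that
  are on each cell a linear combination of them.
\<close>

definition cellwise_span ::
    "(real^'n) set \<Rightarrow> (real^'n) set set \<Rightarrow> ((real^'n) set \<Rightarrow> (real^'n) set \<Rightarrow> real^'n \<Rightarrow> real^'n) \<Rightarrow>
     (real^'n \<Rightarrow> real^'n) set" where
  "cellwise_span \<Omega> T b = {u. L2 (lebesgue_on \<Omega>) u \<and>
     (\<forall>K\<in>T. \<exists>a. ae_eq K u (\<lambda>x. \<Sum>e\<in>facets K. a e *\<^sub>R b K e x))}"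

definition cellwise_independent ::
    "(real^'n) set set \<Rightarrow> ((real^'n) set \<Rightarrow> (real^'n) set \<Rightarrow> real^'n \<Rightarrow> real^'n) \<Rightarrow> bool" where
  "cellwise_independent T b \<longleftrightarrow> (\<forall>K\<in>T. \<forall>a.
     ae_eq K (\<lambda>x. \<Sum>e\<in>facets K. a e *\<^sub>R b K e x) (\<lambda>x. 0) \<longrightarrow> (\<forall>e\<in>facets K. a e = 0))"

text \<open>
  \<open>M_cell\<close> is the restriction of the operator to one cell, as a polynomial, so that it has values
  on the boundary of the cell; the coefficients are unique if the local functions are independent.
  \<open>M_h\<close> glues these together (with the value 0 on the null set of cell boundaries).
\<close>

definition M_cell ::
    "((real^'n) set \<Rightarrow> (real^'n) set \<Rightarrow> real^'n \<Rightarrow> real^'n) \<Rightarrow>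
     ((real^'n) set \<Rightarrow> (real^'n) set \<Rightarrow> real^'n \<Rightarrow> real^'n) \<Rightarrow>
     (real^'n \<Rightarrow> real^'n) \<Rightarrow> (real^'n) set \<Rightarrow> real^'n \<Rightarrow> real^'n" where
  "M_cell \<psi>b rt u K x =
     (let a = (SOME a. ae_eq K u (\<lambda>x. \<Sum>e\<in>facets K. a e *\<^sub>R \<psi>b K e x))
      in \<Sum>e\<in>facets K. a e *\<^sub>R rt K e x)"

definition M_h ::
    "(real^'n) set set \<Rightarrow> ((real^'n) set \<Rightarrow> (real^'n) set \<Rightarrow> real^'n \<Rightarrow> real^'n) \<Rightarrow>
     ((real^'n) set \<Rightarrow> (real^'n) set \<Rightarrow> real^'n \<Rightarrow> real^'n) \<Rightarrow>
     (real^'n \<Rightarrow> real^'n) \<Rightarrow> real^'n \<Rightarrow> real^'n" where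
  "M_h T \<psi>b rt u x = (\<Sum>K\<in>T. if x \<in> interior K then M_cell \<psi>b rt u K x else 0)"

definition X2 ::
    "(real^'n) set \<Rightarrow> (real^'n) set set \<Rightarrow> ((real^'n) set \<Rightarrow> (real^'n) set \<Rightarrow> real^'n \<Rightarrow> real^'n) \<Rightarrow>
     ((real^'n) set \<Rightarrow> (real^'n) set \<Rightarrow> real^'n \<Rightarrow> real^'n) \<Rightarrow> (real^'n \<Rightarrow> real^'n) set" where
  "X2 \<Omega> T \<psi>b rt = {u \<in> cellwise_span \<Omega> T \<psi>b. M_h T \<psi>b rt u \<in> Vh \<Omega> T}"

definition C_h ::
    "(real^'n) set set \<Rightarrow> ((real^'n) set \<Rightarrow> (real^'n) set \<Rightarrow> real^'n \<Rightarrow> real^'n) \<Rightarrow>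
     ((real^'n) set \<Rightarrow> (real^'n) set \<Rightarrow> real^'n \<Rightarrow> real^'n) \<Rightarrow>
     (real^'n \<Rightarrow> real^'n) \<Rightarrow> (real^'n \<Rightarrow> real) \<Rightarrow> real" where
  "C_h T \<psi>b rt \<tau> \<pi> =
     (\<Sum>K\<in>T. \<Sum>e\<in>facets K. LINT x|surf e. (M_cell \<psi>b rt \<tau> K x \<bullet> outer_normal K e) * \<pi> x)"

section \<open>The two discrete problems\<close>

definition OS_solution ::
    "(real^'n) set \<Rightarrow> (real^'n) set set \<Rightarrow> (real^'n \<Rightarrow> real^'n^'n) \<Rightarrow> (real^'n \<Rightarrow> real) \<Rightarrow>
     ((real^'n) set \<Rightarrow> (real^'n) set \<Rightarrow> real^'n \<Rightarrow> real^'n) \<Rightarrow>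
     ((real^'n) set \<Rightarrow> (real^'n) set \<Rightarrow> real^'n \<Rightarrow> real^'n) \<Rightarrow>
     ((real^'n) set \<Rightarrow> (real^'n) set \<Rightarrow> real^'n \<Rightarrow> real^'n) \<Rightarrow>
     (real^'n \<Rightarrow> real^'n) \<Rightarrow> (real^'n \<Rightarrow> real^'n) \<Rightarrow> (real^'n \<Rightarrow> real) \<Rightarrow> bool" where
  "OS_solution \<Omega> T k f \<eta>b \<psi>b rt \<theta> u p \<longleftrightarrow>
     \<theta> \<in> cellwise_span \<Omega> T \<eta>b \<and> u \<in> X2 \<Omega> T \<psi>b rt \<and> p \<in> Qh T \<and>
     (\<forall>\<xi>\<in>cellwise_span \<Omega> T \<eta>b. ip \<Omega> (\<lambda>x. k x *v \<theta> x) \<xi> + ip \<Omega> u \<xi> = 0) \<and>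
     (\<forall>\<tau>\<in>X2 \<Omega> T \<psi>b rt. ip \<Omega> \<theta> \<tau> + (\<Sum>K\<in>T. ip K p (wdiv (interior K) \<tau>)) = 0) \<and>
     (\<forall>q\<in>Qh T. (\<Sum>K\<in>T. ip K (wdiv (interior K) u) q) = ip \<Omega> f q)"

definition HOS_solution ::
    "(real^'n) set \<Rightarrow> (real^'n) set set \<Rightarrow> (real^'n \<Rightarrow> real^'n^'n) \<Rightarrow> (real^'n \<Rightarrow> real) \<Rightarrow>
     ((real^'n) set \<Rightarrow> (real^'n) set \<Rightarrow> real^'n \<Rightarrow> real^'n) \<Rightarrow>
     ((real^'n) set \<Rightarrow> (real^'n) set \<Rightarrow> real^'n \<Rightarrow> real^'n) \<Rightarrow>
     ((real^'n) set \<Rightarrow> (real^'n) set \<Rightarrow> real^'n \<Rightarrow> real^'n) \<Rightarrow>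
     (real^'n \<Rightarrow> real^'n) \<Rightarrow> (real^'n \<Rightarrow> real^'n) \<Rightarrow> (real^'n \<Rightarrow> real) \<Rightarrow>
     (real^'n \<Rightarrow> real) \<Rightarrow> bool" where
  "HOS_solution \<Omega> T k f \<eta>b \<psi>b rt \<theta> u p \<mu> \<longleftrightarrow>
     \<theta> \<in> cellwise_span \<Omega> T \<eta>b \<and> u \<in> cellwise_span \<Omega> T \<psi>b \<and> p \<in> Qh T \<and> \<mu> \<in> Pi_h \<Omega> T \<and>
     (\<forall>\<xi>\<in>cellwise_span \<Omega> T \<eta>b. ip \<Omega> (\<lambda>x. k x *v \<theta> x) \<xi> + ip \<Omega> u \<xi> = 0) \<and>
     (\<forall>\<tau>\<in>cellwise_span \<Omega> T \<psi>b.
        ip \<Omega> \<theta> \<tau> + (\<Sum>K\<in>T. ip K p (wdiv (interior K) \<tau>)) = C_h T \<psi>b rt \<tau> \<mu>) \<and>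
     (\<forall>q\<in>Qh T. (\<Sum>K\<in>T. ip K (wdiv (interior K) u) q) = ip \<Omega> f q) \<and>
     (\<forall>\<pi>\<in>Pi_h \<Omega> T. C_h T \<psi>b rt u \<pi> = 0)"

end

theory Submission
  imports Defs
begin

text \<open>
  Why the hybrid problem is well posed and equivalent to the conforming one.

  On each cell \<open>K\<close> an element of the flux space is a combination of the functions \<open>\<psi>b K e\<close>, one for each
  facet \<open>e\<close> of \<open>K\<close>, with unique coefficients \<open>a K e\<close>. Since every local solution satisfies
  \<open>\<psi> = - k \<eta>\<close> and \<open>k\<close> is uniformly positive, the first equation says exactly that the gradient
  variable has the same coefficients \<open>a\<close> with respect to the \<open>\<eta>b K e\<close> (\<open>first_equation_iff\<close>). The fields
  \<open>\<psi>b K e\<close> and \<open>rt K e\<close> have the same weak divergence \<open>1 / |K|\<close> on \<open>K\<close> (\<open>weak_div_psib\<close>), hence the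
  pressure terms become \<open>p K * (\<Sum>e. a K e)\<close>. As \<open>rt K e\<close> has total flux 1 through \<open>e\<close> and none through the
  other facets, the multiplier term becomes \<open>\<Sum>K. \<Sum>e. a K e * m e\<close> (\<open>C_h_eq\<close>). Both discrete problems are
  therefore finite linear systems for the coefficients (\<open>HOS_iff\<close>, \<open>OS_iff\<close>).

  The two systems have the same constraint. The multiplier equation says that at every interior face
  the coefficients of the adjacent cells add up to 0, and this is equivalent to the
  Raviart--Thomas image of the flux lying in \<open>H(div)\<close> (\<open>rt_field_Hdiv_iff\<close>). The equivalence is
  integration by parts on the cells: the mean of a test function over a face is the only boundary term of
  \<open>rt K e\<close> (\<open>rt0_basis_green\<close>), and it does not depend on the cell from which the face is seen. It rests
  on a divergence theorem for convex polytopes (\<open>divergence_theorem_polytope\<close>), obtained by slicing along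
  lines: on almost every line the polytope is an interval whose two ends lie on exactly one facet each, the
  fundamental theorem of calculus applies, and the flux of the lines through a facet is the surface measure
  of the facet times the cosine of the angle of incidence. Uniqueness of weak divergences is the fundamental lemma
  of the calculus of variations, for which smooth bump functions are constructed from \<open>exp (- 1 / x)\<close>.

  Uniqueness for the hybrid system: with zero data, testing with the solution gives
  \<open>(\<theta>, u) = - (\<theta>, k \<theta>) = 0\<close>, so \<open>\<theta>\<close> and \<open>u\<close> vanish. Then \<open>p K = m e\<close> for every facet \<open>e\<close> of every cell \<open>K\<close>,
  so the pressure is constant across interior faces, and it is 0 on cells that touch the boundary by a
  facet. A bounded set of cells cannot be closed under passing through all facets
  (\<open>no_closed_facet_pairing\<close>), hence \<open>p\<close> and \<open>m\<close> vanish. The system is square, so it is solvable for all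
  data (\<open>hos_system_exists\<close>). A solution of the hybrid problem solves the conforming one, because the
  multiplier term vanishes on the constrained space. For uniqueness of the conforming pressure, the solvability of
  the hybrid system supplies a constrained flux with any prescribed cell divergences.
\<close>

section \<open>Square linear systems\<close>

text \<open>
  Uniqueness implies solvability, for systems indexed by arbitrary finite sets; by Gaussian elimination of
  one row and one column.
\<close>

lemma square_system_solvable:
  fixes M :: "'i \<Rightarrow> 'j \<Rightarrow> real"
  assumes "finite I" "finite J" "card I = card J"
    and "\<And>x. (\<forall>i\<in>I. (\<Sum>j\<in>J. M i j * x j) = 0) \<Longrightarrow> (\<forall>j\<in>J. x j = 0)"
  shows "\<exists>x. \<forall>i\<in>I. (\<Sum>j\<in>J. M i j * x j) = b i"
  using assms(2,1,3,4)
proof (induction J arbitrary: I M b rule: finite_induct)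
  case empty
  then show ?case by auto
next
  case (insert j0 J)
  have "\<exists>i0\<in>I. M i0 j0 \<noteq> 0"
  proof (rule ccontr)
    assume "\<not> ?thesis"
    then have "\<forall>i\<in>I. (\<Sum>j\<in>insert j0 J. M i j * (if j = j0 then 1 else 0)) = 0"
      by (auto intro!: sum.neutral)
    from insert.prems(3)[OF this] show False by auto
  qed
  then obtain i0 where i0: "i0 \<in> I" "M i0 j0 \<noteq> 0" by blast
  \<comment> \<open>Schur complement of the pivot \<open>M i0 j0\<close>\<close>
  define N where "N i j = M i j - M i j0 * M i0 j / M i0 j0" for i j
  define d where "d i = b i - M i j0 * b i0 / M i0 j0" for i
  have *: "(\<Sum>j\<in>J. N i j * x j) = (\<Sum>j\<in>J. M i j * x j) - M i j0 / M i0 j0 * (\<Sum>j\<in>J. M i0 j * x j)" for i x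
    by (simp add: N_def left_diff_distrib sum_subtractf sum_distrib_left mult.assoc)
  have "\<exists>x. \<forall>i\<in>I - {i0}. (\<Sum>j\<in>J. N i j * x j) = d i"
  proof (rule insert.IH)
    show "finite (I - {i0})" using insert by auto
    show "card (I - {i0}) = card J" using insert i0 by simp
    fix x assume x: "\<forall>i\<in>I - {i0}. (\<Sum>j\<in>J. N i j * x j) = 0"
    define y where "y = x(j0 := - (\<Sum>j\<in>J. M i0 j * x j) / M i0 j0)"
    have yJ: "(\<Sum>j\<in>J. M i j * y j) = (\<Sum>j\<in>J. M i j * x j)" for i
      by (rule sum.cong) (use insert in \<open>auto simp: y_def\<close>)
    have "\<forall>i\<in>I. (\<Sum>j\<in>insert j0 J. M i j * y j) = 0"
    proof
      fix i assume "i \<in> I"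
      have "(\<Sum>j\<in>insert j0 J. M i j * y j) =
          (\<Sum>j\<in>J. M i j * x j) - M i j0 / M i0 j0 * (\<Sum>j\<in>J. M i0 j * x j)"
        using insert.hyps by (simp add: yJ) (simp add: y_def)
      also have "\<dots> = 0"
        using x[rule_format, of i] \<open>i \<in> I\<close> *[of i x] i0 by (cases "i = i0") auto
      finally show "(\<Sum>j\<in>insert j0 J. M i j * y j) = 0" .
    qed
    from insert.prems(3)[OF this] show "\<forall>j\<in>J. x j = 0"
      using insert.hyps unfolding y_def by (metis fun_upd_other insertI2)
  qed
  then obtain x where x: "\<forall>i\<in>I - {i0}. (\<Sum>j\<in>J. N i j * x j) = d i" by blast
  define y where "y = x(j0 := (b i0 - (\<Sum>j\<in>J. M i0 j * x j)) / M i0 j0)"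
  have yJ: "(\<Sum>j\<in>J. M i j * y j) = (\<Sum>j\<in>J. M i j * x j)" for i
    by (rule sum.cong) (use insert in \<open>auto simp: y_def\<close>)
  have "\<forall>i\<in>I. (\<Sum>j\<in>insert j0 J. M i j * y j) = b i"
  proof
    fix i assume "i \<in> I"
    have "(\<Sum>j\<in>insert j0 J. M i j * y j) =
        (\<Sum>j\<in>J. M i j * x j) - M i j0 / M i0 j0 * (\<Sum>j\<in>J. M i0 j * x j) + M i j0 / M i0 j0 * b i0"
      using insert.hyps by (simp add: yJ) (simp add: y_def algebra_simps diff_divide_distrib)
    also have "\<dots> = b i"
      using x[rule_format, of i] \<open>i \<in> I\<close> *[of i x] i0 by (cases "i = i0") (auto simp: d_def)
    finally show "(\<Sum>j\<in>insert j0 J. M i j * y j) = b i" .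
  qed
  then show ?case by blast
qed

section \<open>Smooth bump functions\<close>

text \<open>
  The function \<open>q(1/x) exp(-1/x)\<close>, extended by 0 to the left half line, for a polynomial \<open>q\<close>. The class of
  these functions is closed under differentiation, which makes all of them smooth.
\<close>

definition flat_exp :: "real poly \<Rightarrow> real \<Rightarrow> real" where
  "flat_exp q x = (if x \<le> 0 then 0 else poly q (1 / x) * exp (- (1 / x)))"

lemma poly_exp_tendsto_0:
  "((\<lambda>y. poly q y * exp (- y)) \<longlongrightarrow> 0) at_top" for q :: "real poly"
proof -
  have "((\<lambda>y. \<Sum>i\<le>degree q. coeff q i * (y ^ i / exp y)) \<longlongrightarrow> (\<Sum>i\<le>degree q. coeff q i * 0)) at_top"
    by (intro tendsto_intros tendsto_power_div_exp_0)
  then show ?thesis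
    by (simp add: poly_altdef sum_distrib_right exp_minus divide_inverse mult.assoc)
qed

lemma flat_exp_tendsto_0: "(flat_exp q \<longlongrightarrow> 0) (at 0)"
proof -
  have "((\<lambda>x. poly q (inverse x) * exp (- inverse x)) \<longlongrightarrow> 0) (at_right 0)"
    using poly_exp_tendsto_0[of q] filterlim_inverse_at_top_right
    by (rule filterlim_compose)
  then have "(flat_exp q \<longlongrightarrow> 0) (at_right 0)"
    by (rule Lim_transform_eventually)
      (auto simp: eventually_at_filter flat_exp_def divide_inverse)
  moreover have "(flat_exp q \<longlongrightarrow> 0) (at_left 0)"
    by (rule tendsto_eventually) (auto simp: eventually_at_filter flat_exp_def)
  ultimately show ?thesis by (rule filterlim_split_at[rotated])
qed

lemma flat_exp_deriv:
  "(flat_exp q has_real_derivative flat_exp ([:0, 0, 1:] * (q - pderiv q)) x) (at x)"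
proof -
  consider "x < 0" | "x = 0" | "x > 0" by linarith
  then show ?thesis
  proof cases
    case 1
    have "((\<lambda>x. 0) has_real_derivative 0) (at x)" by simp
    then have "(flat_exp q has_real_derivative 0) (at x)"
      by (rule has_field_derivative_transform_within_open[where S="{..<0}"])
        (use 1 in \<open>auto simp: flat_exp_def\<close>)
    then show ?thesis using 1 by (simp add: flat_exp_def)
  next
    case 2
    have "(flat_exp ([:0, 1:] * q) \<longlongrightarrow> 0) (at 0)" by (rule flat_exp_tendsto_0)
    then have "((\<lambda>h. (flat_exp q h - flat_exp q 0) / h) \<longlongrightarrow> 0) (at 0)"
      by (rule Lim_transform_eventually)
        (auto simp: eventually_at_filter flat_exp_def divide_inverse)
    then show ?thesis using 2 by (simp add: DERIV_def) (simp add: flat_exp_def)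
  next
    case 3
    have "((\<lambda>x. poly q (1 / x) * exp (- (1 / x))) has_real_derivative
        flat_exp ([:0, 0, 1:] * (q - pderiv q)) x) (at x)"
    proof -
      have i: "((\<lambda>x. 1 / x) has_real_derivative - (1 / x\<^sup>2)) (at x)"
        using DERIV_inverse[of x] 3 by (simp add: inverse_eq_divide power2_eq_square)
      have "((\<lambda>x. poly q (1 / x) * exp (- (1 / x))) has_real_derivative
          poly (pderiv q) (1 / x) * - (1 / x\<^sup>2) * exp (- (1 / x)) +
          exp (- (1 / x)) * - (- (1 / x\<^sup>2)) * poly q (1 / x)) (at x)"
        using DERIV_mult[OF DERIV_chain2[OF poly_DERIV[of q] i] DERIV_fun_exp[OF DERIV_minus[OF i]]]
        by (simp add: algebra_simps)
      moreover have "poly (pderiv q) (1 / x) * - (1 / x\<^sup>2) * exp (- (1 / x)) +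
          exp (- (1 / x)) * - (- (1 / x\<^sup>2)) * poly q (1 / x) =
          flat_exp ([:0, 0, 1:] * (q - pderiv q)) x"
        using 3 by (simp add: flat_exp_def power2_eq_square algebra_simps)
      ultimately show ?thesis by simp
    qed
    then show ?thesis
      by (rule has_field_derivative_transform_within_open[where S="{0<..}"])
        (use 3 in \<open>auto simp: flat_exp_def\<close>)
  qed
qed

lemma partial_eq:
  "(f has_derivative D) (at x) \<Longrightarrow> partial i f x = D (axis i 1)"
  unfolding partial_def using frechet_derivative_at by metis

lemma has_derivative_grad:
  fixes f :: "real^'n \<Rightarrow> real"
  assumes "f differentiable (at x)"
  shows "(f has_derivative (\<lambda>h. grad f x \<bullet> h)) (at x)"
proof -
  let ?D = "frechet_derivative f (at x)"
  have D: "(f has_derivative ?D) (at x)" using assms frechet_derivative_works by blast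
  then have lin: "linear ?D" using has_derivative_linear by blast
  have "?D h = grad f x \<bullet> h" for h
  proof -
    have "?D h = ?D (\<Sum>i\<in>UNIV. (h $ i) *\<^sub>R axis i 1)"
      using basis_expansion[of h] by (simp add: scalar_mult_eq_scaleR)
    also have "\<dots> = (\<Sum>i\<in>UNIV. h $ i * partial i f x)"
      by (simp add: linear_sum[OF lin] linear_scale[OF lin] partial_def)
    finally show ?thesis by (simp add: inner_vec_def grad_def mult.commute)
  qed
  then show ?thesis using D by (metis (no_types, lifting) ext)
qed

lemma Ck_continuous: "Ck m f \<Longrightarrow> continuous_on UNIV f"
  by (cases m) (auto simp: continuous_on_eq_continuous_at differentiable_imp_continuous_within)

text \<open>
  The predicate \<open>Ck (Suc m)\<close> asks for differentiability only, with partial derivatives in \<open>Ck m\<close>, so that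
  monotonicity in \<open>m\<close> uses that differentiable functions are continuous.
\<close>

lemma Ck_SucD: "Ck (Suc m) f \<Longrightarrow> Ck m f"
proof (induction m arbitrary: f)
  case 0
  then show ?case using Ck_continuous[of "Suc 0" f] by simp
next
  case (Suc m)
  then show ?case by simp
qed

lemma Ck_const: "Ck m (\<lambda>x. c)"
proof (induction m arbitrary: c)
  case (Suc m)
  have "partial i (\<lambda>x. c) = (\<lambda>x. 0)" for i :: 'a
    by (rule ext, rule partial_eq[where D="\<lambda>_. 0", simplified]) simp
  with Suc show ?case by simp
qed simp

lemma partial_add:
  "f differentiable (at x) \<Longrightarrow> g differentiable (at x) \<Longrightarrow>
    partial i (\<lambda>x. f x + g x) x = partial i f x + partial i g x"
  by (rule partial_eq[THEN trans], rule has_derivative_add[OF has_derivative_grad has_derivative_grad])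
    (simp_all add: grad_def inner_axis)

lemma partial_mult:
  "f differentiable (at x) \<Longrightarrow> g differentiable (at x) \<Longrightarrow>
    partial i (\<lambda>x. f x * g x) x = f x * partial i g x + partial i f x * g x"
  by (rule partial_eq[THEN trans], rule has_derivative_mult[OF has_derivative_grad has_derivative_grad])
    (simp_all add: grad_def inner_axis)

lemma Ck_add: "Ck m f \<Longrightarrow> Ck m g \<Longrightarrow> Ck m (\<lambda>x. f x + g x)"
proof (induction m arbitrary: f g)
  case 0
  then show ?case by (simp add: continuous_on_add continuous_on_mult)
next
  case (Suc m)
  have "partial i (\<lambda>x. f x + g x) = (\<lambda>x. partial i f x + partial i g x)" for i
    using Suc.prems by (intro ext partial_add) auto
  with Suc show ?case by (auto intro: differentiable_add)
qed

lemma Ck_mult: "Ck m f \<Longrightarrow> Ck m g \<Longrightarrow> Ck m (\<lambda>x. f x * g x)"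
proof (induction m arbitrary: f g)
  case 0
  then show ?case by (simp add: continuous_on_add continuous_on_mult)
next
  case (Suc m)
  have "partial i (\<lambda>x. f x * g x) = (\<lambda>x. f x * partial i g x + partial i f x * g x)" for i
    using Suc.prems by (intro ext partial_mult) auto
  with Suc show ?case
    using Ck_SucD[OF Suc.prems(1)] Ck_SucD[OF Suc.prems(2)]
    by (auto intro!: differentiable_mult Ck_add)
qed

lemma Ck_prod: "finite A \<Longrightarrow> (\<And>i. i \<in> A \<Longrightarrow> Ck m (f i)) \<Longrightarrow> Ck m (\<lambda>x. \<Prod>i\<in>A. f i x)"
  by (induction A rule: finite_induct) (auto intro: Ck_const Ck_mult)

lemma Ck_flat_exp: "Ck m (\<lambda>x::real^'n. flat_exp q (c * x $ i + d))"
proof (induction m arbitrary: q)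
  case 0
  have "isCont (flat_exp q) x" for x
    using flat_exp_deriv DERIV_isCont by blast
  then have "continuous_on UNIV (flat_exp q)" by (simp add: continuous_on_eq_continuous_at)
  then show ?case
    using continuous_on_compose2[where f="\<lambda>x. c * x $ i + d" and t=UNIV and s=UNIV and g="flat_exp q"]
    by (simp add: continuous_on_add continuous_on_mult continuous_on_component)
next
  case (Suc m)
  let ?q = "[:0, 0, 1:] * (q - pderiv q)"
  have D: "((\<lambda>x::real^'n. flat_exp q (c * x $ i + d)) has_derivative
      (\<lambda>h. flat_exp ?q (c * x $ i + d) * (c * h $ i))) (at x)" for x
  proof -
    have "(flat_exp q has_derivative (\<lambda>h. flat_exp ?q (c * x $ i + d) * h)) (at (c * x $ i + d))"
      using flat_exp_deriv[of q "c * x $ i + d"] unfolding has_field_derivative_def .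
    moreover have "((\<lambda>x::real^'n. c * x $ i + d) has_derivative (\<lambda>h. c * h $ i)) (at x)"
      using has_derivative_add[OF bounded_linear_imp_has_derivative[OF
          bounded_linear_const_mult[OF bounded_linear_vec_nth, of c i]] has_derivative_const[of d]]
      by simp
    ultimately show ?thesis
      using has_derivative_compose[of "\<lambda>x. c * x $ i + d" "\<lambda>h. c * h $ i" x UNIV "flat_exp q"
          "\<lambda>h. flat_exp ?q (c * x $ i + d) * h"] by (simp add: o_def)
  qed
  have "partial j (\<lambda>x::real^'n. flat_exp q (c * x $ i + d)) =
     (\<lambda>x. flat_exp ?q (c * x $ i + d) * (c * axis j 1 $ i))" for j
    by (rule ext) (rule partial_eq[OF D])
  moreover have "Ck m (\<lambda>x::real^'n. flat_exp ?q (c * x $ i + d) * (c * axis j 1 $ i))" for j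
    by (intro Ck_mult Ck_const Suc)
  ultimately show ?case
    using D unfolding Ck.simps differentiable_def by metis
qed

text \<open>
  A smooth function that is positive exactly on the open box; the parameter \<open>m\<close> steepens the flanks, so that
  the functions increase to the indicator function of the box.
\<close>

definition box_bump :: "real^'n \<Rightarrow> real^'n \<Rightarrow> nat \<Rightarrow> real^'n \<Rightarrow> real" where
  "box_bump a b m x = (\<Prod>i\<in>UNIV. flat_exp 1 (real (Suc m) * x $ i + (- (real (Suc m) * a $ i))) *
                                   flat_exp 1 (- real (Suc m) * x $ i + real (Suc m) * b $ i))"

lemma Ck_box_bump: "Ck l (box_bump a b m)"
  unfolding box_bump_def[abs_def] by (intro Ck_prod Ck_mult Ck_flat_exp) auto

lemma flat_exp_1: "flat_exp 1 x = (if x \<le> 0 then 0 else exp (- (1 / x)))"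
  by (simp add: flat_exp_def)

lemma box_bump_nonneg: "0 \<le> box_bump a b m x"
  unfolding box_bump_def by (intro prod_nonneg) (auto simp: flat_exp_1)

lemma box_bump_le_1: "box_bump a b m x \<le> 1"
  unfolding box_bump_def by (intro prod_le_1 conjI mult_le_one mult_nonneg_nonneg) (simp_all add: flat_exp_1)

lemma scaled_less_iff: "real (Suc m) * s + (- (real (Suc m) * t)) \<le> 0 \<longleftrightarrow> s \<le> t"
   "- real (Suc m) * s + real (Suc m) * t \<le> 0 \<longleftrightarrow> t \<le> s"
  by (simp_all del: of_nat_Suc)

lemma box_bump_pos: "x \<in> box a b \<Longrightarrow> 0 < box_bump a b m x"
  unfolding box_bump_def mem_box_cart
  by (intro prod_pos) (simp add: flat_exp_1 scaled_less_iff not_le del: of_nat_Suc)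

lemma box_bump_zero: "x \<notin> box a b \<Longrightarrow> box_bump a b m x = 0"
  unfolding box_bump_def mem_box_cart
  by (rule prod_zero) (auto simp: flat_exp_1 scaled_less_iff not_less simp del: of_nat_Suc)

lemma box_bump_tendsto: "(x::real^'n) \<in> box a b \<Longrightarrow> (\<lambda>m. box_bump a b m x) \<longlonglongrightarrow> 1"
proof -
  assume x: "x \<in> box a b"
  have 1: "(\<lambda>m. flat_exp 1 (real (Suc m) * s)) \<longlonglongrightarrow> 1" if "s > 0" for s
  proof -
    have "(\<lambda>m. exp (- (1 / s * (1 / real (Suc m))))) \<longlonglongrightarrow> exp (- (1 / s * 0))"
      by (intro tendsto_intros LIMSEQ_Suc[OF lim_1_over_n])
    moreover have "flat_exp 1 (real (Suc m) * s) = exp (- (1 / s * (1 / real (Suc m))))" for m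
    proof -
      have "0 < s * real (Suc m)" using that by simp
      then show ?thesis by (simp add: flat_exp_1 mult.commute del: of_nat_Suc)
    qed
    ultimately show ?thesis by (simp del: of_nat_Suc)
  qed
  have "(\<lambda>m. box_bump a b m x) \<longlonglongrightarrow> (\<Prod>i\<in>(UNIV::'n set). 1 * 1)"
    unfolding box_bump_def
  proof (intro tendsto_prod tendsto_mult)
    fix i
    show "(\<lambda>m. flat_exp 1 (real (Suc m) * x $ i + - (real (Suc m) * a $ i))) \<longlonglongrightarrow> 1"
      using 1[of "x $ i - a $ i"] x by (simp add: mem_box_cart right_diff_distrib del: of_nat_Suc)
    show "(\<lambda>m. flat_exp 1 (- real (Suc m) * x $ i + real (Suc m) * b $ i)) \<longlonglongrightarrow> 1"
      using 1[of "b $ i - x $ i"] x by (simp add: mem_box_cart right_diff_distrib del: of_nat_Suc)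
  qed
  then show ?thesis by simp
qed

lemma box_bump_test_fun:
  assumes "cbox a b \<subseteq> U"
  shows "box_bump a b m \<in> test_fun U"
proof -
  have "closure {x. box_bump a b m x \<noteq> 0} \<subseteq> cbox a b"
    by (rule closure_minimal) (use box_bump_zero box_subset_cbox in blast)+
  moreover have "compact (closure {x. box_bump a b m x \<noteq> 0})"
    unfolding compact_closure
    by (rule bounded_subset[OF bounded_cbox[of a b]]) (use box_bump_zero box_subset_cbox in blast)
  ultimately show ?thesis
    unfolding test_fun_def using assms Ck_box_bump by blast
qed

section \<open>The fundamental lemma of the calculus of variations\<close>

text \<open>
  Lebesgue measure is complete, so measurability, integrability and the integral are invariant under changes
  on null sets without measurability assumptions on the second function.
\<close>

lemma measurable_lebesgue_AE:
  fixes f g :: "'a::euclidean_space \<Rightarrow> 'b::topological_space"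
  assumes f: "f \<in> borel_measurable lebesgue" and ae: "AE x in lebesgue. f x = g x"
  shows "g \<in> borel_measurable lebesgue"
proof (rule measurableI)
  fix A :: "'b set" assume "A \<in> sets borel"
  then have m: "f -` A \<inter> space lebesgue \<in> sets lebesgue" by (rule measurable_sets[OF f])
  have ae':  "AE x in lebesgue. (x \<in> f -` A \<inter> space lebesgue) = (x \<in> g -` A \<inter> space lebesgue)"
    using ae by eventually_elim auto
  show "g -` A \<inter> space lebesgue \<in> sets lebesgue"
    by (rule completion.in_sets_AE[OF ae' m]) simp
qed simp

lemma integral_lebesgue_cong_AE:
  fixes f g :: "'a::euclidean_space \<Rightarrow> 'b::{banach, second_countable_topology}"
  assumes ae: "AE x in lebesgue. f x = g x"
  shows "integrable lebesgue f \<longleftrightarrow> integrable lebesgue g"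
    and "integral\<^sup>L lebesgue f = integral\<^sup>L lebesgue g"
proof -
  have ae': "AE x in lebesgue. g x = f x" using ae by eventually_elim auto
  have m: "f \<in> borel_measurable lebesgue \<longleftrightarrow> g \<in> borel_measurable lebesgue"
    using measurable_lebesgue_AE[OF _ ae] measurable_lebesgue_AE[OF _ ae'] by blast
  show i: "integrable lebesgue f \<longleftrightarrow> integrable lebesgue g"
    using m integrable_cong_AE[of f lebesgue g] ae borel_measurable_integrable by metis
  show "integral\<^sup>L lebesgue f = integral\<^sup>L lebesgue g"
    using i m integral_cong_AE[of f lebesgue g] ae
    by (cases "f \<in> borel_measurable lebesgue")
      (auto simp: not_integrable_integral_eq borel_measurable_integrable)
qed

lemma AE_lebesgue_on_iff:
  "D \<in> sets lebesgue \<Longrightarrow> (AE x in lebesgue_on D. P x) \<longleftrightarrow> (AE x in lebesgue. x \<in> D \<longrightarrow> P x)"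
  by (simp add: AE_restrict_space_iff)

lemma integral_lebesgue_on:
  fixes f :: "'a::euclidean_space \<Rightarrow> 'b::{banach, second_countable_topology}"
  shows "D \<in> sets lebesgue \<Longrightarrow> integral\<^sup>L (lebesgue_on D) f = integral\<^sup>L lebesgue (\<lambda>x. indicator D x *\<^sub>R f x)"
  by (simp add: integral_restrict_space)

lemma integrable_lebesgue_on:
  fixes f :: "'a::euclidean_space \<Rightarrow> 'b::{banach, second_countable_topology}"
  shows "D \<in> sets lebesgue \<Longrightarrow> integrable (lebesgue_on D) f \<longleftrightarrow> integrable lebesgue (\<lambda>x. indicator D x *\<^sub>R f x)"
  by (simp add: integrable_restrict_space)

text \<open>
  The boxes generate the Borel sets and are stable under intersection, so the integral of \<open>G\<close> over every Borel subset of
  the open box vanishes.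
\<close>

lemma integral_box_zero_imp_AE_zero:
  fixes G :: "real^'n \<Rightarrow> real"
  assumes G: "integrable lebesgue G"
    and zero: "\<And>a b. cbox a b \<subseteq> cbox c d \<Longrightarrow> (LINT x|lebesgue. indicator (box a b) x * G x) = 0"
  shows "AE x in lebesgue. x \<in> box c d \<longrightarrow> G x = 0"
proof -
  let ?F = "\<lambda>x. indicator (box c d) x * G x"
  have F: "integrable lebesgue ?F"
    by (rule integrable_mult_indicator[where 'b=real, simplified]) (use G in auto)
  obtain H where H: "H \<in> borel_measurable lborel" "AE x in lborel. ?F x = H x"
    using completion_ex_borel_measurable_real[OF borel_measurable_integrable[OF F]] by blast
  have ae: "AE x in lebesgue. ?F x = H x" using H(2) by (rule AE_completion)
  have "integrable lebesgue H" using integral_lebesgue_cong_AE(1)[OF ae] F by simp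
  then have Hi: "integrable lborel H" using integrable_completion[OF H(1)] by simp
  have HA: "(LINT x|lborel. indicator A x * H x) = (LINT x|lebesgue. indicator A x * ?F x)"
    if "A \<in> sets borel" for A
  proof -
    have "(LINT x|lborel. indicator A x * H x) = (LINT x|lebesgue. indicator A x * H x)"
      using that H(1) by (subst integral_completion) auto
    also have "\<dots> = (LINT x|lebesgue. indicator A x * ?F x)"
      by (rule integral_lebesgue_cong_AE(2)) (use ae in \<open>eventually_elim, simp\<close>)
    finally show ?thesis .
  qed
  have box0: "(LINT x|lborel. indicator (box a b) x * H x) = 0" for a b
  proof -
    obtain e f where ef: "box a b \<inter> box c d = box e f" using box_Int_box by blast
    have "(LINT x|lborel. indicator (box a b) x * H x) = (LINT x|lebesgue. indicator (box e f) x * G x)"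
      unfolding ef[symmetric]
      by (subst HA) (auto intro!: Bochner_Integration.integral_cong simp: indicator_def)
    also have "\<dots> = 0"
    proof (cases "box e f = {}")
      case False
      then have "cbox e f = closure (box e f)" by simp
      also have "\<dots> \<subseteq> cbox c d" using ef box_subset_cbox by (intro closure_minimal) auto
      finally show ?thesis by (rule zero)
    qed simp
    finally show ?thesis .
  qed
  have all0: "(LINT x|lborel. indicator A x * H x) = 0" if "A \<in> sets borel" for A
  proof -
    let ?B = "range (\<lambda>(a, b). box a b :: (real^'n) set)"
    have "box a b \<inter> box a' b' \<in> ?B" for a b a' b' :: "real^'n"
      using box_Int_box[of a b a' b'] by auto
    then have "Int_stable ?B" unfolding Int_stable_def by auto
    moreover have "?B \<subseteq> Pow UNIV" by simp
    moreover have "A \<in> sigma_sets UNIV ?B"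
      using that unfolding borel_eq_box by simp
    ultimately show ?thesis
    proof (induction rule: sigma_sets_induct_disjoint)
      case (basic A) then show ?case using box0 by auto
    next
      case empty then show ?case by simp
    next
      case (compl A)
      then have [measurable]: "A \<in> sets borel" by (simp add: borel_eq_box)
      have "(LINT x|lborel. indicator (UNIV - A) x * H x) =
        (LINT x|lborel. H x - indicator A x * H x)"
        by (intro Bochner_Integration.integral_cong) (auto simp: indicator_def)
      also have "\<dots> = (LINT x|lborel. H x) - (LINT x|lborel. indicator A x * H x)"
        using Hi integrable_mult_indicator[where 'b=real, OF _ Hi, of A]
        by (intro Bochner_Integration.integral_diff) auto
      finally have "(LINT x|lborel. indicator (UNIV - A) x * H x) =
        (LINT x|lborel. H x) - (LINT x|lborel. indicator A x * H x)" .
      moreover have "(LINT x|lborel. H x) = 0"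
      proof -
        have "(LINT x|lborel. H x) = (LINT x|lebesgue. ?F x)" using HA[of UNIV] by simp
        also have "\<dots> = 0" by (rule zero) simp
        finally show ?thesis .
      qed
      ultimately show ?case using compl by simp
    next
      case (union A)
      then have m: "A i \<in> sets lborel" for i by (auto simp: borel_eq_box)
      have "set_lebesgue_integral lborel (\<Union>i. A i) H = (\<Sum>i. set_lebesgue_integral lborel (A i) H)"
      proof (rule lebesgue_integral_countable_add)
        show "set_integrable lborel (\<Union>i. A i) H"
          unfolding set_integrable_def by (rule integrable_mult_indicator) (use m Hi in auto)
      qed (use m union in \<open>auto simp: disjoint_family_on_def\<close>)
      then show ?case using union by (simp add: set_lebesgue_integral_def)
    qed
  qed
  have "AE x in lborel. H x = 0"
    by (rule sigma_finite_measure.density_zero[OF sigma_finite_lborel Hi]) (use all0 in \<open>simp add: set_lebesgue_integral_def\<close>)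
  then have "AE x in lebesgue. H x = 0" by (rule AE_completion)
  with ae show ?thesis by eventually_elim (auto simp: indicator_def)
qed

lemma AE_zero_if_orthogonal_to_test_funs:
  fixes g :: "real^'n \<Rightarrow> real"
  assumes U: "open U" and g: "integrable (lebesgue_on U) g"
    and orth: "\<And>\<phi>. \<phi> \<in> test_fun U \<Longrightarrow> (LINT x|lebesgue_on U. g x * \<phi> x) = 0"
  shows "AE x in lebesgue_on U. g x = 0"
proof -
  have Um: "U \<in> sets lebesgue" using U by simp
  define G where "G x = indicator U x * g x" for x
  have G: "integrable lebesgue G"
    using g Um by (simp add: integrable_lebesgue_on G_def[abs_def])
  have box0: "(LINT x|lebesgue. indicator (box a b) x * G x) = 0" if ab: "cbox a b \<subseteq> U" for a b
  proof -
    have "(\<lambda>m. LINT x|lebesgue. box_bump a b m x * G x) \<longlonglongrightarrow> (LINT x|lebesgue. indicator (box a b) x * G x)"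
    proof (rule integral_dominated_convergence[where w="\<lambda>x. norm (G x)"])
      show "integrable lebesgue (\<lambda>x. norm (G x))" using G by simp
      show "(\<lambda>x. indicator (box a b) x * G x) \<in> borel_measurable lebesgue"
        by (intro borel_measurable_times borel_measurable_integrable[OF G] borel_measurable_indicator) (simp add: fmeasurableD)
      have "box_bump a b m \<in> borel_measurable borel" for m
        using Ck_continuous[OF Ck_box_bump[of 0 a b m]] by (rule borel_measurable_continuous_onI)
      then show "(\<lambda>x. box_bump a b m x * G x) \<in> borel_measurable lebesgue" for m
        by (intro borel_measurable_times borel_measurable_integrable[OF G]) (auto intro: measurable_completion)
      show "AE x in lebesgue. (\<lambda>m. box_bump a b m x * G x) \<longlonglongrightarrow> indicator (box a b) x * G x"
      proof (rule AE_I2)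
        fix x
        have "(\<lambda>m. box_bump a b m x) \<longlonglongrightarrow> indicator (box a b) x"
          using box_bump_tendsto[of x a b] box_bump_zero[of x a b] by (cases "x \<in> box a b") auto
        then show "(\<lambda>m. box_bump a b m x * G x) \<longlonglongrightarrow> indicator (box a b) x * G x"
          by (intro tendsto_intros)
      qed
      show "AE x in lebesgue. norm (box_bump a b m x * G x) \<le> norm (G x)" for m
        using box_bump_nonneg[of a b m] box_bump_le_1[of a b m]
        by (intro AE_I2) (auto simp: abs_mult mult_left_le_one_le)
    qed
    moreover have "(LINT x|lebesgue. box_bump a b m x * G x) = 0" for m
    proof -
      have "(LINT x|lebesgue. box_bump a b m x * G x) = (LINT x|lebesgue_on U. g x * box_bump a b m x)"
        using Um by (simp add: integral_lebesgue_on G_def ac_simps)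
      then show ?thesis using orth[OF box_bump_test_fun[OF ab]] by simp
    qed
    ultimately show ?thesis by (simp add: LIMSEQ_const_iff)
  qed
  obtain D where D: "countable D" "D \<subseteq> Pow U" "\<And>X. X \<in> D \<Longrightarrow> \<exists>a b. X = cbox a b" "\<Union>D = U"
    using open_countable_Union_open_cbox U by metis
  have "AE x in lebesgue. x \<in> X \<longrightarrow> G x = 0" if X: "X \<in> D" for X
  proof -
    obtain a b where ab: "X = cbox a b" using D(3)[OF X] by blast
    have "AE x in lebesgue. x \<in> box a b \<longrightarrow> G x = 0"
      by (rule integral_box_zero_imp_AE_zero[OF G]) (use box0 D(2) X ab in blast)
    moreover have "AE x in lebesgue. x \<notin> cbox a b - box a b"
      using negligible_frontier_interval[of a b] unfolding negligible_iff_null_sets by (rule AE_not_in)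
    ultimately show ?thesis unfolding ab by eventually_elim auto
  qed
  then have "AE x in lebesgue. \<forall>X\<in>D. x \<in> X \<longrightarrow> G x = 0"
    by (subst AE_ball_countable[OF D(1)]) blast
  then have "AE x in lebesgue. x \<in> U \<longrightarrow> g x = 0"
    by eventually_elim (use D(4) in \<open>fastforce simp: G_def\<close>)
  then show ?thesis using Um by (simp add: AE_lebesgue_on_iff)
qed

section \<open>Slicing along a direction\<close>

lemma nn_integral_translate:
  fixes g :: "'a::euclidean_space \<Rightarrow> ennreal"
  assumes "g \<in> borel_measurable borel"
  shows "(\<integral>\<^sup>+y. g (c + y) \<partial>lborel) = (\<integral>\<^sup>+y. g y \<partial>lborel)"
  using assms by (subst (2) lborel_distr_plus[of c, symmetric]) (simp add: nn_integral_distr)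

lemma nn_integral_unit_interval_minus:
  "(\<integral>\<^sup>+t. indicator {y. 0 \<le> y \<and> y < 1} (s + - 1 * t :: real) \<partial>lborel) = 1"
proof -
  have "(\<lambda>t. indicator {y. 0 \<le> y \<and> y < 1} (s + - 1 * t)) = (indicator {s - 1<..s} :: real \<Rightarrow> ennreal)"
    by (auto simp: indicator_def fun_eq_iff)
  then show ?thesis by simp
qed

lemma nn_integral_unit_interval_plus:
  "(\<integral>\<^sup>+t. indicator {y. 0 \<le> y \<and> y < 1} (s + t :: real) \<partial>lborel) = 1"
proof -
  have "(\<lambda>t. indicator {y. 0 \<le> y \<and> y < 1} (s + t)) = (indicator {- s..<1 - s} :: real \<Rightarrow> ennreal)"
    by (auto simp: indicator_def fun_eq_iff)
  then show ?thesis by simp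
qed

text \<open>
  Fubini along the direction \<open>v\<close>: a function \<open>s\<close> that grows with unit speed along \<open>v\<close> cuts out of each line a segment
  of unit length, and the integral over the space is the integral over the slab \<open>0 \<le> s < 1\<close> of the line integrals.
  It uses only Tonelli and translation invariance.
\<close>

lemma nn_integral_slices:
  fixes v :: "real^'n" and f :: "real^'n \<Rightarrow> ennreal" and s :: "real^'n \<Rightarrow> real"
  assumes [measurable]: "s \<in> borel_measurable borel" "f \<in> borel_measurable borel"
    and s: "\<And>y t. s (y + t *\<^sub>R v) = s y + t"
  shows "(\<integral>\<^sup>+y. f y \<partial>lborel) =
    (\<integral>\<^sup>+y. indicator {y. 0 \<le> s y \<and> s y < 1} y * (\<integral>\<^sup>+t. f (y + t *\<^sub>R v) \<partial>lborel) \<partial>lborel)"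
proof -
  let ?I = "indicator {y. 0 \<le> y \<and> y < 1} :: real \<Rightarrow> ennreal"
  have I: "indicator {y. 0 \<le> s y \<and> s y < 1} y = ?I (s y)" for y by (simp add: indicator_def)
  have "(\<integral>\<^sup>+y. indicator {y. 0 \<le> s y \<and> s y < 1} y * (\<integral>\<^sup>+t. f (y + t *\<^sub>R v) \<partial>lborel) \<partial>lborel)
    = (\<integral>\<^sup>+y. (\<integral>\<^sup>+t. ?I (s y) * f (y + t *\<^sub>R v) \<partial>lborel) \<partial>lborel)"
    unfolding I by (simp add: nn_integral_cmult)
  also have "\<dots> = (\<integral>\<^sup>+t. (\<integral>\<^sup>+y. ?I (s y) * f (y + t *\<^sub>R v) \<partial>lborel) \<partial>lborel)"
    by (rule lborel_pair.Fubini'[symmetric]) (simp add: case_prod_unfold)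
  also have "\<dots> = (\<integral>\<^sup>+t. (\<integral>\<^sup>+y. ?I (s y + - 1 * t) * f y \<partial>lborel) \<partial>lborel)"
  proof (rule nn_integral_cong)
    fix t :: real
    have "(\<integral>\<^sup>+y. ?I (s y + - 1 * t) * f y \<partial>lborel) = (\<integral>\<^sup>+y. ?I (s (t *\<^sub>R v + y) + - 1 * t) * f (t *\<^sub>R v + y) \<partial>lborel)"
      by (rule nn_integral_translate[symmetric]) measurable
    also have "\<dots> = (\<integral>\<^sup>+y. ?I (s y) * f (y + t *\<^sub>R v) \<partial>lborel)"
      using s by (simp add: add.commute)
    finally show "(\<integral>\<^sup>+y. ?I (s y) * f (y + t *\<^sub>R v) \<partial>lborel) = (\<integral>\<^sup>+y. ?I (s y + - 1 * t) * f y \<partial>lborel)" by simp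
  qed
  also have "\<dots> = (\<integral>\<^sup>+y. (\<integral>\<^sup>+t. ?I (s y + - 1 * t) * f y \<partial>lborel) \<partial>lborel)"
    by (rule lborel_pair.Fubini'[symmetric]) (simp add: case_prod_unfold)
  also have "\<dots> = (\<integral>\<^sup>+y. f y \<partial>lborel)"
    by (subst nn_integral_multc) (simp_all add: nn_integral_unit_interval_minus[simplified])
  finally show ?thesis by simp
qed

lemma integral_slices:
  fixes v :: "real^'n" and f :: "real^'n \<Rightarrow> real" and s :: "real^'n \<Rightarrow> real"
  assumes s_meas[measurable]: "s \<in> borel_measurable borel" and f: "integrable lborel f"
    and s: "\<And>y t. s (y + t *\<^sub>R v) = s y + t"
  shows "(LINT y|lborel. f y) =
    (LINT y|lborel. indicator {y. 0 \<le> s y \<and> s y < 1} y * (LINT t|lborel. f (y + t *\<^sub>R v)))"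
proof -
  have [measurable]: "f \<in> borel_measurable borel" using f by simp
  let ?I = "indicator {y. 0 \<le> y \<and> y < 1} :: real \<Rightarrow> real"
  have I: "indicator {y. 0 \<le> s y \<and> s y < 1} y = ?I (s y)" for y by (simp add: indicator_def)
  let ?g = "\<lambda>(y, t). ?I (s y) * f (y + t *\<^sub>R v)"
  let ?h = "\<lambda>(y, t). ?I (s y + - 1 * t) * f y"
  have IE: "ennreal \<bar>?I r\<bar> = indicator {y. 0 \<le> y \<and> y < 1} r" for r
    by (simp add: indicator_def)
  have g: "integrable (lborel \<Otimes>\<^sub>M lborel) ?g"
  proof (rule integrableI_bounded)
    have "(\<integral>\<^sup>+p. ennreal (norm (?g p)) \<partial>(lborel \<Otimes>\<^sub>M lborel)) =
      (\<integral>\<^sup>+y. (\<integral>\<^sup>+t. ennreal (norm (?g (y, t))) \<partial>lborel) \<partial>lborel)"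
      by (rule lborel.nn_integral_fst[symmetric]) simp
    also have "\<dots> = (\<integral>\<^sup>+y. indicator {y. 0 \<le> s y \<and> s y < 1} y * (\<integral>\<^sup>+t. ennreal (norm (f (y + t *\<^sub>R v))) \<partial>lborel) \<partial>lborel)"
      by (rule nn_integral_cong) (simp add: indicator_def)
    also have "\<dots> = (\<integral>\<^sup>+y. ennreal (norm (f y)) \<partial>lborel)"
      by (rule nn_integral_slices[symmetric]) (use s in auto)
    also have "\<dots> < \<infinity>" using f by (simp add: integrable_iff_bounded)
    finally show "(\<integral>\<^sup>+p. ennreal (norm (?g p)) \<partial>(lborel \<Otimes>\<^sub>M lborel)) < \<infinity>" .
  qed simp
  have h: "integrable (lborel \<Otimes>\<^sub>M lborel) ?h"
  proof (rule integrableI_bounded)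
    have "(\<integral>\<^sup>+p. ennreal (norm (?h p)) \<partial>(lborel \<Otimes>\<^sub>M lborel)) =
      (\<integral>\<^sup>+y. (\<integral>\<^sup>+t. ennreal (norm (?h (y, t))) \<partial>lborel) \<partial>lborel)"
      by (rule lborel.nn_integral_fst[symmetric]) simp
    also have "\<dots> = (\<integral>\<^sup>+y. ennreal (norm (f y)) \<partial>lborel)"
    proof (rule nn_integral_cong)
      fix y
      have "(\<integral>\<^sup>+t. ennreal (norm (?h (y, t))) \<partial>lborel) =
        (\<integral>\<^sup>+t. indicator {y. 0 \<le> y \<and> y < 1} (s y + - 1 * t) * ennreal (norm (f y)) \<partial>lborel)"
        by (rule nn_integral_cong) (simp add: indicator_def)
      also have "\<dots> = ennreal (norm (f y))"
        by (subst nn_integral_multc) (simp_all add: nn_integral_unit_interval_minus[simplified])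
      finally show "(\<integral>\<^sup>+t. ennreal (norm (?h (y, t))) \<partial>lborel) = ennreal (norm (f y))" .
    qed
    also have "\<dots> < \<infinity>" using f by (simp add: integrable_iff_bounded)
    finally show "(\<integral>\<^sup>+p. ennreal (norm (?h p)) \<partial>(lborel \<Otimes>\<^sub>M lborel)) < \<infinity>" .
  qed simp
  have "(LINT y|lborel. indicator {y. 0 \<le> s y \<and> s y < 1} y * (LINT t|lborel. f (y + t *\<^sub>R v)))
    = (LINT y|lborel. (LINT t|lborel. ?I (s y) * f (y + t *\<^sub>R v)))"
    unfolding I by simp
  also have "\<dots> = (LINT t|lborel. (LINT y|lborel. ?I (s y) * f (y + t *\<^sub>R v)))"
    by (rule lborel_pair.Fubini_integral[symmetric]) (use g in \<open>simp add: case_prod_unfold\<close>)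
  also have "\<dots> = (LINT t|lborel. (LINT y|lborel. ?I (s y + - 1 * t) * f y))"
  proof (rule Bochner_Integration.integral_cong[OF refl])
    fix t :: real
    have "(LINT y|lborel. ?I (s y + - 1 * t) * f y) = (LINT y|lborel. ?I (s (t *\<^sub>R v + y) + - 1 * t) * f (t *\<^sub>R v + y))"
      by (subst lborel_distr_plus[of "t *\<^sub>R v", symmetric]) (simp add: integral_distr)
    also have "\<dots> = (LINT y|lborel. ?I (s y) * f (y + t *\<^sub>R v))"
      using s by (simp add: add.commute)
    finally show "(LINT y|lborel. ?I (s y) * f (y + t *\<^sub>R v)) = (LINT y|lborel. ?I (s y + - 1 * t) * f y)" by simp
  qed
  also have "\<dots> = (LINT y|lborel. (LINT t|lborel. ?I (s y + - 1 * t) * f y))"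
    by (rule lborel_pair.Fubini_integral) (use h in \<open>simp add: case_prod_unfold\<close>)
  also have "\<dots> = (LINT y|lborel. f y)"
  proof (rule Bochner_Integration.integral_cong[OF refl])
    fix y
    have "(\<lambda>t. ?I (s y + - 1 * t)) = (indicator {s y - 1<..s y} :: real \<Rightarrow> real)"
      by (auto simp: indicator_def fun_eq_iff)
    then have "(LINT t|lborel. ?I (s y + - 1 * t)) = 1" by simp
    then show "(LINT t|lborel. ?I (s y + - 1 * t) * f y) = f y"
      by simp
  qed
  finally show ?thesis by simp
qed

subsection \<open>Projections onto a hyperplane\<close>

text \<open>
  For the hyperplane \<open>n \<bullet> x = \<beta>\<close> and a transversal direction \<open>v\<close>, every point is
  \<open>y = hit y + height y *\<^sub>R v\<close>, with \<open>hit y\<close> on the hyperplane.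
\<close>

definition height :: "real^'n \<Rightarrow> real \<Rightarrow> real^'n \<Rightarrow> real^'n \<Rightarrow> real" where
  "height n \<beta> v y = (n \<bullet> y - \<beta>) / (n \<bullet> v)"

definition hit :: "real^'n \<Rightarrow> real \<Rightarrow> real^'n \<Rightarrow> real^'n \<Rightarrow> real^'n" where
  "hit n \<beta> v y = y - height n \<beta> v y *\<^sub>R v"

lemma height_measurable[measurable]: "height n \<beta> v \<in> borel_measurable borel"
  unfolding height_def[abs_def] by simp

lemma hit_measurable[measurable]: "hit n \<beta> v \<in> borel_measurable borel"
  unfolding hit_def[abs_def] by simp

lemma height_translate: "n \<bullet> v \<noteq> 0 \<Longrightarrow> height n \<beta> v (y + t *\<^sub>R v) = height n \<beta> v y + t"
  by (simp add: height_def inner_add_right field_simps)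

lemma hit_translate: "n \<bullet> v \<noteq> 0 \<Longrightarrow> hit n \<beta> v (y + t *\<^sub>R v) = hit n \<beta> v y"
  by (simp add: hit_def height_translate algebra_simps)

lemma hit_inner: "n \<bullet> v \<noteq> 0 \<Longrightarrow> n \<bullet> hit n \<beta> v y = \<beta>"
  by (simp add: hit_def height_def inner_diff_right)

lemma emeasure_eq_nn_integral_times:
  fixes A :: "'a::euclidean_space set"
  assumes "A \<in> sets borel" "\<And>y. indicator A y = f y * g y"
  shows "emeasure lborel A = (\<integral>\<^sup>+y. f y * g y \<partial>lborel)"
  using nn_integral_indicator[of A lborel] assms by simp

text \<open>
  The measure of the lines that hit \<open>B\<close> does not depend on the slab that is used to count them.
\<close>

lemma emeasure_section_change:
  fixes v n :: "real^'n"
  assumes [measurable]: "s \<in> borel_measurable borel" "B \<in> sets borel"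
    and s: "\<And>y t. s (y + t *\<^sub>R v) = s y + t" and nv: "n \<bullet> v \<noteq> 0"
  shows "emeasure lborel {y. 0 \<le> s y \<and> s y < 1 \<and> hit n \<beta> v y \<in> B} =
    emeasure lborel {y. 0 \<le> height n \<beta> v y \<and> height n \<beta> v y < 1 \<and> hit n \<beta> v y \<in> B}"
proof -
  let ?I = "indicator {y. 0 \<le> y \<and> y < 1} :: real \<Rightarrow> ennreal"
  let ?J = "\<lambda>y. indicator B (hit n \<beta> v y) :: ennreal"
  have "emeasure lborel {y. 0 \<le> s y \<and> s y < 1 \<and> hit n \<beta> v y \<in> B} = (\<integral>\<^sup>+y. ?I (s y) * ?J y \<partial>lborel)"
    by (rule emeasure_eq_nn_integral_times) (auto simp: indicator_def)
  also have "\<dots> = (\<integral>\<^sup>+y. indicator {y. 0 \<le> height n \<beta> v y \<and> height n \<beta> v y < 1} y *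
     (\<integral>\<^sup>+t. ?I (s (y + t *\<^sub>R v)) * ?J (y + t *\<^sub>R v) \<partial>lborel) \<partial>lborel)"
    by (rule nn_integral_slices) (use nv in \<open>auto simp: height_translate\<close>)
  also have "\<dots> = (\<integral>\<^sup>+y. indicator {y. 0 \<le> height n \<beta> v y \<and> height n \<beta> v y < 1} y * ?J y \<partial>lborel)"
    using nv by (simp add: s hit_translate nn_integral_multc nn_integral_unit_interval_plus)
  also have "\<dots> = emeasure lborel {y. 0 \<le> height n \<beta> v y \<and> height n \<beta> v y < 1 \<and> hit n \<beta> v y \<in> B}"
    by (rule emeasure_eq_nn_integral_times[symmetric]) (auto simp: indicator_def)
  finally show ?thesis .
qed

lemma bounded_height_hit:
  assumes "bounded B"
  shows "bounded {y. 0 \<le> height n \<beta> v y \<and> height n \<beta> v y < 1 \<and> hit n \<beta> v y \<in> B}"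
proof -
  obtain M where M: "\<And>x. x \<in> B \<Longrightarrow> norm x \<le> M" using assms by (auto simp: bounded_iff)
  have "norm y \<le> M + norm v"
    if "0 \<le> height n \<beta> v y" "height n \<beta> v y < 1" "hit n \<beta> v y \<in> B" for y
  proof -
    have "y = hit n \<beta> v y + height n \<beta> v y *\<^sub>R v" by (simp add: hit_def)
    then have "norm y \<le> norm (hit n \<beta> v y) + \<bar>height n \<beta> v y\<bar> * norm v"
      by (metis norm_scaleR norm_triangle_ineq)
    also have "\<bar>height n \<beta> v y\<bar> * norm v \<le> norm v" using that by (simp add: mult_left_le_one_le)
    finally show ?thesis using M[OF that(3)] by linarith
  qed
  then show ?thesis unfolding bounded_iff by blast
qed

text \<open>
  The next three lemmas compare the prisms over a subset \<open>B\<close> of the hyperplane in different directions, by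
  scaling the direction, by shearing it parallel to the hyperplane, and in general.
\<close>

lemma emeasure_prism_scale:
  fixes n v :: "real^'n"
  assumes nv: "n \<bullet> v \<noteq> 0" and c: "c \<noteq> 0" and B[measurable]: "B \<in> sets borel"
  shows "emeasure lborel {y. 0 \<le> height n \<beta> (c *\<^sub>R v) y \<and> height n \<beta> (c *\<^sub>R v) y < 1 \<and> hit n \<beta> (c *\<^sub>R v) y \<in> B} =
    ennreal \<bar>c\<bar> * emeasure lborel {y. 0 \<le> height n \<beta> v y \<and> height n \<beta> v y < 1 \<and> hit n \<beta> v y \<in> B}"
proof -
  let ?I = "indicator {y. 0 \<le> y \<and> y < 1} :: real \<Rightarrow> ennreal"
  let ?J = "\<lambda>y. indicator B (hit n \<beta> v y) :: ennreal"
  have hc: "height n \<beta> (c *\<^sub>R v) y = height n \<beta> v y / c" for y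
    by (simp add: height_def)
  have hitc: "hit n \<beta> (c *\<^sub>R v) y = hit n \<beta> v y" for y
    using c by (simp add: hit_def hc)
  have len: "(\<integral>\<^sup>+t. ?I ((r + t) / c) \<partial>lborel) = ennreal \<bar>c\<bar>" for r
  proof (cases "c > 0")
    case True
    then have "(\<lambda>t. ?I ((r + t) / c)) = indicator {- r..<c - r}"
      by (auto simp: indicator_def fun_eq_iff divide_simps split: if_splits)
    then show ?thesis using True by simp
  next
    case False
    then have "(\<lambda>t. ?I ((r + t) / c)) = indicator {c - r<..- r}"
      using c by (auto simp: indicator_def fun_eq_iff divide_simps split: if_splits)
    then show ?thesis using False by simp
  qed
  have "emeasure lborel {y. 0 \<le> height n \<beta> (c *\<^sub>R v) y \<and> height n \<beta> (c *\<^sub>R v) y < 1 \<and> hit n \<beta> (c *\<^sub>R v) y \<in> B}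
      = (\<integral>\<^sup>+y. ?I (height n \<beta> v y / c) * ?J y \<partial>lborel)"
    unfolding hc hitc by (rule emeasure_eq_nn_integral_times) (auto simp: indicator_def)
  also have "\<dots> = (\<integral>\<^sup>+y. indicator {y. 0 \<le> height n \<beta> v y \<and> height n \<beta> v y < 1} y *
     (\<integral>\<^sup>+t. ?I (height n \<beta> v (y + t *\<^sub>R v) / c) * ?J (y + t *\<^sub>R v) \<partial>lborel) \<partial>lborel)"
    by (rule nn_integral_slices) (use nv in \<open>auto simp: height_translate\<close>)
  also have "\<dots> = (\<integral>\<^sup>+y. ennreal \<bar>c\<bar> * (?I (height n \<beta> v y) * ?J y) \<partial>lborel)"
  proof (rule nn_integral_cong)
    fix y
    have "(\<integral>\<^sup>+t. ?I (height n \<beta> v (y + t *\<^sub>R v) / c) * ?J (y + t *\<^sub>R v) \<partial>lborel) = ennreal \<bar>c\<bar> * ?J y"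
      using nv by (simp add: height_translate hit_translate nn_integral_multc len)
    then show "indicator {y. 0 \<le> height n \<beta> v y \<and> height n \<beta> v y < 1} y *
       (\<integral>\<^sup>+t. ?I (height n \<beta> v (y + t *\<^sub>R v) / c) * ?J (y + t *\<^sub>R v) \<partial>lborel) =
       ennreal \<bar>c\<bar> * (?I (height n \<beta> v y) * ?J y)"
      by (simp add: indicator_def)
  qed
  also have "\<dots> = ennreal \<bar>c\<bar> * (\<integral>\<^sup>+y. ?I (height n \<beta> v y) * ?J y \<partial>lborel)"
    by (rule nn_integral_cmult) measurable
  also have "(\<integral>\<^sup>+y. ?I (height n \<beta> v y) * ?J y \<partial>lborel) =
      emeasure lborel {y. 0 \<le> height n \<beta> v y \<and> height n \<beta> v y < 1 \<and> hit n \<beta> v y \<in> B}"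
    by (rule emeasure_eq_nn_integral_times[symmetric]) (auto simp: indicator_def)
  finally show ?thesis .
qed

lemma emeasure_prism_shear:
  fixes n u :: "real^'n"
  assumes n: "n \<bullet> n = 1" and nu: "n \<bullet> u = 0" and B[measurable]: "B \<in> sets borel"
  shows "emeasure lborel {y. 0 \<le> height n \<beta> (n + u) y \<and> height n \<beta> (n + u) y < 1 \<and> hit n \<beta> (n + u) y \<in> B} =
    emeasure lborel {y. 0 \<le> height n \<beta> n y \<and> height n \<beta> n y < 1 \<and> hit n \<beta> n y \<in> B}"
proof -
  let ?I = "indicator {y. 0 \<le> y \<and> y < 1} :: real \<Rightarrow> ennreal"
  let ?h = "height n \<beta> n"
  let ?J = "\<lambda>t y. indicator B (hit n \<beta> n y - t *\<^sub>R u) :: ennreal"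
  have h: "height n \<beta> (n + u) y = ?h y" for y by (simp add: height_def inner_add_right nu)
  have hitu: "hit n \<beta> (n + u) y = hit n \<beta> n y - ?h y *\<^sub>R u" for y by (simp add: hit_def h algebra_simps)
  have shift: "(\<integral>\<^sup>+y. ?I (?h y) * ?J t y \<partial>lborel) = (\<integral>\<^sup>+y. ?I (?h y) * ?J 0 y \<partial>lborel)" for t
  proof -
    have "(\<integral>\<^sup>+y. ?I (?h y) * ?J t y \<partial>lborel) = (\<integral>\<^sup>+y. ?I (?h (t *\<^sub>R u + y)) * ?J t (t *\<^sub>R u + y) \<partial>lborel)"
      by (rule nn_integral_translate[symmetric]) measurable
    then show ?thesis
      by (simp add: hit_def height_def inner_add_right nu)
  qed
  have "emeasure lborel {y. 0 \<le> height n \<beta> (n + u) y \<and> height n \<beta> (n + u) y < 1 \<and> hit n \<beta> (n + u) y \<in> B}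
     = (\<integral>\<^sup>+y. ?I (?h y) * ?J (?h y) y \<partial>lborel)"
    unfolding h hitu by (rule emeasure_eq_nn_integral_times) (auto simp: indicator_def)
  also have "\<dots> = (\<integral>\<^sup>+y. indicator {y. 0 \<le> ?h y \<and> ?h y < 1} y *
     (\<integral>\<^sup>+t. ?I (?h (y + t *\<^sub>R n)) * ?J (?h (y + t *\<^sub>R n)) (y + t *\<^sub>R n) \<partial>lborel) \<partial>lborel)"
    by (rule nn_integral_slices) (use n in \<open>auto simp: height_translate\<close>)
  also have "\<dots> = (\<integral>\<^sup>+y. ?I (?h y) * (\<integral>\<^sup>+t. ?I t * ?J t y \<partial>lborel) \<partial>lborel)"
  proof (rule nn_integral_cong)
    fix y
    have "(\<integral>\<^sup>+t. ?I t * ?J t y \<partial>lborel) = (\<integral>\<^sup>+t. ?I (?h y + t) * ?J (?h y + t) y \<partial>lborel)"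
      by (rule nn_integral_translate[symmetric]) measurable
    then show "indicator {y. 0 \<le> ?h y \<and> ?h y < 1} y *
       (\<integral>\<^sup>+t. ?I (?h (y + t *\<^sub>R n)) * ?J (?h (y + t *\<^sub>R n)) (y + t *\<^sub>R n) \<partial>lborel) =
       ?I (?h y) * (\<integral>\<^sup>+t. ?I t * ?J t y \<partial>lborel)"
      using n by (simp add: height_translate hit_translate indicator_def)
  qed
  also have "\<dots> = (\<integral>\<^sup>+y. (\<integral>\<^sup>+t. ?I (?h y) * (?I t * ?J t y) \<partial>lborel) \<partial>lborel)"
    by (intro nn_integral_cong nn_integral_cmult[symmetric]) measurable
  also have "\<dots> = (\<integral>\<^sup>+t. (\<integral>\<^sup>+y. ?I (?h y) * (?I t * ?J t y) \<partial>lborel) \<partial>lborel)"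
    by (rule lborel_pair.Fubini'[symmetric]) (simp add: case_prod_unfold)
  also have "\<dots> = (\<integral>\<^sup>+t. ?I t * (\<integral>\<^sup>+y. ?I (?h y) * ?J t y \<partial>lborel) \<partial>lborel)"
  proof (rule nn_integral_cong)
    fix t
    have "(\<integral>\<^sup>+y. ?I (?h y) * (?I t * ?J t y) \<partial>lborel) = (\<integral>\<^sup>+y. ?I t * (?I (?h y) * ?J t y) \<partial>lborel)"
      by (rule nn_integral_cong) (rule mult.left_commute)
    also have "\<dots> = ?I t * (\<integral>\<^sup>+y. ?I (?h y) * ?J t y \<partial>lborel)"
      by (rule nn_integral_cmult) measurable
    finally show "(\<integral>\<^sup>+y. ?I (?h y) * (?I t * ?J t y) \<partial>lborel) = ?I t * (\<integral>\<^sup>+y. ?I (?h y) * ?J t y \<partial>lborel)" .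
  qed
  \<comment> \<open>the slice at height \<open>t\<close> is translated by \<open>t *\<^sub>R u\<close>, parallel to the hyperplane\<close>
  also have "\<dots> = (\<integral>\<^sup>+t. ?I t * (\<integral>\<^sup>+y. ?I (?h y) * ?J 0 y \<partial>lborel) \<partial>lborel)"
    by (intro nn_integral_cong arg_cong2[where f="(*)"] refl shift)
  also have "\<dots> = (\<integral>\<^sup>+y. ?I (?h y) * ?J 0 y \<partial>lborel)"
  proof -
    have "(\<integral>\<^sup>+t. ?I t * (\<integral>\<^sup>+y. ?I (?h y) * ?J 0 y \<partial>lborel) \<partial>lborel) =
        (\<integral>\<^sup>+t. ?I t \<partial>lborel) * (\<integral>\<^sup>+y. ?I (?h y) * ?J 0 y \<partial>lborel)"
      by (rule nn_integral_multc) measurable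
    also have "(\<integral>\<^sup>+t. ?I t \<partial>lborel) = 1" using nn_integral_unit_interval_plus[of 0] by (simp only: add_0_left)
    finally show ?thesis by (simp only: mult_1_left)
  qed
  also have "\<dots> = (\<integral>\<^sup>+y. ?I (?h y) * indicator B (hit n \<beta> n y) \<partial>lborel)"
    by (simp only: scaleR_zero_left diff_zero)
  also have "\<dots> = emeasure lborel {y. 0 \<le> ?h y \<and> ?h y < 1 \<and> hit n \<beta> n y \<in> B}"
    by (rule emeasure_eq_nn_integral_times[symmetric], measurable) (simp add: indicator_def)
  finally show ?thesis .
qed

lemma emeasure_prism_direction:
  fixes n v :: "real^'n"
  assumes n: "norm n = 1" and nv: "n \<bullet> v \<noteq> 0" and B: "B \<in> sets borel"
  shows "emeasure lborel {y. 0 \<le> height n \<beta> v y \<and> height n \<beta> v y < 1 \<and> hit n \<beta> v y \<in> B} =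
    ennreal \<bar>n \<bullet> v\<bar> * emeasure lborel {y. 0 \<le> height n \<beta> n y \<and> height n \<beta> n y < 1 \<and> hit n \<beta> n y \<in> B}"
proof -
  have nn: "n \<bullet> n = 1" using n by (simp add: dot_square_norm)
  \<comment> \<open>\<open>v\<close> is a multiple of a shear of \<open>n\<close>\<close>
  define u where "u = v /\<^sub>R (n \<bullet> v) - n"
  have u: "n \<bullet> u = 0" using nv by (simp add: u_def inner_diff_right nn)
  have v: "v = (n \<bullet> v) *\<^sub>R (n + u)" using nv by (simp add: u_def)
  have "n \<bullet> (n + u) \<noteq> 0" by (simp add: inner_add_right nn u)
  from emeasure_prism_scale[OF this nv B, of \<beta>] emeasure_prism_shear[OF nn u B, of \<beta>] v[symmetric]
  show ?thesis by simp
qed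

section \<open>Facets of polytopes and their surface measure\<close>

text \<open>
  A full-dimensional compact convex polytope.
\<close>

definition solid_polytope :: "(real^'n) set \<Rightarrow> bool" where
  "solid_polytope K \<longleftrightarrow> polytope K \<and> interior K \<noteq> {}"

lemma solid_polytope_aff_dim: "solid_polytope K \<Longrightarrow> aff_dim K = int CARD('n)" for K :: "(real^'n) set"
  unfolding solid_polytope_def using aff_dim_nonempty_interior[of K] by simp

lemma facet_hyperplane:
  fixes K :: "(real^'n) set"
  assumes K: "solid_polytope K" and e: "e facet_of K"
  obtains n b where "norm n = 1" "K \<subseteq> {x. n \<bullet> x \<le> b}" "e = K \<inter> {x. n \<bullet> x = b}"
    "affine hull e = {x. n \<bullet> x = b}"
proof -
  have p: "polyhedron K" using K by (simp add: solid_polytope_def polytope_imp_polyhedron)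
  obtain a c where ac: "a \<noteq> 0" "K \<subseteq> {x. a \<bullet> x \<le> c}" "e = K \<inter> {x. a \<bullet> x = c}"
    using facet_of_polyhedron[OF p e] by metis
  define n where "n = a /\<^sub>R norm a"
  define b where "b = c / norm a"
  have le: "n \<bullet> x \<le> b \<longleftrightarrow> a \<bullet> x \<le> c" and eq: "n \<bullet> x = b \<longleftrightarrow> a \<bullet> x = c" for x
    using ac(1) by (auto simp: n_def b_def field_simps)
  have n: "norm n = 1" using ac(1) by (simp add: n_def)
  have "affine hull e = {x. n \<bullet> x = b}"
  proof (rule affine_dim_equal)
    show "affine hull e \<subseteq> {x. n \<bullet> x = b}"
      by (rule hull_minimal) (use ac eq in \<open>auto simp: affine_hyperplane\<close>)
    show "affine hull e \<noteq> {}" using e by (auto simp: facet_of_def)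
    have "n \<noteq> 0" using n by auto
    then show "aff_dim (affine hull e) = aff_dim {x. n \<bullet> x = b}"
      using e solid_polytope_aff_dim[OF K] by (simp add: facet_of_def aff_dim_hyperplane)
  qed (simp_all add: affine_hyperplane)
  with n ac le eq show thesis by (intro that[of n b]) auto
qed

lemma unit_normal_cases:
  fixes n m :: "real^'n"
  assumes n: "norm n = 1" and m: "norm m = 1" and hull: "affine hull e = {x. n \<bullet> x = b}"
    and c: "\<And>x. x \<in> e \<Longrightarrow> m \<bullet> x = c"
  shows "m = n \<or> m = - n"
proof -
  have nn: "n \<bullet> n = 1" and mm: "m \<bullet> m = 1" using n m by (auto simp: dot_square_norm)
  have sub: "affine hull e \<subseteq> {x. m \<bullet> x = c}"
    by (rule hull_minimal) (use c in \<open>auto simp: affine_hyperplane\<close>)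
  define w where "w = m - (n \<bullet> m) *\<^sub>R n"
  have nw: "n \<bullet> w = 0" by (simp add: w_def inner_diff_right nn)
  have "b *\<^sub>R n \<in> affine hull e" "b *\<^sub>R n + w \<in> affine hull e"
    unfolding hull using nw nn by (auto simp: inner_add_right)
  then have "m \<bullet> (b *\<^sub>R n) = c" "m \<bullet> (b *\<^sub>R n + w) = c" using sub by auto
  then have mw: "m \<bullet> w = 0" by (simp add: inner_add_right)
  have "w \<bullet> w = m \<bullet> w - (n \<bullet> m) * (n \<bullet> w)" by (subst (1) w_def) (simp add: inner_diff_left)
  then have "w = 0" using nw mw by simp
  then have eq: "m = (n \<bullet> m) *\<^sub>R n" by (simp add: w_def)
  then have "\<bar>n \<bullet> m\<bar> = 1" using n m by (metis mult.right_neutral norm_scaleR)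
  then have "n \<bullet> m = 1 \<or> n \<bullet> m = - 1" by linarith
  then show ?thesis using eq by (metis scaleR_minus1_left scaleR_one)
qed

lemma outer_normal_unique:
  assumes K: "solid_polytope K"
    and n: "norm n = 1" "K \<subseteq> {x. n \<bullet> x \<le> b}" "e = K \<inter> {x. n \<bullet> x = b}" "affine hull e = {x. n \<bullet> x = b}"
  shows "outer_normal K e = n"
  unfolding outer_normal_def
proof (rule the_equality)
  show "norm n = 1 \<and> (\<exists>b. K \<subseteq> {x. n \<bullet> x \<le> b} \<and> e = K \<inter> {x. n \<bullet> x = b})" using n by blast
next
  fix m assume "norm m = 1 \<and> (\<exists>c. K \<subseteq> {x. m \<bullet> x \<le> c} \<and> e = K \<inter> {x. m \<bullet> x = c})"
  then obtain c where m: "norm m = 1" "K \<subseteq> {x. m \<bullet> x \<le> c}" "e = K \<inter> {x. m \<bullet> x = c}" by blast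
  have "m = n \<or> m = - n" by (rule unit_normal_cases[OF n(1) m(1) n(4)]) (use m in auto)
  moreover have False if "m = - n"
  proof -
    have "b *\<^sub>R n \<in> affine hull e" using n by (simp add: dot_square_norm)
    then have "e \<noteq> {}" by auto
    then obtain x where "x \<in> e" by blast
    then have "n \<bullet> x = b" "m \<bullet> x = c" using n m by auto
    then have "c = - b" using that by simp
    then have "K \<subseteq> {x. n \<bullet> x = b}" using n(2) m(2) that by force
    then have "interior K \<subseteq> interior {x. n \<bullet> x = b}" by (rule interior_mono)
    moreover have "n \<noteq> 0" using n by auto
    ultimately show False using K by (simp add: solid_polytope_def interior_hyperplane)
  qed
  ultimately show "m = n" by blast
qed

lemma outer_normal_facet:
  assumes K: "solid_polytope K" and e: "e facet_of K"
  obtains b where "norm (outer_normal K e) = 1" "K \<subseteq> {x. outer_normal K e \<bullet> x \<le> b}"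
    "e = K \<inter> {x. outer_normal K e \<bullet> x = b}" "affine hull e = {x. outer_normal K e \<bullet> x = b}"
proof -
  obtain n b where n: "norm n = 1" "K \<subseteq> {x. n \<bullet> x \<le> b}" "e = K \<inter> {x. n \<bullet> x = b}"
    "affine hull e = {x. n \<bullet> x = b}" using facet_hyperplane[OF K e] by metis
  then have "outer_normal K e = n" by (intro outer_normal_unique[OF K])
  with n show thesis by (intro that) auto
qed

text \<open>
  The facet \<open>e\<close> of \<open>K\<close> lies in the hyperplane \<open>outer_normal K e \<bullet> x = facet_level K e\<close>.
\<close>

definition facet_level :: "(real^'n) set \<Rightarrow> (real^'n) set \<Rightarrow> real" where
  "facet_level K e = (SOME b. K \<subseteq> {x. outer_normal K e \<bullet> x \<le> b} \<and>
     e = K \<inter> {x. outer_normal K e \<bullet> x = b} \<and> affine hull e = {x. outer_normal K e \<bullet> x = b})"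

lemma facet_data:
  assumes K: "solid_polytope K" and e: "e facet_of K"
  shows "norm (outer_normal K e) = 1" "K \<subseteq> {x. outer_normal K e \<bullet> x \<le> facet_level K e}"
    "e = K \<inter> {x. outer_normal K e \<bullet> x = facet_level K e}"
    "affine hull e = {x. outer_normal K e \<bullet> x = facet_level K e}"
proof -
  obtain b where b: "norm (outer_normal K e) = 1" "K \<subseteq> {x. outer_normal K e \<bullet> x \<le> b}"
    "e = K \<inter> {x. outer_normal K e \<bullet> x = b}" "affine hull e = {x. outer_normal K e \<bullet> x = b}"
    using outer_normal_facet[OF K e] by metis
  show "norm (outer_normal K e) = 1" by fact
  have "\<exists>b. K \<subseteq> {x. outer_normal K e \<bullet> x \<le> b} \<and>
     e = K \<inter> {x. outer_normal K e \<bullet> x = b} \<and> affine hull e = {x. outer_normal K e \<bullet> x = b}"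
    using b by blast
  from someI_ex[OF this]
  show "K \<subseteq> {x. outer_normal K e \<bullet> x \<le> facet_level K e}"
    "e = K \<inter> {x. outer_normal K e \<bullet> x = facet_level K e}"
    "affine hull e = {x. outer_normal K e \<bullet> x = facet_level K e}"
    unfolding facet_level_def by blast+
qed

lemma facet_inner: "solid_polytope K \<Longrightarrow> e facet_of K \<Longrightarrow> x \<in> e \<Longrightarrow> outer_normal K e \<bullet> x = facet_level K e"
  using facet_data(3) by fastforce

lemma finite_facets: "solid_polytope K \<Longrightarrow> finite (facets K)"
  unfolding solid_polytope_def by (simp add: finite_polytope_facets)

lemma solid_polytope_compact: "solid_polytope K \<Longrightarrow> compact K"
  and solid_polytope_convex: "solid_polytope K \<Longrightarrow> convex K"
  and solid_polytope_bounded: "solid_polytope K \<Longrightarrow> bounded K"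
  and solid_polytope_closed: "solid_polytope K \<Longrightarrow> closed K"
  unfolding solid_polytope_def
  by (auto simp: polytope_imp_compact polytope_imp_convex polytope_imp_bounded polytope_imp_closed)

lemma facet_compact: "solid_polytope K \<Longrightarrow> e facet_of K \<Longrightarrow> compact e"
  using face_of_imp_compact[OF solid_polytope_convex solid_polytope_compact] facet_of_imp_face_of by blast

lemma frontier_solid_polytope:
  assumes "solid_polytope K"
  shows "K - interior K = \<Union>(facets K)"
proof -
  have "rel_interior K = interior K"
    using assms by (intro rel_interior_nonempty_interior) (simp add: solid_polytope_def)
  moreover have "K - rel_interior K = \<Union>{F. F facet_of K}"
    using assms by (intro rel_boundary_of_polyhedron) (simp add: solid_polytope_def polytope_imp_polyhedron)
  ultimately show ?thesis by simp
qed

lemma interior_facet_strict: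
  assumes K: "solid_polytope K" and e: "e facet_of K" and x: "x \<in> interior K"
  shows "outer_normal K e \<bullet> x < facet_level K e"
proof -
  have "interior K \<subseteq> interior {x. outer_normal K e \<bullet> x \<le> facet_level K e}"
    by (rule interior_mono) (rule facet_data(2)[OF K e])
  moreover have "outer_normal K e \<noteq> 0" using facet_data(1)[OF K e] by auto
  ultimately show ?thesis using x by (auto simp: interior_halfspace_le)
qed

lemma solid_polytope_halfspaces:
  assumes K: "solid_polytope K"
  shows "x \<in> K \<longleftrightarrow> (\<forall>e\<in>facets K. outer_normal K e \<bullet> x \<le> facet_level K e)"
proof
  assume "x \<in> K" then show "\<forall>e\<in>facets K. outer_normal K e \<bullet> x \<le> facet_level K e"
    using facet_data(2)[OF K] by fastforce
next
  assume le: "\<forall>e\<in>facets K. outer_normal K e \<bullet> x \<le> facet_level K e"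
  show "x \<in> K"
  proof (rule ccontr)
    assume x: "x \<notin> K"
    obtain a where a: "a \<in> interior K" using K by (auto simp: solid_polytope_def)
    \<comment> \<open>the segment from an interior point to \<open>x\<close> leaves \<open>K\<close> through a facet, whose halfspace does not contain \<open>x\<close>\<close>
    have "closed_segment a x \<inter> frontier K \<noteq> {}"
      by (rule connected_Int_frontier) (use a x interior_subset in auto)
    then obtain z where z: "z \<in> closed_segment a x" "z \<in> K - interior K"
      using solid_polytope_closed[OF K] by (auto simp: frontier_def)
    then obtain e where e: "e facet_of K" "z \<in> e" using frontier_solid_polytope[OF K] by auto
    obtain u where u: "0 \<le> u" "u \<le> 1" "z = (1 - u) *\<^sub>R a + u *\<^sub>R x" using z(1) by (auto simp: in_segment)
    have "u \<noteq> 1" using u x z by auto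
    let ?n = "outer_normal K e" and ?b = "facet_level K e"
    have "(1 - u) * (?n \<bullet> a) < (1 - u) * ?b"
      using interior_facet_strict[OF K e(1) a] u \<open>u \<noteq> 1\<close> by (intro mult_strict_left_mono) auto
    moreover have "u * (?n \<bullet> x) \<le> u * ?b" using le e u by (intro mult_left_mono) auto
    moreover have "?n \<bullet> z = (1 - u) * (?n \<bullet> a) + u * (?n \<bullet> x)" unfolding u by (simp add: inner_add_right)
    moreover have "?n \<bullet> z = ?b" using facet_inner[OF K e] .
    ultimately show False by (simp add: algebra_simps)
  qed
qed

subsection \<open>Surface measure\<close>

lemma sets_surf: "sets (surf e) = sets (restrict_space borel e)"
  by (simp add: surf_def Let_def)

lemma space_surf: "space (surf e) = e"
  by (simp add: surf_def Let_def space_restrict_space)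

text \<open>
  The surface measure of a facet is the measure of the prism of height one over it, written with either of the two unit normals.
  The closed prism of the definition differs from the half-open one by a null set.
\<close>

lemma emeasure_surf:
  fixes n :: "real^'n"
  assumes n: "norm n = 1" and hull: "affine hull e = {x. n \<bullet> x = \<beta>}" and e: "closed e"
    and B[measurable]: "B \<in> sets borel" and Be: "B \<subseteq> e"
  shows "emeasure (surf e) B =
    emeasure lborel {y. 0 \<le> height n \<beta> n y \<and> height n \<beta> n y < 1 \<and> hit n \<beta> n y \<in> B}"
proof -
  have nn: "n \<bullet> n = 1" using n by (simp add: dot_square_norm)
  have ene: "e \<noteq> {}"
  proof -
    have "\<beta> *\<^sub>R n \<in> affine hull e" unfolding hull by (simp add: nn)
    then show ?thesis by auto
  qed
  have en: "n \<bullet> x = \<beta>" if "x \<in> e" for x using hull_inc[OF that, of affine] hull by auto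
  define m where "m = unit_normal e"
  define z where "z = (SOME x. x \<in> e)"
  define \<gamma> where "\<gamma> = m \<bullet> z"
  have z: "z \<in> e" unfolding z_def using ene by (simp add: some_in_eq)
  have "norm m = 1 \<and> (\<exists>b. \<forall>x\<in>e. m \<bullet> x = b)"
    unfolding m_def unit_normal_def by (rule someI[of _ n]) (use n en in blast)
  then have m: "norm m = 1" "\<And>x. x \<in> e \<Longrightarrow> m \<bullet> x = \<gamma>" using z by (auto simp: \<gamma>_def)
  have mm: "m \<bullet> m = 1" using m by (simp add: dot_square_norm)
  have [measurable]: "e \<in> sets borel" using e by simp
  let ?P = "{x + t *\<^sub>R m | x t. x \<in> e \<and> 0 \<le> t \<and> t \<le> 1}"
  let ?f = "\<lambda>y. y - (m \<bullet> (y - z)) *\<^sub>R m"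
  have f: "?f y = hit m \<gamma> m y" for y
    by (simp add: hit_def height_def mm \<gamma>_def inner_diff_right)
  have fP: "height m \<gamma> m (x + t *\<^sub>R m) = t" "hit m \<gamma> m (x + t *\<^sub>R m) = x" if "x \<in> e" for x t
    using m(2)[OF that] by (simp_all add: height_def hit_def inner_add_right mm)
  have P: "?P = {y. 0 \<le> height m \<gamma> m y \<and> height m \<gamma> m y \<le> 1 \<and> hit m \<gamma> m y \<in> e}" (is "_ = ?Q")
  proof (intro equalityI subsetI)
    fix y assume "y \<in> ?Q"
    then have "y = hit m \<gamma> m y + height m \<gamma> m y *\<^sub>R m \<and> hit m \<gamma> m y \<in> e \<and>
        0 \<le> height m \<gamma> m y \<and> height m \<gamma> m y \<le> 1" by (simp add: hit_def)
    then show "y \<in> ?P" by blast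
  qed (use fP in auto)
  have Pm: "?P \<in> sets lebesgue"
  proof -
    have "?Q \<in> sets borel" by measurable
    then show ?thesis unfolding P by simp
  qed
  have fm: "?f \<in> measurable (lebesgue_on ?P) (restrict_space borel e)"
  proof (rule measurable_restrict_space2)
    show "?f \<in> space (lebesgue_on ?P) \<rightarrow> e" unfolding f P by (auto simp: space_restrict_space)
    have "(\<lambda>y. hit m \<gamma> m y) \<in> borel_measurable lebesgue"
      by (rule measurable_completion) measurable
    then show "?f \<in> borel_measurable (lebesgue_on ?P)"
      unfolding f by (rule measurable_restrict_space1)
  qed
  have Br: "B \<in> sets (restrict_space borel e)"
    using B Be by (auto simp: sets_restrict_space)
  have "emeasure (surf e) B = emeasure (lebesgue_on ?P) (?f -` B \<inter> ?P)"
    unfolding surf_def Let_def m_def[symmetric] z_def[symmetric]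
    by (subst emeasure_distr[OF fm Br]) (simp add: space_restrict_space)
  also have "\<dots> = emeasure lebesgue (?f -` B \<inter> ?P)"
    using Pm by (intro emeasure_restrict_space) auto
  also have "?f -` B \<inter> ?P = {y. 0 \<le> height m \<gamma> m y \<and> height m \<gamma> m y \<le> 1 \<and> hit m \<gamma> m y \<in> B}"
    unfolding f P using Be by auto
  also have "emeasure lebesgue \<dots> = emeasure lborel \<dots>"
  proof -
    have "{y. 0 \<le> height m \<gamma> m y \<and> height m \<gamma> m y \<le> 1 \<and> hit m \<gamma> m y \<in> B} \<in> sets lborel" by measurable
    then show ?thesis by simp
  qed
  also have "\<dots> = emeasure lborel {y. 0 \<le> height m \<gamma> m y \<and> height m \<gamma> m y < 1 \<and> hit m \<gamma> m y \<in> B}"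
  proof (rule emeasure_eq_AE)
    have "negligible {y. m \<bullet> y = \<gamma> + 1}"
      by (rule negligible_hyperplane) (use mm in auto)
    moreover have "closed {y. m \<bullet> y = \<gamma> + 1}" by (rule closed_hyperplane)
    ultimately have "AE y in lborel. y \<notin> {y. m \<bullet> y = \<gamma> + 1}"
      by (intro AE_not_in) (auto simp: negligible_iff_null_sets null_sets_def)
    then show "AE y in lborel. (y \<in> {y. 0 \<le> height m \<gamma> m y \<and> height m \<gamma> m y \<le> 1 \<and> hit m \<gamma> m y \<in> B}) =
       (y \<in> {y. 0 \<le> height m \<gamma> m y \<and> height m \<gamma> m y < 1 \<and> hit m \<gamma> m y \<in> B})"
      by eventually_elim (auto simp: height_def mm)
  qed measurable
  also have "\<dots> = emeasure lborel {y. 0 \<le> height n \<beta> n y \<and> height n \<beta> n y < 1 \<and> hit n \<beta> n y \<in> B}"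
    using unit_normal_cases[OF n m(1) hull m(2)]
  proof
    assume "m = n" then show ?thesis using en[OF z] by (simp add: \<gamma>_def)
  next
    assume mn: "m = - n"
    then have "\<gamma> = - \<beta>" using en[OF z] by (simp add: \<gamma>_def)
    then have h: "height m \<gamma> m = height n \<beta> (- n)" "hit m \<gamma> m = hit n \<beta> (- n)"
      using mn by (simp_all add: height_def hit_def fun_eq_iff nn)
    show ?thesis unfolding h
      using emeasure_prism_direction[OF n, of "- n" B \<beta>] B nn by simp
  qed
  finally show ?thesis .
qed

lemma finite_surf:
  assumes K: "solid_polytope K" and e: "e facet_of K"
  shows "emeasure (surf e) e < \<infinity>"
proof -
  have c: "compact e" by (rule facet_compact[OF K e])
  show ?thesis
    using c emeasure_surf[OF facet_data(1,4)[OF K e], of e]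
      emeasure_bounded_finite[OF bounded_height_hit[OF compact_imp_bounded[OF c]]]
    by (simp add: compact_imp_closed)
qed

lemma finite_measure_surf:
  assumes K: "solid_polytope K" and e: "e facet_of K"
  shows "finite_measure (surf e)"
  using finite_surf[OF assms] by (intro finite_measureI) (simp add: space_surf)

lemma emeasure_surf_pos:
  fixes K :: "(real^'n) set"
  assumes K: "solid_polytope K" and e: "e facet_of K" and B: "B \<in> sets borel" "B \<subseteq> e"
    and z: "z \<in> affine hull e" and r: "0 < r" "ball z r \<inter> affine hull e \<subseteq> B"
  shows "0 < emeasure (surf e) B"
proof -
  let ?n = "outer_normal K e" and ?b = "facet_level K e"
  note d = facet_data[OF K e]
  have nn: "?n \<bullet> ?n = 1" using d by (simp add: dot_square_norm)
  have cl: "closed e" using facet_compact[OF K e] compact_imp_closed by blast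
  let ?A = "{y. 0 \<le> height ?n ?b ?n y \<and> height ?n ?b ?n y < 1 \<and> hit ?n ?b ?n y \<in> B}"
  let ?O = "{y. 0 < height ?n ?b ?n y \<and> height ?n ?b ?n y < 1 \<and> hit ?n ?b ?n y \<in> ball z r}"
  have sub: "?O \<subseteq> ?A" using r(2) d(4) hit_inner[of ?n ?n ?b] nn by auto
  have "continuous_on UNIV (height ?n ?b ?n)" "continuous_on UNIV (hit ?n ?b ?n)"
    unfolding height_def[abs_def] hit_def[abs_def] by (auto intro!: continuous_intros simp: nn)
  then have "open ?O"
    unfolding mem_ball by (intro open_Collect_conj open_Collect_less continuous_intros)
  moreover have "z + (1/2) *\<^sub>R ?n \<in> ?O"
    using z r(1) unfolding d(4) by (simp add: height_def hit_def inner_add_right nn)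
  ultimately have "\<not> negligible ?O" using open_not_negligible by blast
  then have "\<not> negligible ?A" using sub negligible_subset by blast
  moreover have "?A \<in> sets borel" using B by measurable
  ultimately have "emeasure lborel ?A \<noteq> 0"
    by (auto simp: negligible_iff_null_sets null_sets_def)
  then show ?thesis
    using emeasure_surf[OF d(1,4) cl B] by (simp add: zero_less_iff_neq_zero)
qed

text \<open>
  The lines of direction \<open>v\<close> that hit a facet, weighted by a function of the point of incidence: the measure of
  these lines is the surface measure times the cosine of the angle of incidence.
\<close>

lemma integral_surf_slab:
  fixes K :: "(real^'n) set" and g :: "real^'n \<Rightarrow> real"
  assumes K: "solid_polytope K" and e: "e facet_of K" and g[measurable]: "g \<in> borel_measurable borel"
    and nv: "outer_normal K e \<bullet> v \<noteq> 0"
    and s_meas[measurable]: "s \<in> borel_measurable borel" and s: "\<And>y t. s (y + t *\<^sub>R v) = s y + t"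
  shows "(LINT y|lborel. indicator {y. 0 \<le> s y \<and> s y < 1} y *
      (indicator e (hit (outer_normal K e) (facet_level K e) v y) * g (hit (outer_normal K e) (facet_level K e) v y)))
    = \<bar>outer_normal K e \<bullet> v\<bar> * (LINT x|surf e. g x)"
proof -
  let ?n = "outer_normal K e" and ?b = "facet_level K e"
  let ?H = "hit ?n ?b v"
  note d = facet_data[OF K e]
  have cl: "closed e" using facet_compact[OF K e] compact_imp_closed by blast
  have em[measurable]: "e \<in> sets borel" using cl by simp
  let ?A = "{y. 0 \<le> s y \<and> s y < 1 \<and> ?H y \<in> e}"
  have A: "?A \<in> sets borel" by measurable
  let ?N = "distr (restrict_space lborel ?A) (restrict_space borel e) ?H"
  have Hm: "?H \<in> measurable (restrict_space lborel ?A) (restrict_space borel e)"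
  proof (rule measurable_restrict_space2)
    show "?H \<in> space (restrict_space lborel ?A) \<rightarrow> e" by (auto simp: space_restrict_space)
    show "?H \<in> borel_measurable (restrict_space lborel ?A)"
      by (rule measurable_restrict_space1) measurable
  qed
  have gm: "g \<in> borel_measurable (restrict_space borel e)" using g by (rule measurable_restrict_space1)
  have eq: "?N = density (surf e) (\<lambda>_. ennreal \<bar>?n \<bullet> v\<bar>)"
  proof (rule measure_eqI)
    fix B assume "B \<in> sets ?N"
    then have Br: "B \<in> sets (restrict_space borel e)" by simp
    then have B[measurable]: "B \<in> sets borel" and Be: "B \<subseteq> e"
      using em by (auto simp: sets_restrict_space_iff)
    have "emeasure ?N B = emeasure lborel {y. 0 \<le> s y \<and> s y < 1 \<and> ?H y \<in> B}"
    proof -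
      have "emeasure ?N B = emeasure (restrict_space lborel ?A) (?H -` B \<inter> ?A)"
        using emeasure_distr[OF Hm Br] by (simp add: space_restrict_space)
      also have "\<dots> = emeasure lborel (?H -` B \<inter> ?A)"
        using A by (intro emeasure_restrict_space) auto
      also have "?H -` B \<inter> ?A = {y. 0 \<le> s y \<and> s y < 1 \<and> ?H y \<in> B}" using Be by auto
      finally show ?thesis .
    qed
    also have "\<dots> = ennreal \<bar>?n \<bullet> v\<bar> * emeasure (surf e) B"
      unfolding emeasure_section_change[OF s_meas B s nv] emeasure_prism_direction[OF d(1) nv B]
        emeasure_surf[OF d(1,4) cl B Be] ..
    also have "\<dots> = emeasure (density (surf e) (\<lambda>_. ennreal \<bar>?n \<bullet> v\<bar>)) B"
      using Br by (subst emeasure_density_const) (simp_all add: sets_surf)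
    finally show "emeasure ?N B = emeasure (density (surf e) (\<lambda>_. ennreal \<bar>?n \<bullet> v\<bar>)) B" .
  qed (simp add: sets_surf)
  have "(LINT y|lborel. indicator {y. 0 \<le> s y \<and> s y < 1} y * (indicator e (?H y) * g (?H y))) =
     (LINT y|lborel. indicator ?A y *\<^sub>R g (?H y))"
    by (rule Bochner_Integration.integral_cong) (auto simp: indicator_def)
  also have "\<dots> = (LINT y|restrict_space lborel ?A. g (?H y))"
    using A by (simp add: integral_restrict_space)
  also have "\<dots> = integral\<^sup>L ?N g" by (rule integral_distr[OF Hm gm, symmetric])
  also have "\<dots> = (LINT x|surf e. \<bar>?n \<bullet> v\<bar> *\<^sub>R g x)"
    unfolding eq using gm by (intro integral_density) (auto simp: measurable_cong_sets[OF sets_surf refl])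
  finally show ?thesis by simp
qed

section \<open>The divergence theorem on polytopes\<close>

text \<open>
  If the line \<open>y + t *\<^sub>R v\<close> leaves \<open>K\<close> at the parameter \<open>t\<close> in the direction given by the sign \<open>\<sigma>\<close>, it does so through a
  facet that is crossed outwards. The first hypothesis on the facets excludes lines that run inside the hyperplane of a facet.
\<close>

lemma line_end_facet:
  fixes K :: "(real^'n) set"
  assumes K: "solid_polytope K"
    and g1: "\<And>e. e facet_of K \<Longrightarrow> outer_normal K e \<bullet> v = 0 \<Longrightarrow> outer_normal K e \<bullet> y \<noteq> facet_level K e"
    and t: "y + t *\<^sub>R v \<in> K" and out: "\<And>\<epsilon>. 0 < \<epsilon> \<Longrightarrow> y + (t + \<sigma> * \<epsilon>) *\<^sub>R v \<notin> K"
  obtains e where "e facet_of K" "outer_normal K e \<bullet> (y + t *\<^sub>R v) = facet_level K e"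
    "0 < \<sigma> * (outer_normal K e \<bullet> v)"
proof (rule ccontr)
  assume "\<not> thesis"
  with that have no: "\<not> (outer_normal K e \<bullet> (y + t *\<^sub>R v) = facet_level K e \<and> 0 < \<sigma> * (outer_normal K e \<bullet> v))"
    if "e facet_of K" for e using that by blast
  have "\<forall>\<^sub>F \<epsilon> in at_right 0. outer_normal K e \<bullet> (y + (t + \<sigma> * \<epsilon>) *\<^sub>R v) \<le> facet_level K e"
    if e: "e \<in> facets K" for e
  proof -
    have le: "outer_normal K e \<bullet> (y + t *\<^sub>R v) \<le> facet_level K e"
      using t e solid_polytope_halfspaces[OF K] by blast
    have eq: "outer_normal K e \<bullet> (y + (t + \<sigma> * \<epsilon>) *\<^sub>R v) =
        outer_normal K e \<bullet> (y + t *\<^sub>R v) + \<epsilon> * (\<sigma> * (outer_normal K e \<bullet> v))" for \<epsilon>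
      by (simp add: inner_add_right algebra_simps)
    show ?thesis
    proof (cases "\<sigma> * (outer_normal K e \<bullet> v) \<le> 0")
      case True
      have "outer_normal K e \<bullet> (y + (t + \<sigma> * \<epsilon>) *\<^sub>R v) \<le> facet_level K e" if "0 < \<epsilon>" for \<epsilon>
        using mult_nonneg_nonpos[of \<epsilon>, OF _ True] le that unfolding eq by linarith
      then show ?thesis by (auto simp: eventually_at_filter)
    next
      case False
      then have lt: "outer_normal K e \<bullet> (y + t *\<^sub>R v) < facet_level K e" using no[of e] e le by force
      have "((\<lambda>\<epsilon>. outer_normal K e \<bullet> (y + (t + \<sigma> * \<epsilon>) *\<^sub>R v)) \<longlongrightarrow>
          outer_normal K e \<bullet> (y + (t + \<sigma> * 0) *\<^sub>R v)) (at_right 0)"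
        by (intro tendsto_intros)
      then have "\<forall>\<^sub>F \<epsilon> in at_right 0. outer_normal K e \<bullet> (y + (t + \<sigma> * \<epsilon>) *\<^sub>R v) < facet_level K e"
        by (rule order_tendstoD(2)) (use lt in simp)
      then show ?thesis by eventually_elim simp
    qed
  qed
  then have "\<forall>\<^sub>F \<epsilon> in at_right 0. \<forall>e\<in>facets K. outer_normal K e \<bullet> (y + (t + \<sigma> * \<epsilon>) *\<^sub>R v) \<le> facet_level K e"
    using finite_facets[OF K] by (intro eventually_ball_finite) auto
  moreover have "\<forall>\<^sub>F \<epsilon> in at_right 0. (0::real) < \<epsilon>" by (simp add: eventually_at_right_less)
  ultimately have "\<forall>\<^sub>F \<epsilon>::real in at_right 0. False"
  proof eventually_elim
    case (elim \<epsilon>)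
    then have "y + (t + \<sigma> * \<epsilon>) *\<^sub>R v \<in> K" using solid_polytope_halfspaces[OF K] by blast
    with out[of \<epsilon>] elim show ?case by simp
  qed
  then show False by (simp add: trivial_limit_at_right_real[unfolded trivial_limit_def])
qed

text \<open>
  The fundamental theorem of calculus on a generic line. The intersection with \<open>K\<close> is a compact interval; for a facet that is
  crossed outwards the point of incidence belongs to the facet if and only if it is the upper end of the interval, and
  similarly for the lower end. Genericity excludes that an end belongs to two facets that the line crosses.
\<close>

lemma integral_line_polytope:
  fixes K :: "(real^'n) set" and \<psi> D :: "real^'n \<Rightarrow> real"
  assumes K: "solid_polytope K" and v: "v \<noteq> 0"
    and deriv: "\<And>t. ((\<lambda>t. \<psi> (y + t *\<^sub>R v)) has_real_derivative D (y + t *\<^sub>R v)) (at t)"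
    and cont: "continuous_on UNIV D"
    and g1: "\<And>e. e facet_of K \<Longrightarrow> outer_normal K e \<bullet> v = 0 \<Longrightarrow> outer_normal K e \<bullet> y \<noteq> facet_level K e"
    and g2: "\<And>e e'. e facet_of K \<Longrightarrow> e' facet_of K \<Longrightarrow> e \<noteq> e' \<Longrightarrow>
       outer_normal K e \<bullet> v \<noteq> 0 \<Longrightarrow> outer_normal K e' \<bullet> v \<noteq> 0 \<Longrightarrow>
       height (outer_normal K e) (facet_level K e) v y \<noteq> height (outer_normal K e') (facet_level K e') v y"
  shows "(LINT t|lborel. indicator K (y + t *\<^sub>R v) * D (y + t *\<^sub>R v)) =
    (\<Sum>e\<in>facets K. sgn (outer_normal K e \<bullet> v) *
       (indicator e (hit (outer_normal K e) (facet_level K e) v y) * \<psi> (hit (outer_normal K e) (facet_level K e) v y)))"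
proof -
  let ?n = "outer_normal K" and ?b = "facet_level K"
  let ?h = "\<lambda>e. height (?n e) (?b e) v y" and ?H = "\<lambda>e. hit (?n e) (?b e) v y"
  define I where "I = {t. y + t *\<^sub>R v \<in> K}"
  have H: "?H e = y + (- ?h e) *\<^sub>R v" for e by (simp add: hit_def)
  have HI: "?H e \<in> e \<longleftrightarrow> - ?h e \<in> I" if "e facet_of K" "?n e \<bullet> v \<noteq> 0" for e
  proof -
    have "?H e \<in> e \<longleftrightarrow> ?H e \<in> K"
      using hit_inner[OF that(2), of "?b e" y] facet_data(3)[OF K that(1)] by blast
    then show ?thesis unfolding I_def H by simp
  qed
  show ?thesis
  proof (cases "I = {}")
    case True
    have "sgn (?n e \<bullet> v) * (indicator e (?H e) * \<psi> (?H e)) = 0" if "e \<in> facets K" for e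
      using HI[of e] that True by (cases "?n e \<bullet> v = 0") auto
    then have "(\<Sum>e\<in>facets K. sgn (?n e \<bullet> v) * (indicator e (?H e) * \<psi> (?H e))) = 0"
      by (intro sum.neutral) blast
    moreover have "(LINT t|lborel. indicator K (y + t *\<^sub>R v) * D (y + t *\<^sub>R v)) = 0"
      using True by (simp add: I_def indicator_def)
    ultimately show ?thesis by simp
  next
    case False
    have "compact I"
    proof (rule compact_eq_bounded_closed[THEN iffD2], rule conjI)
      obtain M where M: "\<And>x. x \<in> K \<Longrightarrow> norm x \<le> M"
        using solid_polytope_bounded[OF K] by (auto simp: bounded_iff)
      have "\<bar>t\<bar> \<le> (M + norm y) / norm v" if "t \<in> I" for t
      proof -
        have "\<bar>t\<bar> * norm v = norm ((y + t *\<^sub>R v) - y)" by simp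
        also have "\<dots> \<le> norm (y + t *\<^sub>R v) + norm y" by (rule norm_triangle_ineq4)
        also have "\<dots> \<le> M + norm y" using M that by (auto simp: I_def)
        finally show ?thesis using v by (simp add: pos_le_divide_eq)
      qed
      then show "bounded I" unfolding bounded_iff real_norm_def by blast
      show "closed I"
      proof -
        have "continuous_on UNIV (\<lambda>t. y + t *\<^sub>R v)" by (intro continuous_intros)
        then have "closed ((\<lambda>t. y + t *\<^sub>R v) -` K)"
          using closed_vimage solid_polytope_closed[OF K] by blast
        then show ?thesis by (simp add: I_def vimage_def)
      qed
    qed
    moreover have "convex I"
    proof (rule convexI)
      fix a b u w :: real assume *: "a \<in> I" "b \<in> I" "0 \<le> u" "0 \<le> w" "u + w = 1"
      have "u *\<^sub>R (y + a *\<^sub>R v) + w *\<^sub>R (y + b *\<^sub>R v) \<in> K"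
        using * solid_polytope_convex[OF K] unfolding I_def by (intro convexD) auto
      also have "u *\<^sub>R (y + a *\<^sub>R v) + w *\<^sub>R (y + b *\<^sub>R v) = (u + w) *\<^sub>R y + (u * a + w * b) *\<^sub>R v"
        by (simp add: algebra_simps)
      finally show "u *\<^sub>R a + w *\<^sub>R b \<in> I" using *(5) by (simp add: I_def)
    qed
    ultimately obtain a b where ab: "I = {a..b}"
      using connected_compact_interval_1 convex_connected by metis
    then have le: "a \<le> b" using False by auto
    obtain e1 where e1: "e1 facet_of K" "?n e1 \<bullet> (y + b *\<^sub>R v) = ?b e1" "0 < 1 * (?n e1 \<bullet> v)"
    proof (rule line_end_facet[where y=y and t=b and v=v and \<sigma>=1, OF K g1])
      have "b \<in> I" "\<And>\<epsilon>. 0 < \<epsilon> \<Longrightarrow> b + 1 * \<epsilon> \<notin> I" using ab le by auto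
      then show "y + b *\<^sub>R v \<in> K" "\<And>\<epsilon>. 0 < \<epsilon> \<Longrightarrow> y + (b + 1 * \<epsilon>) *\<^sub>R v \<notin> K" by (auto simp: I_def)
    qed
    obtain e0 where e0: "e0 facet_of K" "?n e0 \<bullet> (y + a *\<^sub>R v) = ?b e0" "0 < - 1 * (?n e0 \<bullet> v)"
    proof (rule line_end_facet[where y=y and t=a and v=v and \<sigma>="- 1", OF K g1])
      have "a \<in> I" "\<And>\<epsilon>. 0 < \<epsilon> \<Longrightarrow> a + - 1 * \<epsilon> \<notin> I" using ab le by auto
      then show "y + a *\<^sub>R v \<in> K" "\<And>\<epsilon>. 0 < \<epsilon> \<Longrightarrow> y + (a + - 1 * \<epsilon>) *\<^sub>R v \<notin> K" by (auto simp: I_def)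
    qed
    have h1: "- ?h e1 = b" using e1 by (simp add: height_def inner_add_right field_simps)
    have h0: "- ?h e0 = a" using e0 by (simp add: height_def inner_add_right field_simps)
    have Ile: "?n e \<bullet> y + t * (?n e \<bullet> v) \<le> ?b e" if "t \<in> I" "e facet_of K" for t e
      using that solid_polytope_halfspaces[OF K, of "y + t *\<^sub>R v"] by (auto simp: I_def inner_add_right)
    have "sgn (?n e \<bullet> v) * (indicator e (?H e) * \<psi> (?H e)) =
      (if e = e1 then \<psi> (y + b *\<^sub>R v) else 0) - (if e = e0 then \<psi> (y + a *\<^sub>R v) else 0)"
      if e: "e \<in> facets K" for e
    proof -
      consider "?n e \<bullet> v = 0" | "?n e \<bullet> v > 0" | "?n e \<bullet> v < 0" by linarith
      then show ?thesis
      proof cases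
        case 1
        then show ?thesis using e1 e0 by auto
      next
        case 2
        then have "e \<noteq> e0" using e0 by auto
        have "- ?h e \<in> I \<longleftrightarrow> e = e1"
        proof
          assume *: "- ?h e \<in> I"
          have "b \<le> - ?h e"
            using Ile[of b e] e 2 ab le by (simp add: height_def field_simps)
          then have "?h e = ?h e1" using * ab h1 by auto
          then show "e = e1" using g2[of e e1] e e1 2 by auto
        qed (use h1 ab le in auto)
        moreover have "?H e1 = y + b *\<^sub>R v" unfolding H h1 ..
        ultimately show ?thesis using 2 HI[of e] e \<open>e \<noteq> e0\<close> by (auto simp: indicator_def)
      next
        case 3
        then have "e \<noteq> e1" using e1 by auto
        have "- ?h e \<in> I \<longleftrightarrow> e = e0"
        proof
          assume *: "- ?h e \<in> I"
          have "- ?h e \<le> a"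
            using Ile[of a e] e 3 ab le by (simp add: height_def field_simps)
          then have "?h e = ?h e0" using * ab h0 by auto
          then show "e = e0" using g2[of e e0] e e0 3 by auto
        qed (use h0 ab le in auto)
        moreover have "?H e0 = y + a *\<^sub>R v" unfolding H h0 ..
        ultimately show ?thesis using 3 HI[of e] e \<open>e \<noteq> e1\<close> by (auto simp: indicator_def)
      qed
    qed
    then have "(\<Sum>e\<in>facets K. sgn (?n e \<bullet> v) * (indicator e (?H e) * \<psi> (?H e))) =
      \<psi> (y + b *\<^sub>R v) - \<psi> (y + a *\<^sub>R v)"
      using finite_facets[OF K] e0 e1 by (simp add: sum_subtractf)
    also have "\<dots> = (LINT t|lborel. D (y + t *\<^sub>R v) * indicator {a..b} t)"
    proof (rule integral_FTC_Icc_real[OF le deriv, symmetric])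
      have "continuous_on UNIV (\<lambda>t. D (y + t *\<^sub>R v))"
        by (rule continuous_on_compose2[OF cont]) (auto intro!: continuous_intros)
      then show "isCont (\<lambda>t. D (y + t *\<^sub>R v)) x" for x by (simp add: continuous_on_eq_continuous_at)
    qed
    also have "\<dots> = (LINT t|lborel. indicator K (y + t *\<^sub>R v) * D (y + t *\<^sub>R v))"
      unfolding ab[symmetric] I_def by (rule Bochner_Integration.integral_cong) (auto simp: indicator_def)
    finally show ?thesis by simp
  qed
qed

text \<open>
  Lines that run in the hyperplane of a facet, or meet the hyperplanes of two facets at the same parameter, are contained in finitely many hyperplanes.
\<close>

lemma AE_generic_line:
  fixes K :: "(real^'n) set"
  assumes K: "solid_polytope K"
  shows "AE y in lborel. (\<forall>e\<in>facets K. outer_normal K e \<bullet> v = 0 \<longrightarrow> outer_normal K e \<bullet> y \<noteq> facet_level K e) \<and>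
    (\<forall>e\<in>facets K. \<forall>e'\<in>facets K. e \<noteq> e' \<and> outer_normal K e \<bullet> v \<noteq> 0 \<and> outer_normal K e' \<bullet> v \<noteq> 0 \<longrightarrow>
       height (outer_normal K e) (facet_level K e) v y \<noteq> height (outer_normal K e') (facet_level K e') v y)"
proof -
  let ?n = "outer_normal K" and ?b = "facet_level K"
  have hyp: "AE y in lborel. a \<bullet> y \<noteq> c" if "a \<noteq> 0 \<or> c \<noteq> 0" for a :: "real^'n" and c
  proof -
    have "negligible {y. a \<bullet> y = c}" by (rule negligible_hyperplane) (use that in auto)
    moreover have "closed {y. a \<bullet> y = c}" by (rule closed_hyperplane)
    ultimately have "AE y in lborel. y \<notin> {y. a \<bullet> y = c}"
      by (intro AE_not_in) (auto simp: negligible_iff_null_sets null_sets_def)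
    then show ?thesis by simp
  qed
  have A: "AE y in lborel. ?n e \<bullet> v = 0 \<longrightarrow> ?n e \<bullet> y \<noteq> ?b e" if "e \<in> facets K" for e
  proof -
    have "?n e \<noteq> 0" using facet_data(1)[OF K, of e] that by auto
    from hyp[of "?n e" "?b e"] this show ?thesis by auto
  qed
  have B: "AE y in lborel. e \<noteq> e' \<and> ?n e \<bullet> v \<noteq> 0 \<and> ?n e' \<bullet> v \<noteq> 0 \<longrightarrow>
       height (?n e) (?b e) v y \<noteq> height (?n e') (?b e') v y" if "e \<in> facets K" "e' \<in> facets K" for e e'
  proof (cases "e \<noteq> e' \<and> ?n e \<bullet> v \<noteq> 0 \<and> ?n e' \<bullet> v \<noteq> 0")
    case True
    define a where "a = ?n e /\<^sub>R (?n e \<bullet> v) - ?n e' /\<^sub>R (?n e' \<bullet> v)"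
    define c where "c = ?b e / (?n e \<bullet> v) - ?b e' / (?n e' \<bullet> v)"
    have eq: "height (?n e) (?b e) v y = height (?n e') (?b e') v y \<longleftrightarrow> a \<bullet> y = c" for y
      by (simp add: height_def a_def c_def inner_diff_left diff_divide_distrib divide_inverse algebra_simps)
    have "a \<noteq> 0 \<or> c \<noteq> 0"
    proof (rule ccontr)
      assume "\<not> ?thesis"
      then have all: "height (?n e) (?b e) v y = height (?n e') (?b e') v y" for y using eq by simp
      have "?n e \<bullet> y = ?b e \<longleftrightarrow> ?n e' \<bullet> y = ?b e'" for y
        using all[of y] True by (auto simp: height_def)
      then have "K \<inter> {x. ?n e \<bullet> x = ?b e} = K \<inter> {x. ?n e' \<bullet> x = ?b e'}" by auto
      then show False using facet_data(3)[OF K, of e] facet_data(3)[OF K, of e'] that True by auto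
    qed
    from hyp[OF this] show ?thesis unfolding eq by auto
  qed auto
  show ?thesis
    by (intro AE_conjI AE_finite_allI finite_facets[OF K] A B)
qed

lemma facet_bounded_image:
  assumes K: "solid_polytope K" and e: "e facet_of K" and g: "continuous_on UNIV (g :: real^'n \<Rightarrow> real)"
  shows "\<exists>B. \<forall>x\<in>e. norm (g x) \<le> B"
proof -
  have "compact (g ` e)"
    by (rule compact_continuous_image[OF continuous_on_subset[OF g] facet_compact[OF K e]]) simp
  then have "bounded (g ` e)" by (rule compact_imp_bounded)
  then show ?thesis by (simp add: bounded_iff)
qed

lemma integrable_surf_continuous:
  assumes K: "solid_polytope K" and e: "e facet_of K" and g: "continuous_on UNIV (g :: real^'n \<Rightarrow> real)"
  shows "integrable (surf e) g"
proof -
  obtain B where B: "\<And>x. x \<in> e \<Longrightarrow> norm (g x) \<le> B"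
    using facet_bounded_image[OF K e g] by blast
  have "g \<in> borel_measurable borel" using g by (rule borel_measurable_continuous_onI)
  then have "g \<in> borel_measurable (surf e)"
    unfolding measurable_cong_sets[OF sets_surf refl] by (rule measurable_restrict_space1)
  then show ?thesis
    by (rule finite_measure.integrable_const_bound[OF finite_measure_surf[OF K e], rotated])
      (use B in \<open>auto simp: space_surf intro!: AE_I2\<close>)
qed

text \<open>
  The directional derivative of \<open>\<psi>\<close> along \<open>v\<close> is \<open>D\<close>.
\<close>

lemma integral_polytope_directional:
  fixes K :: "(real^'n) set" and \<psi> D :: "real^'n \<Rightarrow> real"
  assumes K: "solid_polytope K" and v: "v \<noteq> 0"
    and \<psi>: "continuous_on UNIV \<psi>" and D: "continuous_on UNIV D"
    and deriv: "\<And>y t. ((\<lambda>t. \<psi> (y + t *\<^sub>R v)) has_real_derivative D (y + t *\<^sub>R v)) (at t)"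
  shows "(LINT x|lborel. indicator K x * D x) = (\<Sum>e\<in>facets K. (outer_normal K e \<bullet> v) * (LINT x|surf e. \<psi> x))"
proof -
  let ?n = "outer_normal K" and ?b = "facet_level K"
  let ?H = "\<lambda>e. hit (?n e) (?b e) v"
  define s where "s y = (v \<bullet> y) / (v \<bullet> v)" for y
  have s_meas[measurable]: "s \<in> borel_measurable borel" unfolding s_def[abs_def] by simp
  have s: "s (y + t *\<^sub>R v) = s y + t" for y t
    using v by (simp add: s_def inner_add_right add_divide_distrib)
  let ?S = "\<lambda>y. indicator {y. 0 \<le> s y \<and> s y < 1} y :: real"
  let ?T = "\<lambda>e y. sgn (?n e \<bullet> v) * (?S y * (indicator e (?H e y) * \<psi> (?H e y)))"
  have \<psi>m[measurable]: "\<psi> \<in> borel_measurable borel" using \<psi> by (rule borel_measurable_continuous_onI)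
  have Dm[measurable]: "D \<in> borel_measurable borel" using D by (rule borel_measurable_continuous_onI)
  have Km[measurable]: "K \<in> sets borel" using solid_polytope_closed[OF K] by simp
  have "integrable lborel (\<lambda>x. indicator K x *\<^sub>R D x)"
    by (rule borel_integrable_compact[OF solid_polytope_compact[OF K]])
      (rule continuous_on_subset[OF D], simp)
  then have "integrable lborel (\<lambda>x. indicator K x * D x)" by simp
  then have "(LINT x|lborel. indicator K x * D x) =
     (LINT y|lborel. ?S y * (LINT t|lborel. indicator K (y + t *\<^sub>R v) * D (y + t *\<^sub>R v)))"
    by (rule integral_slices[OF s_meas _ s])
  also have "\<dots> = (LINT y|lborel. (\<Sum>e\<in>facets K. ?T e y))"
  proof (rule integral_cong_AE)
    show "AE y in lborel. ?S y * (LINT t|lborel. indicator K (y + t *\<^sub>R v) * D (y + t *\<^sub>R v)) =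
       (\<Sum>e\<in>facets K. ?T e y)"
      using AE_generic_line[OF K, of v]
    proof eventually_elim
      case (elim y)
      have "(LINT t|lborel. indicator K (y + t *\<^sub>R v) * D (y + t *\<^sub>R v)) =
        (\<Sum>e\<in>facets K. sgn (?n e \<bullet> v) * (indicator e (?H e y) * \<psi> (?H e y)))"
        by (rule integral_line_polytope[OF K v deriv D]) (use elim in auto)
      then show ?case by (simp add: sum_distrib_left mult.left_commute)
    qed
    show "(\<lambda>y. ?S y * (LINT t|lborel. indicator K (y + t *\<^sub>R v) * D (y + t *\<^sub>R v))) \<in> borel_measurable lborel"
      by (intro borel_measurable_times lborel.borel_measurable_lebesgue_integral)
        (simp_all add: case_prod_unfold)
    have "e \<in> sets borel" if "e \<in> facets K" for e
      using facet_compact[OF K, of e] that by (simp add: compact_imp_closed)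
    then show "(\<lambda>y. \<Sum>e\<in>facets K. ?T e y) \<in> borel_measurable lborel"
      by (intro borel_measurable_sum borel_measurable_times) simp_all
  qed
  also have "\<dots> = (\<Sum>e\<in>facets K. (LINT y|lborel. ?T e y))"
  proof (rule Bochner_Integration.integral_sum)
    fix e assume "e \<in> facets K"
    then have e: "e facet_of K" by simp
    have em[measurable]: "e \<in> sets borel" using facet_compact[OF K e] by (simp add: compact_imp_closed)
    show "integrable lborel (?T e)"
    proof (cases "?n e \<bullet> v = 0")
      case False
      let ?A = "{y. 0 \<le> s y \<and> s y < 1 \<and> ?H e y \<in> e}"
      obtain B where B: "\<And>x. x \<in> e \<Longrightarrow> norm (\<psi> x) \<le> B"
        using facet_bounded_image[OF K e \<psi>] by blast
      have "integrable lborel (\<lambda>y. indicator ?A y *\<^sub>R \<psi> (?H e y))"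
      proof (rule integrableI_bounded_set_indicator)
        show "?A \<in> sets lborel" by measurable
        show "emeasure lborel ?A < \<infinity>"
          unfolding emeasure_section_change[OF s_meas em s False]
          using emeasure_bounded_finite[OF bounded_height_hit[OF compact_imp_bounded[OF facet_compact[OF K e]]]]
          by simp
        show "AE y in lborel. y \<in> ?A \<longrightarrow> norm (\<psi> (?H e y)) \<le> B" using B by auto
      qed simp
      then have "integrable lborel (\<lambda>y. sgn (?n e \<bullet> v) * (indicator ?A y *\<^sub>R \<psi> (?H e y)))" by simp
      also have "(\<lambda>y. sgn (?n e \<bullet> v) * (indicator ?A y *\<^sub>R \<psi> (?H e y))) = ?T e"
        by (auto simp: fun_eq_iff indicator_def)
      finally show ?thesis .
    qed simp
  qed
  also have "\<dots> = (\<Sum>e\<in>facets K. (?n e \<bullet> v) * (LINT x|surf e. \<psi> x))"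
  proof (rule sum.cong[OF refl])
    fix e assume "e \<in> facets K"
    then have e: "e facet_of K" by simp
    show "(LINT y|lborel. ?T e y) = (?n e \<bullet> v) * (LINT x|surf e. \<psi> x)"
    proof (cases "?n e \<bullet> v = 0")
      case False
      have "(LINT y|lborel. ?T e y) =
          sgn (?n e \<bullet> v) * (LINT y|lborel. ?S y * (indicator e (?H e y) * \<psi> (?H e y)))"
        by (rule integral_mult_right_zero)
      also have "\<dots> = sgn (?n e \<bullet> v) * (\<bar>?n e \<bullet> v\<bar> * (LINT x|surf e. \<psi> x))"
        unfolding integral_surf_slab[OF K e \<psi>m False s_meas s] ..
      finally show ?thesis by (simp add: mult.assoc[symmetric] sgn_mult_abs)
    qed simp
  qed
  finally show ?thesis .
qed

text \<open>
  The divergence theorem for the product of an affine field and a \<open>C\<^sup>1\<close> function; the divergence of \<open>x \<mapsto> a + M *v x\<close> is the trace of \<open>M\<close>.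
\<close>

theorem divergence_theorem_polytope:
  fixes K :: "(real^'n) set" and \<phi> :: "real^'n \<Rightarrow> real" and M :: "real^'n^'n"
  assumes K: "solid_polytope K" and \<phi>: "Ck 1 \<phi>" and r: "\<And>x. r x = a + M *v x"
  shows "(LINT x|lborel. indicator K x * (r x \<bullet> grad \<phi> x + trace M * \<phi> x)) =
     (\<Sum>e\<in>facets K. (LINT x|surf e. (r x \<bullet> outer_normal K e) * \<phi> x))"
proof -
  have \<phi>c: "continuous_on UNIV \<phi>" by (rule Ck_continuous[OF \<phi>])
  have pc: "continuous_on UNIV (partial i \<phi>)" for i using \<phi> by simp
  have dif: "\<phi> differentiable (at x)" for x using \<phi> by simp
  have rc: "continuous_on UNIV (\<lambda>x. r x $ i)" for i
    unfolding r by (intro continuous_intros)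
  let ?D = "\<lambda>i x. r x $ i * partial i \<phi> x + M $ i $ i * \<phi> x"
  have Dc: "continuous_on UNIV (?D i)" for i
    by (intro continuous_intros rc pc \<phi>c)
  have deriv: "((\<lambda>t. r (y + t *\<^sub>R axis i 1) $ i * \<phi> (y + t *\<^sub>R axis i 1)) has_real_derivative
      ?D i (y + t *\<^sub>R axis i 1)) (at t)" for y i t
  proof -
    have ri: "r (y + t *\<^sub>R axis i 1) $ i = r y $ i + t * M $ i $ i" for t
      by (simp add: r matrix_vector_right_distrib matrix_vector_mult_scaleR matrix_vector_mult_basis column_def)
    have "((\<lambda>t. \<phi> (y + t *\<^sub>R axis i 1)) has_derivative
        (\<lambda>h. grad \<phi> (y + t *\<^sub>R axis i 1) \<bullet> (h *\<^sub>R axis i 1))) (at t)"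
      by (rule has_derivative_compose[OF _ has_derivative_grad[OF dif]])
        (auto intro!: derivative_eq_intros)
    then have d: "((\<lambda>t. \<phi> (y + t *\<^sub>R axis i 1)) has_real_derivative partial i \<phi> (y + t *\<^sub>R axis i 1)) (at t)"
      by (simp add: has_field_derivative_def grad_def inner_axis mult.commute[of _ "partial i \<phi> _"])
    have "((\<lambda>t. r y $ i + t * M $ i $ i) has_real_derivative M $ i $ i) (at t)"
      by (auto intro!: derivative_eq_intros)
    from DERIV_mult[OF this d] show ?thesis unfolding ri by (simp add: algebra_simps)
  qed
  have Di: "integrable lborel (\<lambda>x. indicator K x *\<^sub>R ?D i x)" for i
    by (rule borel_integrable_compact[OF solid_polytope_compact[OF K]])
      (rule continuous_on_subset[OF Dc], simp)
  have "indicator K x * (r x \<bullet> grad \<phi> x + trace M * \<phi> x) = (\<Sum>i\<in>UNIV. indicator K x * ?D i x)" for x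
    by (simp add: inner_vec_def grad_def trace_def sum.distrib sum_distrib_left sum_distrib_right distrib_left mult.assoc)
  then have "(LINT x|lborel. indicator K x * (r x \<bullet> grad \<phi> x + trace M * \<phi> x)) =
      (LINT x|lborel. (\<Sum>i\<in>UNIV. indicator K x * ?D i x))" by simp
  also have "\<dots> = (\<Sum>i\<in>UNIV. (LINT x|lborel. indicator K x * ?D i x))"
    using Di by (intro Bochner_Integration.integral_sum) simp
  also have "\<dots> = (\<Sum>i\<in>UNIV. \<Sum>e\<in>facets K. (outer_normal K e \<bullet> axis i 1) * (LINT x|surf e. r x $ i * \<phi> x))"
    by (intro sum.cong refl integral_polytope_directional[OF K _ _ Dc deriv])
      (auto intro!: continuous_intros rc \<phi>c)
  also have "\<dots> = (\<Sum>e\<in>facets K. \<Sum>i\<in>UNIV. (outer_normal K e \<bullet> axis i 1) * (LINT x|surf e. r x $ i * \<phi> x))"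
    by (rule sum.swap)
  also have "\<dots> = (\<Sum>e\<in>facets K. (LINT x|surf e. (r x \<bullet> outer_normal K e) * \<phi> x))"
  proof (rule sum.cong[OF refl])
    fix e assume "e \<in> facets K"
    then have e: "e facet_of K" by simp
    have i: "integrable (surf e) (\<lambda>x. r x $ i * \<phi> x)" for i
      by (rule integrable_surf_continuous[OF K e]) (intro continuous_intros rc \<phi>c)
    have "(\<Sum>i\<in>UNIV. (outer_normal K e \<bullet> axis i 1) * (LINT x|surf e. r x $ i * \<phi> x)) =
      (\<Sum>i\<in>UNIV. (LINT x|surf e. (outer_normal K e \<bullet> axis i 1) * (r x $ i * \<phi> x)))" by simp
    also have "\<dots> = (LINT x|surf e. (\<Sum>i\<in>UNIV. (outer_normal K e \<bullet> axis i 1) * (r x $ i * \<phi> x)))"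
      by (rule Bochner_Integration.integral_sum[symmetric]) (use i in simp)
    also have "\<dots> = (LINT x|surf e. (r x \<bullet> outer_normal K e) * \<phi> x)"
    proof -
      have "(\<Sum>i\<in>UNIV. (outer_normal K e \<bullet> axis i 1) * (r x $ i * \<phi> x)) = (r x \<bullet> outer_normal K e) * \<phi> x" for x
        unfolding inner_axis inner_real_def mult_1_right
        by (simp add: inner_vec_def sum_distrib_right mult.assoc mult.left_commute)
      then show ?thesis by simp
    qed
    finally show "(\<Sum>i\<in>UNIV. (outer_normal K e \<bullet> axis i 1) * (LINT x|surf e. r x $ i * \<phi> x)) =
      (LINT x|surf e. (r x \<bullet> outer_normal K e) * \<phi> x)" .
  qed
  finally show ?thesis .
qed

section \<open>Square integrable fields and weak divergences\<close>

lemma test_fun_Ck: "\<phi> \<in> test_fun U \<Longrightarrow> Ck m \<phi>"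
  by (simp add: test_fun_def)

lemma partial_outside_support:
  assumes "x \<notin> closure {x. \<phi> x \<noteq> 0}"
  shows "partial i \<phi> x = 0"
proof -
  have "((\<lambda>x. 0) has_derivative (\<lambda>h. 0)) (at x)" by simp
  then have "(\<phi> has_derivative (\<lambda>h. 0)) (at x)"
    by (rule has_derivative_transform_within_open[where s="- closure {x. \<phi> x \<noteq> 0}"])
      (use assms closure_subset[of "{x. \<phi> x \<noteq> 0}"] in auto)
  then show ?thesis by (rule partial_eq)
qed

lemma partial_test_fun:
  assumes \<phi>: "\<phi> \<in> test_fun U"
  shows "partial i \<phi> \<in> test_fun U"
proof -
  have sub: "closure {x. partial i \<phi> x \<noteq> 0} \<subseteq> closure {x. \<phi> x \<noteq> 0}"
    by (rule closure_minimal) (use partial_outside_support[of _ \<phi> i] in auto)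
  have "Ck m (partial i \<phi>)" for m
    using \<phi> unfolding test_fun_def by (metis (mono_tags, lifting) Ck.simps(2) mem_Collect_eq)
  moreover have "compact (closure {x. partial i \<phi> x \<noteq> 0})"
    using \<phi> compact_Int_closed[of "closure {x. \<phi> x \<noteq> 0}" "closure {x. partial i \<phi> x \<noteq> 0}"] sub
    by (simp add: test_fun_def Int_absorb1)
  ultimately show ?thesis using \<phi> sub unfolding test_fun_def by blast
qed

lemma test_fun_outside: "\<phi> \<in> test_fun U \<Longrightarrow> x \<notin> U \<Longrightarrow> \<phi> x = 0"
  unfolding test_fun_def using closure_subset[of "{x. \<phi> x \<noteq> 0}"] by blast

lemma grad_outside: "\<phi> \<in> test_fun U \<Longrightarrow> x \<notin> U \<Longrightarrow> grad \<phi> x = 0"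
  using test_fun_outside[OF partial_test_fun[of \<phi> U]] by (simp add: grad_def vec_eq_iff)

lemma test_fun_mono: "U \<subseteq> V \<Longrightarrow> \<phi> \<in> test_fun U \<Longrightarrow> \<phi> \<in> test_fun V"
  unfolding test_fun_def by blast

lemma test_fun_continuous: "\<phi> \<in> test_fun U \<Longrightarrow> continuous_on UNIV \<phi>"
  by (rule Ck_continuous[OF test_fun_Ck[where m=0]])

lemma test_fun_measurable: "\<phi> \<in> test_fun U \<Longrightarrow> \<phi> \<in> borel_measurable borel"
  by (rule borel_measurable_continuous_onI[OF test_fun_continuous])

lemma grad_continuous: "Ck 1 \<phi> \<Longrightarrow> continuous_on UNIV (grad \<phi>)"
  unfolding grad_def[abs_def] by (intro continuous_on_vec_lambda) simp

lemma test_fun_bounded: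
  assumes \<phi>: "\<phi> \<in> test_fun U"
  obtains B where "\<And>x. \<bar>\<phi> x\<bar> \<le> B"
proof -
  let ?S = "closure {x. \<phi> x \<noteq> 0}"
  have "compact (\<phi> ` ?S)"
    using \<phi> by (intro compact_continuous_image continuous_on_subset[OF test_fun_continuous[OF \<phi>]])
      (auto simp: test_fun_def)
  then have "bounded (\<phi> ` ?S)" by (rule compact_imp_bounded)
  then obtain B where B: "\<And>x. x \<in> ?S \<Longrightarrow> \<bar>\<phi> x\<bar> \<le> B" by (auto simp: bounded_iff)
  have "\<bar>\<phi> x\<bar> \<le> max B 0" for x
    using B[of x] closure_subset[of "{x. \<phi> x \<noteq> 0}"] by (cases "\<phi> x = 0") auto
  then show thesis by (rule that)
qed

lemma abs_inner_le_sum_squares: "\<bar>u \<bullet> v\<bar> \<le> (norm u)\<^sup>2 + (norm v)\<^sup>2" for u v :: "'a::real_inner"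
proof -
  have "\<bar>u \<bullet> v\<bar> \<le> norm u * norm v" by (rule Cauchy_Schwarz_ineq2)
  also have "\<dots> \<le> (norm u)\<^sup>2 + (norm v)\<^sup>2"
    using sum_squares_bound[of "norm u" "norm v"] mult_nonneg_nonneg[OF norm_ge_zero[of u] norm_ge_zero[of v]]
    by linarith
  finally show ?thesis .
qed

lemma L2_inner_integrable:
  fixes u v :: "'a \<Rightarrow> 'b::euclidean_space"
  assumes u: "L2 M u" and v: "L2 M v"
  shows "integrable M (\<lambda>x. u x \<bullet> v x)"
proof (rule Bochner_Integration.integrable_bound)
  show "integrable M (\<lambda>x. (norm (u x))\<^sup>2 + (norm (v x))\<^sup>2)"
    using assms by (simp add: L2_def)
  show "(\<lambda>x. u x \<bullet> v x) \<in> borel_measurable M"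
    using assms by (auto simp: L2_def intro: borel_measurable_inner)
  show "AE x in M. norm (u x \<bullet> v x) \<le> norm ((norm (u x))\<^sup>2 + (norm (v x))\<^sup>2)"
    using abs_inner_le_sum_squares[of "u _" "v _"] by (auto intro!: AE_I2 order_trans[OF _ abs_ge_self])
qed

lemma L2_bounded:
  fixes u :: "'a \<Rightarrow> 'b::euclidean_space"
  assumes "finite_measure M" "u \<in> borel_measurable M" "\<And>x. x \<in> space M \<Longrightarrow> norm (u x) \<le> B"
  shows "L2 M u"
  unfolding L2_def
proof
  show "integrable M (\<lambda>x. (norm (u x))\<^sup>2)"
    by (rule finite_measure.integrable_const_bound[OF assms(1), where B="B\<^sup>2"])
      (use assms in \<open>auto intro!: AE_I2 power_mono\<close>)
qed fact

lemma L2_integrable: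
  fixes u :: "'a \<Rightarrow> 'b::euclidean_space"
  assumes M: "finite_measure M" and u: "L2 M u"
  shows "integrable M u"
proof (rule Bochner_Integration.integrable_bound)
  show "integrable M (\<lambda>x. 1 + (norm (u x))\<^sup>2)"
    using u M by (simp add: L2_def finite_measure.integrable_const)
  show "u \<in> borel_measurable M" using u by (simp add: L2_def)
  have "norm a \<le> 1 + (norm a)\<^sup>2" for a :: 'b
    using sum_squares_bound[of 1 "norm a"] norm_ge_zero[of a] unfolding mult_1_right one_power2 by linarith
  then show "AE x in M. norm (u x) \<le> norm (1 + (norm (u x))\<^sup>2)"
    by (intro AE_I2) (simp add: order_trans[OF _ abs_ge_self])
qed

lemma L2_add:
  fixes u v :: "'a \<Rightarrow> 'b::euclidean_space"
  assumes u: "L2 M u" and v: "L2 M v"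
  shows "L2 M (\<lambda>x. u x + v x)"
  unfolding L2_def
proof
  have m: "u \<in> borel_measurable M" "v \<in> borel_measurable M" using assms by (auto simp: L2_def)
  then show "(\<lambda>x. u x + v x) \<in> borel_measurable M" by simp
  have "integrable M (\<lambda>x. (norm (u x))\<^sup>2 + (norm (v x))\<^sup>2 + 2 * (u x \<bullet> v x))"
    using assms L2_inner_integrable[OF u v] by (simp add: L2_def)
  then show "integrable M (\<lambda>x. (norm (u x + v x))\<^sup>2)"
    by (simp add: power2_norm_eq_inner inner_add_left inner_add_right inner_commute algebra_simps)
qed

lemma L2_scale:
  fixes u :: "'a \<Rightarrow> 'b::euclidean_space"
  shows "L2 M u \<Longrightarrow> L2 M (\<lambda>x. c *\<^sub>R u x)"
  by (auto simp: L2_def power_mult_distrib intro: borel_measurable_scaleR)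

lemma L2_zero: "L2 M (\<lambda>x. 0)"
  by (simp add: L2_def)

lemma L2_sum:
  fixes u :: "'i \<Rightarrow> 'a \<Rightarrow> 'b::euclidean_space"
  shows "finite A \<Longrightarrow> (\<And>i. i \<in> A \<Longrightarrow> L2 M (u i)) \<Longrightarrow> L2 M (\<lambda>x. \<Sum>i\<in>A. c i *\<^sub>R u i x)"
  by (induction A rule: finite_induct) (simp_all add: L2_zero L2_add L2_scale)

lemma finite_measure_lebesgue_on:
  fixes U :: "'a::euclidean_space set"
  assumes "bounded U" "U \<in> sets lebesgue"
  shows "finite_measure (lebesgue_on U)"
proof (rule finite_measureI)
  have "emeasure (lebesgue_on U) (space (lebesgue_on U)) = emeasure lebesgue U"
    using assms(2) by (simp add: space_restrict_space emeasure_restrict_space)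
  also have "\<dots> \<noteq> \<infinity>"
    using fmeasurableD2[OF bounded_set_imp_lmeasurable[OF assms]] by simp
  finally show "emeasure (lebesgue_on U) (space (lebesgue_on U)) \<noteq> \<infinity>" .
qed

lemma test_fun_L2:
  assumes "bounded U" "U \<in> sets lebesgue" and \<phi>: "\<phi> \<in> test_fun V"
  shows "L2 (lebesgue_on U) \<phi>"
proof -
  obtain B where "\<And>x. \<bar>\<phi> x\<bar> \<le> B" using test_fun_bounded[OF \<phi>] by blast
  moreover have "\<phi> \<in> borel_measurable (lebesgue_on U)"
    using test_fun_measurable[OF \<phi>] by (intro measurable_restrict_space1 measurable_completion) simp
  ultimately show ?thesis
    by (intro L2_bounded[OF finite_measure_lebesgue_on[OF assms(1,2)]]) auto
qed

lemma grad_L2: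
  fixes \<phi> :: "real^'n \<Rightarrow> real"
  assumes "bounded U" "U \<in> sets lebesgue" and \<phi>: "\<phi> \<in> test_fun V"
  shows "L2 (lebesgue_on U) (grad \<phi>)"
proof -
  have "grad \<phi> = (\<lambda>x. \<Sum>i\<in>UNIV. 1 *\<^sub>R (partial i \<phi> x *\<^sub>R axis i 1))"
    using basis_expansion[of "grad \<phi> _"] by (auto simp: fun_eq_iff grad_def scalar_mult_eq_scaleR)
  moreover have "L2 (lebesgue_on U) (\<lambda>x. partial i \<phi> x *\<^sub>R (axis i 1 :: real^'n))" for i
    using test_fun_L2[OF assms(1,2) partial_test_fun[OF \<phi>, of i]]
    by (auto simp: L2_def power_mult_distrib norm_axis_1 intro: borel_measurable_scaleR)
  then have "L2 (lebesgue_on U) (\<lambda>x. \<Sum>i\<in>UNIV. 1 *\<^sub>R (partial i \<phi> x *\<^sub>R (axis i 1 :: real^'n)))"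
    by (intro L2_sum) auto
  ultimately show ?thesis by simp
qed

lemma L2_subset:
  fixes u :: "'a::euclidean_space \<Rightarrow> 'b::euclidean_space"
  assumes u: "L2 (lebesgue_on U) u" and V: "V \<subseteq> U" "V \<in> sets lebesgue" and U: "U \<in> sets lebesgue"
  shows "L2 (lebesgue_on V) u"
  unfolding L2_def
proof
  have eq: "lebesgue_on V = restrict_space (lebesgue_on U) V"
    using V U by (simp add: restrict_restrict_space Int_absorb1)
  then show "u \<in> borel_measurable (lebesgue_on V)"
    using u by (simp add: L2_def measurable_restrict_space1)
  have "integrable (lebesgue_on U) (\<lambda>x. (norm (u x))\<^sup>2)" using u by (simp add: L2_def)
  then have "integrable lebesgue (\<lambda>x. indicator U x *\<^sub>R (norm (u x))\<^sup>2)"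
    unfolding integrable_lebesgue_on[OF U] .
  then have "integrable lebesgue (\<lambda>x. indicator V x *\<^sub>R (indicator U x *\<^sub>R (norm (u x))\<^sup>2))"
    by (rule integrable_mult_indicator[OF V(2)])
  moreover have "(\<lambda>x. indicator V x *\<^sub>R (indicator U x *\<^sub>R (norm (u x))\<^sup>2)) =
      (\<lambda>x. indicator V x *\<^sub>R (norm (u x))\<^sup>2)"
    using V by (auto simp: fun_eq_iff indicator_def)
  ultimately show "integrable (lebesgue_on V) (\<lambda>x. (norm (u x))\<^sup>2)"
    unfolding integrable_lebesgue_on[OF V(2)] by (simp only:)
qed

lemma ip_sum_left:
  fixes u :: "'i \<Rightarrow> real^'n \<Rightarrow> 'b::euclidean_space"
  assumes "finite A" "\<And>i. i \<in> A \<Longrightarrow> L2 (lebesgue_on U) (u i)" "L2 (lebesgue_on U) w"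
  shows "ip U (\<lambda>x. \<Sum>i\<in>A. c i *\<^sub>R u i x) w = (\<Sum>i\<in>A. c i * ip U (u i) w)"
  unfolding ip_def inner_sum_left inner_scaleR_left
  using assms L2_inner_integrable by (subst Bochner_Integration.integral_sum) auto

lemma weak_div_sum:
  fixes v :: "'i \<Rightarrow> real^'n \<Rightarrow> real^'n"
  assumes U: "bounded U" "U \<in> sets lebesgue" and A: "finite A"
    and v: "\<And>i. i \<in> A \<Longrightarrow> L2 (lebesgue_on U) (v i)" and g: "\<And>i. i \<in> A \<Longrightarrow> L2 (lebesgue_on U) (g i)"
    and d: "\<And>i. i \<in> A \<Longrightarrow> weak_div U (v i) (g i)"
  shows "weak_div U (\<lambda>x. \<Sum>i\<in>A. c i *\<^sub>R v i x) (\<lambda>x. \<Sum>i\<in>A. c i * g i x)"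
  unfolding weak_div_def
proof
  fix \<phi> assume \<phi>: "\<phi> \<in> test_fun U"
  have "ip U (\<lambda>x. \<Sum>i\<in>A. c i *\<^sub>R v i x) (grad \<phi>) = (\<Sum>i\<in>A. c i * ip U (v i) (grad \<phi>))"
    by (rule ip_sum_left[OF A v grad_L2[OF U \<phi>]])
  also have "\<dots> = - (\<Sum>i\<in>A. c i * ip U (g i) \<phi>)"
    using d \<phi> by (simp add: weak_div_def sum_negf)
  also have "(\<Sum>i\<in>A. c i * ip U (g i) \<phi>) = ip U (\<lambda>x. \<Sum>i\<in>A. c i *\<^sub>R g i x) \<phi>"
    by (rule ip_sum_left[OF A g test_fun_L2[OF U \<phi>], symmetric])
  finally show "ip U (\<lambda>x. \<Sum>i\<in>A. c i *\<^sub>R v i x) (grad \<phi>) = - ip U (\<lambda>x. \<Sum>i\<in>A. c i * g i x) \<phi>" by simp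
qed

lemma ip_subset:
  assumes "V \<subseteq> U" "V \<in> sets lebesgue" "U \<in> sets lebesgue" "\<And>x. x \<notin> V \<Longrightarrow> w x = 0"
  shows "ip V v w = ip U v w"
proof -
  have "indicator V x *\<^sub>R (v x \<bullet> w x) = indicator U x *\<^sub>R (v x \<bullet> w x)" for x
    using assms(1) assms(4)[of x] by (cases "x \<in> V") auto
  then show ?thesis
    unfolding ip_def integral_lebesgue_on[OF assms(2)] integral_lebesgue_on[OF assms(3)]
    by (intro Bochner_Integration.integral_cong refl)
qed

lemma weak_div_subset:
  assumes d: "weak_div U v g" and V: "V \<subseteq> U" "V \<in> sets lebesgue" "U \<in> sets lebesgue"
  shows "weak_div V v g"
  unfolding weak_div_def
proof
  fix \<phi> assume \<phi>: "\<phi> \<in> test_fun V"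
  have "ip V v (grad \<phi>) = ip U v (grad \<phi>)" "ip V g \<phi> = ip U g \<phi>"
    using ip_subset[OF V] grad_outside[OF \<phi>] test_fun_outside[OF \<phi>] by blast+
  then show "ip V v (grad \<phi>) = - ip V g \<phi>"
    using d test_fun_mono[OF V(1) \<phi>] by (simp add: weak_div_def)
qed

lemma ip_cong_AE:
  assumes U: "U \<in> sets lebesgue" and "ae_eq U u u'" "ae_eq U w w'"
  shows "ip U u w = ip U u' w'"
proof -
  have "AE x in lebesgue. x \<in> U \<longrightarrow> u x = u' x \<and> w x = w' x"
    using assms by (auto simp: ae_eq_def AE_lebesgue_on_iff)
  then have "AE x in lebesgue. indicator U x *\<^sub>R (u x \<bullet> w x) = indicator U x *\<^sub>R (u' x \<bullet> w' x)"
    by eventually_elim (auto simp: indicator_def)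
  then show ?thesis
    unfolding ip_def integral_lebesgue_on[OF U] by (rule integral_lebesgue_cong_AE(2))
qed

lemma ae_eq_refl: "ae_eq U u u"
  by (simp add: ae_eq_def)

lemma ae_eq_sym:
  assumes "ae_eq U u v"
  shows "ae_eq U v u"
  using assms unfolding ae_eq_def by eventually_elim simp

lemma ae_eq_trans:
  assumes "ae_eq U u v" "ae_eq U v w"
  shows "ae_eq U u w"
  using assms unfolding ae_eq_def by eventually_elim simp

lemma ae_eq_subset:
  assumes "ae_eq U u v" "V \<subseteq> U" "V \<in> sets lebesgue" "U \<in> sets lebesgue"
  shows "ae_eq V u v"
proof -
  have "AE x in lebesgue. x \<in> U \<longrightarrow> u x = v x"
    using assms(1) unfolding ae_eq_def AE_lebesgue_on_iff[OF assms(4)] .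
  then show ?thesis
    unfolding ae_eq_def AE_lebesgue_on_iff[OF assms(3)]
    by eventually_elim (use assms(2) in blast)
qed

lemma weak_div_cong_AE:
  assumes "U \<in> sets lebesgue" "ae_eq U v v'" "ae_eq U g g'" "weak_div U v g"
  shows "weak_div U v' g'"
  using assms(4) ip_cong_AE[OF assms(1,2) ae_eq_refl, of "grad _"] ip_cong_AE[OF assms(1,3) ae_eq_refl]
  unfolding weak_div_def by metis

text \<open>
  A weak divergence is unique almost everywhere.
\<close>

lemma weak_div_unique:
  fixes v :: "real^'n \<Rightarrow> real^'n"
  assumes U: "bounded U" "open U" and g: "L2 (lebesgue_on U) g" "L2 (lebesgue_on U) h"
    and d: "weak_div U v g" "weak_div U v h"
  shows "ae_eq U g h"
proof -
  have Um: "U \<in> sets lebesgue" using U by simp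
  note fm = finite_measure_lebesgue_on[OF U(1) Um]
  have gi: "integrable (lebesgue_on U) (\<lambda>x. g x - h x)"
    by (intro Bochner_Integration.integrable_diff L2_integrable[OF fm] g)
  have "AE x in lebesgue_on U. g x - h x = 0"
  proof (rule AE_zero_if_orthogonal_to_test_funs[OF U(2) gi])
    fix \<phi> assume \<phi>: "\<phi> \<in> test_fun U"
    have "ip U g \<phi> = ip U h \<phi>" using d \<phi> by (auto simp: weak_div_def)
    moreover have "(LINT x|lebesgue_on U. (g x - h x) * \<phi> x) = ip U g \<phi> - ip U h \<phi>"
      unfolding ip_def left_diff_distrib inner_real_def
      using L2_inner_integrable[OF g(1) test_fun_L2[OF U(1) Um \<phi>]] L2_inner_integrable[OF g(2) test_fun_L2[OF U(1) Um \<phi>]]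
      by (intro Bochner_Integration.integral_diff) auto
    ultimately show "(LINT x|lebesgue_on U. (g x - h x) * \<phi> x) = 0" by simp
  qed
  then show ?thesis unfolding ae_eq_def by eventually_elim simp
qed

lemma wdiv_weak_div:
  assumes "weak_div U v g" "L2 (lebesgue_on U) g"
  shows "weak_div U v (wdiv U v)" "L2 (lebesgue_on U) (wdiv U v)"
proof -
  have "L2 (lebesgue_on U) (wdiv U v) \<and> weak_div U v (wdiv U v)"
    unfolding wdiv_def
    by (rule someI[where P="\<lambda>g. L2 (lebesgue_on U) g \<and> weak_div U v g", OF conjI[OF assms(2,1)]])
  then show "weak_div U v (wdiv U v)" "L2 (lebesgue_on U) (wdiv U v)" by simp_all
qed

lemma wdiv_ae_eq:
  fixes v :: "real^'n \<Rightarrow> real^'n"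
  assumes U: "bounded U" "open U" and "weak_div U v g" "L2 (lebesgue_on U) g"
  shows "ae_eq U (wdiv U v) g"
  by (rule weak_div_unique[OF U wdiv_weak_div(2) assms(4) wdiv_weak_div(1) assms(3)]) (rule assms)+

lemma L2_const: "bounded U \<Longrightarrow> U \<in> sets lebesgue \<Longrightarrow> L2 (lebesgue_on U) (\<lambda>x. c::real)"
  for U :: "'a::euclidean_space set"
  by (rule L2_bounded[OF finite_measure_lebesgue_on, of _ _ "\<bar>c\<bar>"]) auto

lemma open_ae_const:
  fixes c d :: real and U :: "(real^'n) set"
  assumes "open U" "U \<noteq> {}" "ae_eq U (\<lambda>x. c) (\<lambda>x. d)"
  shows "c = d"
proof (rule ccontr)
  assume "c \<noteq> d"
  moreover have "AE x in lebesgue. x \<in> U \<longrightarrow> c = d"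
    using assms(1,3) unfolding ae_eq_def by (subst (asm) AE_lebesgue_on_iff) simp_all
  ultimately have "AE x in lebesgue. x \<notin> U" by simp
  then have "U \<in> null_sets lebesgue" using assms(1) by (subst AE_iff_null_sets) auto
  then show False using open_not_negligible[OF assms(1,2)] by (simp add: negligible_iff_null_sets)
qed

section \<open>Cells and Raviart--Thomas fields\<close>

lemma solid_polytopeI:
  fixes K :: "(real^'n) set"
  assumes "polytope K" "aff_dim K = int CARD('n)"
  shows "solid_polytope K"
proof -
  have "K \<noteq> {}" using assms(2) by auto
  moreover have "rel_interior K = interior K" using assms(2) by (intro interior_rel_interior) simp
  ultimately show ?thesis
    using assms(1) rel_interior_eq_empty[OF polytope_imp_convex[OF assms(1)]] by (auto simp: solid_polytope_def)
qed

lemma solid_polytope_parallelotope: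
  fixes b :: "real^'n"
  assumes "invertible B"
  shows "solid_polytope (parallelotope b B)"
proof (rule solid_polytopeI)
  have inj: "inj ((*v) B)" using assms by (simp add: inj_matrix_vector_mult)
  have eq: "parallelotope b B = (+) b ` (*v) B ` cbox 0 One"
    by (simp add: parallelotope_def image_image)
  show "polytope (parallelotope b B)"
    unfolding eq by (simp add: polytope_translation_eq polytope_linear_image polytope_interval)
  have "interior (cbox 0 One :: (real^'n) set) \<noteq> {}"
    by (simp add: box_ne_empty)
  then have "aff_dim (cbox 0 One :: (real^'n) set) = int CARD('n)"
    using aff_dim_nonempty_interior[of "cbox 0 One :: (real^'n) set"] by simp
  then show "aff_dim (parallelotope b B) = int CARD('n)"
    unfolding eq using inj by (simp add: aff_dim_translation_eq aff_dim_injective_linear_image)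
qed

lemma cell_solid_polytope:
  fixes K :: "(real^'n) set"
  assumes "cell K"
  shows "solid_polytope K"
  using assms unfolding cell_def
proof
  assume s: "int CARD('n) simplex K"
  show ?thesis
    by (rule solid_polytopeI[OF simplex_imp_polytope[OF s] aff_dim_simplex[OF s]])
qed (use solid_polytope_parallelotope in blast)

lemma RT0_affine:
  fixes r :: "real^'n \<Rightarrow> real^'n"
  assumes "r \<in> RT0 K"
  obtains a M where "\<And>x. r x = a + M *v x"
proof -
  consider "\<exists>a c. \<forall>x. r x = a + c *\<^sub>R x"
    | "\<exists>b (B :: real^'n^'n) a c. invertible B \<and> (\<forall>y. r (b + B *v y) = B *v (\<chi> i. a $ i + c $ i * y $ i))"
    using assms unfolding RT0_def mem_Collect_eq by blast
  then show thesis
  proof cases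
    case 1
    then obtain a c where "\<And>x. r x = a + c *\<^sub>R x" by auto
    then have "r x = a + (c *\<^sub>R mat 1) *v x" for x by (simp add: scaleR_matrix_vector_assoc[symmetric])
    then show thesis by (rule that)
  next
    case 2
    then obtain b a c and B :: "real^'n^'n" where B: "invertible B"
      and r: "\<And>y. r (b + B *v y) = B *v (\<chi> i. a $ i + c $ i * y $ i)" by auto
    obtain C where C: "B ** C = mat 1" "C ** B = mat 1" using B by (auto simp: invertible_def)
    define D where "D = (\<chi> i j. if i = j then c $ i else 0)"
    have D: "D *v y = (\<chi> i. c $ i * y $ i)" for y
      by (simp add: D_def matrix_vector_mult_def vec_eq_iff if_distrib[of "\<lambda>z. z * _"] cong: if_cong)
    have "r x = (B *v a - B *v (D *v (C *v b))) + (B ** D ** C) *v x" for x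
    proof -
      have "x = b + B *v (C *v (x - b))" by (simp add: matrix_vector_mul_assoc C)
      then have "r x = B *v (\<chi> i. a $ i + c $ i * (C *v (x - b)) $ i)" using r by metis
      also have "(\<chi> i. a $ i + c $ i * (C *v (x - b)) $ i) = a + D *v (C *v (x - b))"
        by (simp add: D vec_eq_iff)
      finally show ?thesis
        by (simp add: matrix_vector_mul_assoc[symmetric] matrix_vector_right_distrib matrix_vector_mult_diff_distrib algebra_simps)
    qed
    then show thesis by (rule that)
  qed
qed

lemma RT0_continuous: "r \<in> RT0 K \<Longrightarrow> continuous_on UNIV r"
proof -
  assume "r \<in> RT0 K"
  then obtain a M where r: "\<And>x. r x = a + M *v x" by (rule RT0_affine) blast
  show ?thesis unfolding r by (intro continuous_intros)
qed

lemma null_boundary_polytope: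
  assumes "solid_polytope K"
  shows "K - interior K \<in> null_sets lebesgue"
  using negligible_convex_frontier[OF solid_polytope_convex[OF assms]] solid_polytope_closed[OF assms]
  by (simp add: frontier_def negligible_iff_null_sets)

lemma AE_interior_iff:
  assumes "solid_polytope K"
  shows "(AE x in lebesgue_on K. P x) \<longleftrightarrow> (AE x in lebesgue_on (interior K). P x)"
proof -
  have "AE x in lebesgue. x \<notin> K - interior K" by (rule AE_not_in[OF null_boundary_polytope[OF assms]])
  moreover have "K \<in> sets lebesgue" "interior K \<in> sets lebesgue"
    using solid_polytope_closed[OF assms] by simp_all
  ultimately show ?thesis
    using interior_subset[of K] by (auto simp: AE_lebesgue_on_iff elim: eventually_elim2)
qed

lemma ae_eq_interior_iff: "solid_polytope K \<Longrightarrow> ae_eq K u v \<longleftrightarrow> ae_eq (interior K) u v"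
  unfolding ae_eq_def by (rule AE_interior_iff)

lemma ip_interior:
  assumes K: "solid_polytope K"
  shows "ip (interior K) u v = ip K u v"
proof -
  have "AE x in lebesgue. x \<notin> K - interior K" by (rule AE_not_in[OF null_boundary_polytope[OF K]])
  then have "AE x in lebesgue. indicator (interior K) x *\<^sub>R (u x \<bullet> v x) = indicator K x *\<^sub>R (u x \<bullet> v x)"
    by eventually_elim (use interior_subset[of K] in \<open>auto simp: indicator_def\<close>)
  then show ?thesis
    unfolding ip_def using solid_polytope_closed[OF K]
    by (simp add: integral_lebesgue_on integral_lebesgue_cong_AE(2))
qed

lemma integral_interior_continuous:
  fixes F :: "real^'n \<Rightarrow> real"
  assumes K: "solid_polytope K" and F: "continuous_on UNIV F"
  shows "integrable (lebesgue_on (interior K)) F"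
    and "(LINT x|lebesgue_on (interior K). F x) = (LINT x|lborel. indicator K x * F x)"
proof -
  have Km: "K \<in> sets lborel" using solid_polytope_closed[OF K] by simp
  have Fm: "F \<in> borel_measurable lborel" using borel_measurable_continuous_onI[OF F] by simp
  have ae: "AE x in lebesgue. indicator (interior K) x *\<^sub>R F x = indicator K x *\<^sub>R F x"
    using AE_not_in[OF null_boundary_polytope[OF K]]
    by eventually_elim (use interior_subset[of K] in \<open>auto simp: indicator_def\<close>)
  have i: "integrable lborel (\<lambda>x. indicator K x *\<^sub>R F x)"
    by (rule borel_integrable_compact[OF solid_polytope_compact[OF K]])
      (rule continuous_on_subset[OF F], simp)
  have m: "(\<lambda>x. indicator K x *\<^sub>R F x) \<in> borel_measurable lborel" using Km Fm by simp
  show "integrable (lebesgue_on (interior K)) F"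
    using i integrable_completion[OF m] integral_lebesgue_cong_AE(1)[OF ae]
    by (simp add: integrable_lebesgue_on)
  show "(LINT x|lebesgue_on (interior K). F x) = (LINT x|lborel. indicator K x * F x)"
    using integral_completion[OF m] integral_lebesgue_cong_AE(2)[OF ae]
    by (simp add: integral_lebesgue_on)
qed

text \<open>
  The mean value over a face with respect to surface measure.
\<close>

definition facet_mean :: "(real^'n) set \<Rightarrow> (real^'n \<Rightarrow> real) \<Rightarrow> real" where
  "facet_mean e \<phi> = (LINT x|surf e. \<phi> x) / measure (surf e) e"

text \<open>
  Green's formula for a Raviart--Thomas basis field: the only boundary term is the mean over the facet of the field.
  The classical divergence of the field is constant, and it is \<open>1 / |K|\<close> because weak divergences are unique.
\<close>

lemma rt0_basis_green:
  fixes K :: "(real^'n) set"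
  assumes K: "solid_polytope K" and rt: "rt0_basis K rt" and e: "e facet_of K" and \<phi>: "Ck 1 \<phi>"
  shows "ip (interior K) (rt e) (grad \<phi>) + ip (interior K) (\<lambda>x. 1 / measure lebesgue K) \<phi> = facet_mean e \<phi>"
proof -
  let ?U = "interior K"
  have eR: "rt e \<in> RT0 K" and wd: "weak_div ?U (rt e) (\<lambda>x. 1 / measure lebesgue K)"
    and flux: "\<And>e' x. e' facet_of K \<Longrightarrow> x \<in> e' \<Longrightarrow>
       rt e x \<bullet> outer_normal K e' = (if e' = e then 1 / measure (surf e) e else 0)"
    using rt e unfolding rt0_basis_def by auto
  obtain a M where r: "\<And>x. rt e x = a + M *v x" by (rule RT0_affine[OF eR]) blast
  have main: "ip ?U (rt e) (grad \<phi>) + ip ?U (\<lambda>x. trace M) \<phi> = facet_mean e \<phi>" if \<phi>: "Ck 1 \<phi>" for \<phi>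
  proof -
    have c1: "continuous_on UNIV (\<lambda>x. rt e x \<bullet> grad \<phi> x)"
      by (intro continuous_intros RT0_continuous[OF eR] grad_continuous[OF \<phi>])
    have c2: "continuous_on UNIV (\<lambda>x. trace M * \<phi> x)"
      by (intro continuous_intros Ck_continuous[OF \<phi>])
    have "ip ?U (rt e) (grad \<phi>) + ip ?U (\<lambda>x. trace M) \<phi> =
        (LINT x|lebesgue_on ?U. rt e x \<bullet> grad \<phi> x + trace M * \<phi> x)"
      unfolding ip_def inner_real_def
      using integral_interior_continuous(1)[OF K c1] integral_interior_continuous(1)[OF K c2]
      by (intro Bochner_Integration.integral_add[symmetric])
    also have "\<dots> = (LINT x|lborel. indicator K x * (rt e x \<bullet> grad \<phi> x + trace M * \<phi> x))"
      by (rule integral_interior_continuous(2)[OF K]) (intro continuous_on_add c1 c2)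
    also have "\<dots> = (\<Sum>e'\<in>facets K. (LINT x|surf e'. (rt e x \<bullet> outer_normal K e') * \<phi> x))"
      by (rule divergence_theorem_polytope[OF K \<phi> r])
    also have "\<dots> = (\<Sum>e'\<in>facets K. if e' = e then facet_mean e \<phi> else 0)"
    proof (rule sum.cong[OF refl])
      fix e' assume e': "e' \<in> facets K"
      have "(LINT x|surf e'. (rt e x \<bullet> outer_normal K e') * \<phi> x) =
        (LINT x|surf e'. (if e' = e then 1 / measure (surf e) e else 0) * \<phi> x)"
        by (rule Bochner_Integration.integral_cong) (use flux[of e'] e' in \<open>auto simp: space_surf\<close>)
      then show "(LINT x|surf e'. (rt e x \<bullet> outer_normal K e') * \<phi> x) = (if e' = e then facet_mean e \<phi> else 0)"
        by (simp add: facet_mean_def)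
    qed
    finally show ?thesis using finite_facets[OF K] e by simp
  qed
  have "weak_div ?U (rt e) (\<lambda>x. trace M)"
    unfolding weak_div_def
  proof
    fix \<phi> assume \<phi>: "\<phi> \<in> test_fun ?U"
    have "e \<inter> interior K = {}" using frontier_solid_polytope[OF K] e by blast
    then have "(LINT x|surf e. \<phi> x) = (LINT x|surf e. 0)"
      using test_fun_outside[OF \<phi>] by (intro Bochner_Integration.integral_cong) (auto simp: space_surf)
    then have "facet_mean e \<phi> = 0" by (simp add: facet_mean_def)
    then show "ip ?U (rt e) (grad \<phi>) = - ip ?U (\<lambda>x. trace M) \<phi>"
      using main[OF test_fun_Ck[OF \<phi>]] by linarith
  qed
  moreover have "bounded ?U" using solid_polytope_bounded[OF K] bounded_subset interior_subset by blast
  ultimately have "ae_eq ?U (\<lambda>x. trace M) (\<lambda>x. 1 / measure lebesgue K)"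
    using wd by (intro weak_div_unique L2_const) auto
  then have "trace M = 1 / measure lebesgue K"
    using K by (intro open_ae_const[of ?U]) (auto simp: solid_polytope_def)
  then show ?thesis using main[OF \<phi>] by simp
qed

section \<open>Combinations of Raviart--Thomas fields\<close>

lemma matrix_sum_vector_mult: "(\<Sum>i\<in>A. M i) *v x = (\<Sum>i\<in>A. M i *v x)" for M :: "'i \<Rightarrow> real^'n^'m"
  by (induction A rule: infinite_finite_induct) (simp_all add: matrix_vector_mult_add_rdistrib)

lemma rt0_combination_affine:
  fixes K :: "(real^'n) set"
  assumes K: "solid_polytope K" and rt: "rt0_basis K rt"
  shows "\<exists>\<alpha> M. \<forall>x. (\<Sum>e\<in>facets K. a e *\<^sub>R rt e x) = \<alpha> + M *v x"
proof -
  have "\<exists>\<alpha> M. \<forall>x. rt e x = \<alpha> + M *v x" if "e \<in> facets K" for e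
  proof -
    have "rt e \<in> RT0 K" using rt that by (auto simp: rt0_basis_def)
    then show ?thesis by (metis RT0_affine)
  qed
  then obtain \<alpha> M where r: "\<And>e x. e \<in> facets K \<Longrightarrow> rt e x = \<alpha> e + M e *v x" by metis
  have "(\<Sum>e\<in>facets K. a e *\<^sub>R rt e x) =
      (\<Sum>e\<in>facets K. a e *\<^sub>R \<alpha> e) + (\<Sum>e\<in>facets K. a e *\<^sub>R M e) *v x" for x
    by (simp add: r scaleR_add_right sum.distrib matrix_sum_vector_mult scaleR_matrix_vector_assoc)
  then show ?thesis by blast
qed

lemma rt0_combination_flux:
  assumes rt: "rt0_basis K rt" and K: "solid_polytope K" and e': "e' facet_of K" and x: "x \<in> e'"
  shows "(\<Sum>e\<in>facets K. a e *\<^sub>R rt e x) \<bullet> outer_normal K e' = a e' / measure (surf e') e'"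
proof -
  have "(\<Sum>e\<in>facets K. a e *\<^sub>R rt e x) \<bullet> outer_normal K e' =
      (\<Sum>e\<in>facets K. a e * (rt e x \<bullet> outer_normal K e'))"
    by (simp add: inner_sum_left)
  also have "\<dots> = (\<Sum>e\<in>facets K. if e = e' then a e' / measure (surf e') e' else 0)"
    using rt e' x by (intro sum.cong refl) (auto simp: rt0_basis_def)
  also have "\<dots> = a e' / measure (surf e') e'"
    using finite_facets[OF K] e' by simp
  finally show ?thesis .
qed

text \<open>
  On a parallelotope, the Raviart--Thomas fields are the affine fields with constant normal component on each facet.
  This description does not refer to the representation \<open>b\<close>, \<open>B\<close> of the parallelotope, which is not unique and may differ
  between the basis fields.
\<close>

lemma RT0_parallelotopeI:
  fixes b :: "real^'n"
  assumes B: "invertible B" and K: "K = parallelotope b B"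
    and w: "\<And>x. w x = \<alpha> + M *v x"
    and flux: "\<And>e x y. e facet_of K \<Longrightarrow> x \<in> e \<Longrightarrow> y \<in> e \<Longrightarrow> w x \<bullet> outer_normal K e = w y \<bullet> outer_normal K e"
  shows "w \<in> RT0 K"
proof -
  have sK: "solid_polytope K" unfolding K by (rule solid_polytope_parallelotope[OF B])
  obtain C where C: "B ** C = mat 1" "C ** B = mat 1" using B by (auto simp: invertible_def)
  define v where "v y = C *v w (b + B *v y)" for y
  define \<alpha>' where "\<alpha>' = C *v (\<alpha> + M *v b)"
  define \<Gamma> where "\<Gamma> = C ** M ** B"
  have v: "v y = \<alpha>' + \<Gamma> *v y" for y
    by (simp add: v_def w \<alpha>'_def \<Gamma>_def matrix_vector_right_distrib matrix_vector_mul_assoc[symmetric] add.assoc)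
  have Bv: "w (b + B *v y) = B *v v y" for y
    by (simp add: v_def matrix_vector_mul_assoc C)
  have diag: "\<Gamma> $ i $ j = 0" if ij: "i \<noteq> j" for i j
  proof -
    define a where "a = row i C"
    have a: "(C *v x) $ i = a \<bullet> x" for x
      by (simp add: a_def row_def matrix_vector_mult_def inner_vec_def)
    have aK: "a \<bullet> (b + B *v y) = a \<bullet> b + y $ i" for y
      by (simp add: inner_add_right a[symmetric] matrix_vector_mul_assoc C)
    have ge: "a \<bullet> x \<ge> a \<bullet> b" if "x \<in> K" for x
      using that aK unfolding K parallelotope_def by (auto simp: mem_box_cart)
    \<comment> \<open>the facet on which the reference coordinate \<open>y $ i\<close> vanishes; its normal picks out the component \<open>i\<close> of \<open>v\<close>\<close>
    define F where "F = K \<inter> {x. a \<bullet> x = a \<bullet> b}"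
    have face: "F face_of K"
      unfolding F_def by (rule face_of_Int_supporting_hyperplane_ge[OF solid_polytope_convex[OF sK] ge])
    have one: "(One :: real^'n) $ l = 1" for l by (simp add: cart_eq_inner_axis)
    have inK: "b + B *v y \<in> K" if "\<And>l. 0 \<le> y $ l \<and> y $ l \<le> 1" for y
      unfolding K parallelotope_def by (intro imageI) (simp add: mem_box_cart one that del: sum_component)
    have F0: "b \<in> F" using inK[of 0] by (simp add: F_def)
    have Fj: "b + B *v axis l 1 \<in> F" if "l \<noteq> i" for l
      using inK[of "axis l 1"] aK[of "axis l 1"] that by (auto simp: F_def axis_def)
    have "b + B *v axis i 1 \<in> K - F"
      using inK[of "axis i 1"] aK[of "axis i 1"] by (auto simp: F_def axis_def)
    then have "F \<noteq> K" by blast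
    then obtain e where e: "e facet_of K" "F \<subseteq> e"
      using face_of_polyhedron_subset_facet[of K F] sK face F0
      by (metis empty_iff polytope_imp_polyhedron solid_polytope_def)
    define n where "n = outer_normal K e"
    have n: "norm n = 1" "\<And>x. x \<in> e \<Longrightarrow> n \<bullet> x = facet_level K e"
      using facet_data(1)[OF sK e(1)] facet_inner[OF sK e(1)] by (auto simp: n_def)
    define m where "m = transpose B *v n"
    have m: "n \<bullet> (B *v z) = m \<bullet> z" for z
      unfolding m_def by (metis dot_lmul_matrix inner_commute transpose_matrix_vector)
    have ml: "m $ l = 0" if "l \<noteq> i" for l
    proof -
      have "n \<bullet> (b + B *v axis l 1) = n \<bullet> b" using n(2) Fj[OF that] F0 e(2) by (metis subsetD)
      then have "m \<bullet> axis l 1 = 0" by (simp add: inner_add_right m)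
      then show ?thesis by (simp add: inner_axis)
    qed
    have mz: "m \<bullet> z = m $ i * z $ i" for z
    proof -
      have "m \<bullet> z = (\<Sum>l\<in>UNIV. if l = i then m $ i * z $ i else 0)"
        unfolding inner_vec_def by (intro sum.cong refl) (use ml in auto)
      then show ?thesis by simp
    qed
    have "m $ i \<noteq> 0"
    proof
      assume "m $ i = 0"
      then have "n \<bullet> (B *v (C *v n)) = 0" by (simp add: m mz)
      then have "n \<bullet> n = 0" by (simp add: matrix_vector_mul_assoc C)
      then show False using n(1) by simp
    qed
    have "w b \<bullet> n = w (b + B *v axis j 1) \<bullet> n"
      unfolding n_def by (rule flux[OF e(1)]) (use F0 Fj[of j] e(2) ij in auto)
    moreover have "w (b + B *v y) \<bullet> n = m $ i * v y $ i" for y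
      unfolding Bv by (simp add: inner_commute[of _ n] m mz)
    from this[of 0] this[of "axis j 1"] have "w b \<bullet> n = m $ i * v 0 $ i"
      "w (b + B *v axis j 1) \<bullet> n = m $ i * v (axis j 1) $ i" by simp_all
    ultimately have "v 0 $ i = v (axis j 1) $ i" using \<open>m $ i \<noteq> 0\<close> by simp
    then show ?thesis by (simp add: v matrix_vector_mult_basis column_def)
  qed
  have "w (b + B *v y) = B *v (\<chi> i. \<alpha>' $ i + (\<chi> i. \<Gamma> $ i $ i) $ i * y $ i)" for y
  proof -
    have "(\<Gamma> *v y) $ i = \<Gamma> $ i $ i * y $ i" for i
    proof -
      have "(\<Gamma> *v y) $ i = (\<Sum>j\<in>UNIV. if j = i then \<Gamma> $ i $ i * y $ i else 0)"
        unfolding matrix_vector_mult_def vec_lambda_beta by (intro sum.cong refl) (use diag in auto)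
      then show ?thesis by simp
    qed
    then have "v y = (\<chi> i. \<alpha>' $ i + (\<chi> i. \<Gamma> $ i $ i) $ i * y $ i)"
      by (simp add: v vec_eq_iff)
    then show ?thesis unfolding Bv by simp
  qed
  then show ?thesis unfolding RT0_def mem_Collect_eq using B K by blast
qed

lemma RT0_combination:
  fixes K :: "(real^'n) set"
  assumes cK: "cell K" and rt: "rt0_basis K rt"
  shows "(\<lambda>x. \<Sum>e\<in>facets K. a e *\<^sub>R rt e x) \<in> RT0 K"
proof (cases "\<exists>b B. invertible B \<and> K = parallelotope b B")
  case True
  then obtain b B where B: "invertible B" "K = parallelotope b B" by blast
  have sK: "solid_polytope K" by (rule cell_solid_polytope[OF cK])
  obtain \<alpha> M where *: "\<And>x. (\<Sum>e\<in>facets K. a e *\<^sub>R rt e x) = \<alpha> + M *v x"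
    using rt0_combination_affine[OF sK rt, of a] by blast
  show ?thesis
    by (rule RT0_parallelotopeI[OF B *]) (simp add: rt0_combination_flux[OF rt sK])
next
  case False
  then have s: "int CARD('n) simplex K" using cK unfolding cell_def by blast
  have "\<exists>\<alpha> c. \<forall>x. rt e x = \<alpha> + c *\<^sub>R x" if "e \<in> facets K" for e
  proof -
    have "rt e \<in> RT0 K" using rt that by (auto simp: rt0_basis_def)
    then show ?thesis using False unfolding RT0_def mem_Collect_eq by blast
  qed
  then obtain \<alpha> c where r: "\<And>e x. e \<in> facets K \<Longrightarrow> rt e x = \<alpha> e + c e *\<^sub>R x" by metis
  have "(\<Sum>e\<in>facets K. a e *\<^sub>R rt e x) =
      (\<Sum>e\<in>facets K. a e *\<^sub>R \<alpha> e) + (\<Sum>e\<in>facets K. a e * c e) *\<^sub>R x" for x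
    by (simp add: r scaleR_add_right sum.distrib scaleR_sum_left)
  then show ?thesis unfolding RT0_def mem_Collect_eq using s by blast
qed

section \<open>Faces of a conforming mesh\<close>

lemma facet_aff_dim: "solid_polytope K \<Longrightarrow> e facet_of K \<Longrightarrow> aff_dim e = int CARD('n) - 1" for K :: "(real^'n) set"
  using solid_polytope_aff_dim[of K] by (simp add: facet_of_def)

lemma facet_convex: "solid_polytope K \<Longrightarrow> e facet_of K \<Longrightarrow> convex e"
  by (rule face_of_imp_convex[OF facet_of_imp_face_of])

lemma face_eqI:
  fixes e e' :: "(real^'n) set"
  assumes "e face_of P" "e' face_of P" "convex P" "aff_dim e = aff_dim e'"
    and z: "z \<in> rel_interior e" "z \<in> e'"
  shows "e = e'"
proof -
  have sub: "e \<subseteq> e'"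
    using subset_of_face_of[OF assms(2) face_of_imp_subset[OF assms(1)]] z by blast
  have "e face_of e'" by (rule face_of_subset[OF assms(1) sub face_of_imp_subset[OF assms(2)]])
  moreover have "convex e'" by (rule face_of_imp_convex[OF assms(2)])
  ultimately show ?thesis using face_of_aff_dim_lt[of e' e] assms(4) by (cases "e = e'") simp_all
qed

text \<open>
  Near a relatively interior point of a facet, the polytope is a half ball: the constraints of the other facets are strict there.
\<close>

lemma facet_half_ball:
  fixes K :: "(real^'n) set"
  assumes K: "solid_polytope K" and e: "e facet_of K" and z: "z \<in> rel_interior e"
  obtains r where "0 < r" "ball z r \<inter> {x. outer_normal K e \<bullet> x \<le> facet_level K e} \<subseteq> K"
proof -
  have ze: "z \<in> e" using z rel_interior_subset by blast
  then have zK: "z \<in> K" using e facet_of_imp_subset by blast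
  have "\<forall>\<^sub>F x in nhds z. outer_normal K e' \<bullet> x < facet_level K e'" if e': "e' \<in> facets K - {e}" for e'
  proof -
    have "z \<notin> e'"
      using face_eqI[OF facet_of_imp_face_of[OF e] facet_of_imp_face_of _ _ z] e' K
        solid_polytope_convex facet_aff_dim[OF K] e by auto
    then have "outer_normal K e' \<bullet> z \<noteq> facet_level K e'" using facet_data(3)[OF K, of e'] e' zK by auto
    moreover have "outer_normal K e' \<bullet> z \<le> facet_level K e'"
      using solid_polytope_halfspaces[OF K] zK e' by auto
    ultimately have "outer_normal K e' \<bullet> z < facet_level K e'" by simp
    moreover have "((\<lambda>x. outer_normal K e' \<bullet> x) \<longlongrightarrow> outer_normal K e' \<bullet> z) (nhds z)"
      by (intro tendsto_intros filterlim_ident)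
    ultimately show ?thesis by (auto dest: order_tendstoD(2))
  qed
  then have "\<forall>\<^sub>F x in nhds z. \<forall>e'\<in>facets K - {e}. outer_normal K e' \<bullet> x < facet_level K e'"
    using finite_facets[OF K] by (intro eventually_ball_finite) auto
  then obtain r where r: "0 < r" "\<And>x. dist x z < r \<Longrightarrow> \<forall>e'\<in>facets K - {e}. outer_normal K e' \<bullet> x < facet_level K e'"
    unfolding eventually_nhds_metric by blast
  show thesis
  proof (rule that[OF r(1)], rule subsetI)
    fix x assume x: "x \<in> ball z r \<inter> {x. outer_normal K e \<bullet> x \<le> facet_level K e}"
    then have "\<forall>e'\<in>facets K - {e}. outer_normal K e' \<bullet> x < facet_level K e'"
      using r(2)[of x] by (auto simp: dist_commute)
    then show "x \<in> K" using solid_polytope_halfspaces[OF K] x by force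
  qed
qed

lemma interior_Un_sharing_facet:
  fixes K :: "(real^'n) set"
  assumes K: "solid_polytope K" "solid_polytope K'" and e: "e facet_of K" "e facet_of K'"
    and KK: "K \<inter> K' = e" and z: "z \<in> rel_interior e"
  shows "z \<in> interior (K \<union> K')"
proof -
  let ?n = "outer_normal K e" and ?b = "facet_level K e"
  let ?n' = "outer_normal K' e" and ?b' = "facet_level K' e"
  note d = facet_data[OF K(1) e(1)] and d' = facet_data[OF K(2) e(2)]
  have ze: "z \<in> e" using z rel_interior_subset by blast
  obtain r where r: "0 < r" "ball z r \<inter> {x. ?n \<bullet> x \<le> ?b} \<subseteq> K" by (rule facet_half_ball[OF K(1) e(1) z])
  obtain r' where r': "0 < r'" "ball z r' \<inter> {x. ?n' \<bullet> x \<le> ?b'} \<subseteq> K'" by (rule facet_half_ball[OF K(2) e(2) z])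
  have zb: "?n \<bullet> z = ?b" "?n' \<bullet> z = ?b'" using facet_inner[OF K(1) e(1) ze] facet_inner[OF K(2) e(2) ze] .
  have "?n' = ?n \<or> ?n' = - ?n"
    by (rule unit_normal_cases[OF d(1) d'(1) d(4)]) (rule facet_inner[OF K(2) e(2)])
  moreover have False if eq: "?n' = ?n"
  proof -
    define s where "s = min r r' / 2"
    define x where "x = z - s *\<^sub>R ?n"
    have s: "0 < s" "s < r" "s < r'" using r r' by (auto simp: s_def)
    have "dist z x = s" using s d(1) by (simp add: x_def dist_norm)
    moreover have nx: "?n \<bullet> x = ?b - s" using d(1) by (simp add: x_def inner_diff_right zb dot_square_norm)
    ultimately have "x \<in> K" "x \<in> K'" using r(2) r'(2) s zb eq by auto
    then have "x \<in> e" using KK by blast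
    then have "?n \<bullet> x = ?b" using facet_inner[OF K(1) e(1)] by blast
    then show False using nx s by simp
  qed
  ultimately have n': "?n' = - ?n" by blast
  then have b': "?b' = - ?b" using zb by simp
  have "ball z (min r r') \<subseteq> K \<union> K'"
  proof
    fix x assume x: "x \<in> ball z (min r r')"
    show "x \<in> K \<union> K'"
    proof (cases "?n \<bullet> x \<le> ?b")
      case True then show ?thesis using x r(2) by auto
    next
      case False then show ?thesis using x r'(2) unfolding n' b' by auto
    qed
  qed
  then show ?thesis using r r' by (meson centre_in_ball interior_maximal min_less_iff_conj open_ball subsetD)
qed

lemma facet_boundary:
  fixes K :: "(real^'n) set"
  assumes K: "solid_polytope K" and e: "e facet_of K"
  shows "e - rel_interior e = \<Union>(facets e)" "finite (facets e)"
    "\<And>g. g facet_of e \<Longrightarrow> aff_dim g = int CARD('n) - 2" "\<And>g. g facet_of e \<Longrightarrow> closed g \<and> g \<subseteq> e"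
proof -
  have p: "polytope e"
    using face_of_polytope_polytope facet_of_imp_face_of[OF e] K by (auto simp: solid_polytope_def)
  show "e - rel_interior e = \<Union>(facets e)"
    using rel_boundary_of_polyhedron[OF polytope_imp_polyhedron[OF p]] by simp
  show "finite (facets e)" using p by (rule finite_polytope_facets)
  show "aff_dim g = int CARD('n) - 2" if "g facet_of e" for g
    using that facet_aff_dim[OF K e] by (simp add: facet_of_def)
  show "closed g \<and> g \<subseteq> e" if "g facet_of e" for g
    using that face_of_polytope_polytope[OF p facet_of_imp_face_of[OF that]]
      polytope_imp_closed facet_of_imp_subset by blast
qed

lemma negligible_low_aff_dim:
  fixes S :: "(real^'n) set"
  assumes "aff_dim S < int CARD('n)"
  shows "negligible S"
proof -
  obtain a b where "a \<noteq> 0" "S \<subseteq> {x. a \<bullet> x = b}"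
    using aff_lowdim_subset_hyperplane[of S] assms by auto
  then show ?thesis using negligible_hyperplane negligible_subset by metis
qed

text \<open>
  In a finite set of polytopes, not every facet can be shared with another polytope of the set. Otherwise take a segment from an interior point to
  a point outside the (bounded) union, avoiding all faces of codimension two, which only excludes end points from finitely many hyperplanes. Where the segment
  leaves the union it is at a relatively interior point of a facet, and the union of the two polytopes that share the facet is a neighbourhood of this point.
\<close>

lemma no_closed_facet_pairing:
  fixes A :: "(real^'n) set set"
  assumes fin: "finite A" and ne: "A \<noteq> {}" and K: "\<And>K. K \<in> A \<Longrightarrow> solid_polytope K"
    and pair: "\<And>K e. K \<in> A \<Longrightarrow> e facet_of K \<Longrightarrow> \<exists>K'\<in>A. e facet_of K' \<and> K \<inter> K' = e"
  shows False
proof -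
  define W where "W = \<Union>A"
  obtain K0 where K0: "K0 \<in> A" using ne by blast
  obtain x0 where x0: "x0 \<in> interior K0" using K[OF K0] by (auto simp: solid_polytope_def)
  have sub: "K \<subseteq> W" if "K \<in> A" for K using that by (auto simp: W_def)
  have W: "compact W" unfolding W_def using fin K solid_polytope_compact by (intro compact_Union) auto
  define G where "G = (\<Union>K\<in>A. \<Union>e\<in>facets K. facets e)"
  have finG: "finite G"
    unfolding G_def using fin finite_facets[OF K] facet_boundary(2)[OF K] by auto
  have "negligible (\<Union>g\<in>G. affine hull (insert x0 g))"
  proof (rule negligible_Union)
    show "finite ((\<lambda>g. affine hull (insert x0 g)) ` G)" using finG by simp
    fix H assume "H \<in> (\<lambda>g. affine hull (insert x0 g)) ` G"
    then obtain K e g where g: "K \<in> A" "e facet_of K" "g facet_of e" "H = affine hull (insert x0 g)"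
      by (auto simp: G_def)
    have "aff_dim (insert x0 g) \<le> aff_dim g + 1" by (simp add: aff_dim_insert)
    also have "\<dots> < int CARD('n)" using facet_boundary(3)[OF K[OF g(1)] g(2,3)] by simp
    finally show "negligible H" unfolding g(4) by (intro negligible_low_aff_dim) simp
  qed
  moreover have "\<not> negligible (- W)"
  proof (rule open_not_negligible)
    show "open (- W)" using compact_imp_closed[OF W] by (simp add: open_Compl)
    show "- W \<noteq> {}" using compact_imp_bounded[OF W] not_bounded_UNIV by (metis Compl_empty_eq double_complement)
  qed
  ultimately have "\<not> - W \<subseteq> (\<Union>g\<in>G. affine hull (insert x0 g))" using negligible_subset by blast
  then obtain y where y: "y \<notin> W" "\<And>g. g \<in> G \<Longrightarrow> y \<notin> affine hull (insert x0 g)" by blast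
  have x0W: "x0 \<in> interior W" using interior_mono[OF sub[OF K0]] x0 by blast
  have "closed_segment x0 y \<inter> frontier W \<noteq> {}"
    by (rule connected_Int_frontier) (use x0W interior_subset y in auto)
  then obtain z where z: "z \<in> closed_segment x0 y" "z \<in> W" "z \<notin> interior W"
    using compact_imp_closed[OF W] by (auto simp: frontier_def)
  obtain K1 where K1: "K1 \<in> A" "z \<in> K1" using z(2) by (auto simp: W_def)
  have "z \<in> K1 - interior K1" using K1 z(3) interior_mono[OF sub[OF K1(1)]] by blast
  then obtain e where e: "e facet_of K1" "z \<in> e" using frontier_solid_polytope[OF K[OF K1(1)]] by auto
  obtain K2 where K2: "K2 \<in> A" "e facet_of K2" "K1 \<inter> K2 = e" using pair[OF K1(1) e(1)] by blast
  have "z \<notin> rel_interior e"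
  proof
    assume "z \<in> rel_interior e"
    then have "z \<in> interior (K1 \<union> K2)"
      by (rule interior_Un_sharing_facet[OF K[OF K1(1)] K[OF K2(1)] e(1) K2(2,3)])
    moreover have "K1 \<union> K2 \<subseteq> W" using sub K1 K2 by auto
    ultimately show False using z(3) interior_mono by blast
  qed
  then obtain g where g: "g facet_of e" "z \<in> g"
    using facet_boundary(1)[OF K[OF K1(1)] e(1)] e(2) by blast
  then have gG: "g \<in> G" using K1 e by (auto simp: G_def)
  obtain u where u: "0 \<le> u" "u \<le> 1" "z = (1 - u) *\<^sub>R x0 + u *\<^sub>R y" using z(1) by (auto simp: in_segment)
  have "u \<noteq> 0" using u z(3) x0W by auto
  have "(1 / u) *\<^sub>R z = ((1 - u) / u) *\<^sub>R x0 + y" using \<open>u \<noteq> 0\<close> by (simp add: u(3) scaleR_add_right)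
  then have "(1 - 1 / u) *\<^sub>R x0 + (1 / u) *\<^sub>R z = ((1 - 1 / u) + (1 - u) / u) *\<^sub>R x0 + y"
    by (simp add: scaleR_add_left)
  also have "(1 - 1 / u) + (1 - u) / u = 0" using \<open>u \<noteq> 0\<close> by (simp add: diff_divide_distrib)
  finally have "y = (1 - 1 / u) *\<^sub>R x0 + (1 / u) *\<^sub>R z" by simp
  moreover have "x0 \<in> affine hull (insert x0 g)" "z \<in> affine hull (insert x0 g)"
    using g(2) by (auto intro: hull_inc)
  ultimately have "y \<in> affine hull (insert x0 g)"
    using mem_affine[of "affine hull (insert x0 g)" x0 z "1 - 1 / u" "1 / u"] by simp
  then show False using y(2)[OF gG] by blast
qed

lemma mesh_solid: "mesh \<Omega> T \<Longrightarrow> K \<in> T \<Longrightarrow> solid_polytope K"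
  by (simp add: mesh_def cell_solid_polytope)

text \<open>
  A facet that is not contained in the boundary of the domain has a relatively interior point in the domain. Points of the domain just outside the cell belong to
  another cell, and conformity forces the intersection of the two cells to be the whole facet.
\<close>

lemma mesh_interior_facet_shared:
  fixes \<Omega> :: "(real^'n) set"
  assumes m: "mesh \<Omega> T" and \<Omega>: "open \<Omega>" and KT: "K \<in> T" and e: "e facet_of K" and int: "\<not> e \<subseteq> frontier \<Omega>"
  shows "\<exists>z. z \<in> rel_interior e \<inter> \<Omega>" "\<exists>K'\<in>T. e facet_of K' \<and> K \<inter> K' = e"
proof -
  note K = mesh_solid[OF m KT]
  have eK: "e \<subseteq> K" by (rule facet_of_imp_subset[OF e])
  have "K \<subseteq> closure \<Omega>" using m KT by (auto simp: mesh_def)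
  then obtain x where "x \<in> e" "x \<in> \<Omega>" using int eK \<Omega> by (auto simp: frontier_def interior_open)
  moreover have "closure (rel_interior e) = closure e" by (rule convex_closure_rel_interior[OF facet_convex[OF K e]])
  ultimately have "x \<in> closure (rel_interior e)" using closure_subset by blast
  then have "\<Omega> \<inter> closure (rel_interior e) \<noteq> {}" using \<open>x \<in> \<Omega>\<close> by blast
  then have "\<Omega> \<inter> rel_interior e \<noteq> {}" using open_Int_closure_eq_empty[OF \<Omega>] by blast
  then obtain z where z: "z \<in> rel_interior e" "z \<in> \<Omega>" by blast
  then show "\<exists>z. z \<in> rel_interior e \<inter> \<Omega>" by blast
  have ze: "z \<in> e" using z rel_interior_subset by blast
  let ?n = "outer_normal K e" and ?b = "facet_level K e"
  have "\<exists>K'\<in>T - {K}. z \<in> K'"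
  proof (rule ccontr)
    assume no: "\<not> ?thesis"
    have "closed (\<Union>(T - {K}))"
      using m mesh_solid[OF m] solid_polytope_closed by (intro closed_Union) (auto simp: mesh_def)
    then have "open (\<Omega> - \<Union>(T - {K}))" using \<Omega> by (simp add: open_Diff)
    then obtain r where r: "0 < r" "ball z r \<subseteq> \<Omega> - \<Union>(T - {K})"
      using z no open_contains_ball_eq by (metis DiffI UnionE)
    define x where "x = z + (r / 2) *\<^sub>R ?n"
    have "x \<in> ball z r" using r facet_data(1)[OF K e] by (simp add: x_def dist_norm)
    then have "x \<in> \<Omega>" "x \<notin> \<Union>(T - {K})" using r by auto
    moreover have "\<Omega> \<subseteq> \<Union>T" using m closure_subset by (auto simp: mesh_def)
    ultimately have "x \<in> K" by blast
    then have "?n \<bullet> x \<le> ?b" using facet_data(2)[OF K e] by blast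
    moreover have "?n \<bullet> x = ?b + r / 2"
      using facet_inner[OF K e ze] facet_data(1)[OF K e] by (simp add: x_def inner_add_right dot_square_norm)
    ultimately show False using r by simp
  qed
  then obtain K' where K': "K' \<in> T" "K' \<noteq> K" "z \<in> K'" by blast
  note sK' = mesh_solid[OF m K'(1)]
  have F: "(K \<inter> K') face_of K" "(K \<inter> K') face_of K'" using m KT K' by (auto simp: mesh_def)
  have eF: "e \<subseteq> K \<inter> K'" using subset_of_face_of[OF F(1) eK] z ze K' eK by blast
  have "K \<inter> K' \<noteq> K"
  proof
    assume "K \<inter> K' = K"
    then have "K face_of K'" using F(2) by simp
    then show False
      using face_of_aff_dim_lt[OF solid_polytope_convex[OF sK'], of K] K'(2) solid_polytope_aff_dim[OF K] solid_polytope_aff_dim[OF sK'] by simp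
  qed
  then have lt: "aff_dim (K \<inter> K') < int CARD('n)"
    using face_of_aff_dim_lt[OF solid_polytope_convex[OF K] F(1)] solid_polytope_aff_dim[OF K] by simp
  have "e face_of (K \<inter> K')"
    by (rule face_of_subset[OF facet_of_imp_face_of[OF e] eF]) simp
  moreover have "convex (K \<inter> K')" using solid_polytope_convex[OF K] solid_polytope_convex[OF sK'] by (rule convex_Int)
  ultimately have eq: "e = K \<inter> K'"
    using face_of_aff_dim_lt[of "K \<inter> K'" e] lt facet_aff_dim[OF K e] by (cases "e = K \<inter> K'") auto
  moreover have "e facet_of K'"
    using F(2) eq facet_aff_dim[OF K e] solid_polytope_aff_dim[OF sK'] ze unfolding facet_of_def by auto
  ultimately show "\<exists>K'\<in>T. e facet_of K' \<and> K \<inter> K' = e" using K'(1) by blast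
qed

lemma mesh_facet_constants_zero:
  fixes \<Omega> :: "(real^'n) set"
  assumes m: "mesh \<Omega> T" and \<Omega>: "open \<Omega>"
    and eq: "\<And>K e. K \<in> T \<Longrightarrow> e facet_of K \<Longrightarrow> p K = \<mu> e"
    and bd: "\<And>e. e \<in> faces T \<Longrightarrow> e \<subseteq> frontier \<Omega> \<Longrightarrow> \<mu> e = (0::real)"
    and KT: "K \<in> T"
  shows "p K = 0"
proof (rule ccontr)
  assume pK: "p K \<noteq> 0"
  show False
  proof (rule no_closed_facet_pairing)
    show "finite {L \<in> T. p L = p K}" using m by (simp add: mesh_def)
    show "{L \<in> T. p L = p K} \<noteq> {}" using KT by blast
    show "solid_polytope L" if "L \<in> {L \<in> T. p L = p K}" for L using mesh_solid[OF m] that by simp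
    fix L e assume L: "L \<in> {L \<in> T. p L = p K}" and e: "e facet_of L"
    have \<mu>e: "\<mu> e = p K" using eq[of L e] L e by simp
    have "e \<in> faces T" using L e by (auto simp: faces_def)
    then have "\<not> e \<subseteq> frontier \<Omega>" using bd \<mu>e pK by metis
    from mesh_interior_facet_shared(2)[OF m \<Omega> _ e this] L
    obtain L' where L': "L' \<in> T" "e facet_of L'" "L \<inter> L' = e" by blast
    then show "\<exists>L'\<in>{L \<in> T. p L = p K}. e facet_of L' \<and> L \<inter> L' = e"
      using eq[of L' e] \<mu>e by auto
  qed
qed

lemma mesh_faces_disjoint:
  assumes m: "mesh \<Omega> T" and e: "e \<in> faces T" "e' \<in> faces T" "e \<noteq> e'"
  shows "rel_interior e \<inter> e' = {}"
proof (rule ccontr)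
  assume "\<not> ?thesis"
  then obtain z where z: "z \<in> rel_interior e" "z \<in> e'" by blast
  obtain K K' where K: "K \<in> T" "e facet_of K" and K': "K' \<in> T" "e' facet_of K'"
    using e by (auto simp: faces_def)
  note sK = mesh_solid[OF m K(1)] and sK' = mesh_solid[OF m K'(1)]
  have ze: "z \<in> e" using z rel_interior_subset by blast
  have "e face_of K'"
  proof (cases "K = K'")
    case True then show ?thesis using K facet_of_imp_face_of by blast
  next
    case False
    have F: "(K \<inter> K') face_of K" "(K \<inter> K') face_of K'" using m K K' False by (auto simp: mesh_def)
    have "e \<subseteq> K \<inter> K'"
      using subset_of_face_of[OF F(1) facet_of_imp_subset[OF K(2)]] z ze
        facet_of_imp_subset[OF K(2)] facet_of_imp_subset[OF K'(2)] by blast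
    then have "e face_of (K \<inter> K')"
      using face_of_subset[OF facet_of_imp_face_of[OF K(2)]] by blast
    then show ?thesis using F(2) face_of_trans by blast
  qed
  from face_eqI[OF this facet_of_imp_face_of[OF K'(2)] solid_polytope_convex[OF sK'] _ z]
  show False using facet_aff_dim[OF sK K(2)] facet_aff_dim[OF sK' K'(2)] e(3) by simp
qed

lemma AE_surf_rel_interior:
  fixes K :: "(real^'n) set"
  assumes K: "solid_polytope K" and e: "e facet_of K"
  shows "AE x in surf e. x \<in> rel_interior e"
proof -
  let ?n = "outer_normal K e" and ?b = "facet_level K e"
  note d = facet_data[OF K e]
  have nn: "?n \<bullet> ?n = 1" using d(1) by (simp add: dot_square_norm)
  have cl: "closed e" using facet_compact[OF K e] compact_imp_closed by blast
  have "AE x in surf e. x \<notin> g" if g: "g \<in> facets e" for g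
  proof (rule AE_not_in)
    have gc: "closed g" "g \<subseteq> e" using facet_boundary(4)[OF K e, of g] g by auto
    have gb: "g \<in> sets borel" using gc by simp
    have "g \<noteq> {}" using g by (auto simp: facet_of_def)
    then obtain x where x: "x \<in> g" by blast
    let ?A = "{y. 0 \<le> height ?n ?b ?n y \<and> height ?n ?b ?n y < 1 \<and> hit ?n ?b ?n y \<in> g}"
    have "?A \<subseteq> affine hull (insert (x + ?n) g)"
    proof
      fix y assume y: "y \<in> ?A"
      let ?h = "height ?n ?b ?n y" and ?z = "hit ?n ?b ?n y"
      have "y = 1 *\<^sub>R ?z + (- ?h) *\<^sub>R x + ?h *\<^sub>R (x + ?n)"
        by (simp add: hit_def scaleR_add_right)
      moreover have "1 *\<^sub>R ?z + (- ?h) *\<^sub>R x + ?h *\<^sub>R (x + ?n) \<in> affine hull (insert (x + ?n) g)"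
        using y x by (intro mem_affine_3 affine_affine_hull hull_inc) auto
      ultimately show "y \<in> affine hull (insert (x + ?n) g)" by simp
    qed
    moreover have "aff_dim (affine hull (insert (x + ?n) g)) < int CARD('n)"
    proof -
      have "aff_dim (insert (x + ?n) g) \<le> aff_dim g + 1" by (simp add: aff_dim_insert)
      then show ?thesis using facet_boundary(3)[OF K e, of g] g by simp
    qed
    ultimately have "negligible ?A" using negligible_low_aff_dim negligible_subset by blast
    moreover have "?A \<in> sets borel" using gb by measurable
    ultimately have "emeasure lborel ?A = 0" by (auto simp: negligible_iff_null_sets null_sets_def)
    then have "emeasure (surf e) g = 0" using emeasure_surf[OF d(1,4) cl gb gc(2)] by simp
    moreover have "g \<in> sets (surf e)"
      using gb gc cl by (auto simp: sets_surf sets_restrict_space_iff)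
    ultimately show "g \<in> null_sets (surf e)" by auto
  qed
  then have "AE x in surf e. \<forall>g\<in>facets e. x \<notin> g"
    by (intro AE_finite_allI facet_boundary(2)[OF K e])
  moreover have "AE x in surf e. x \<in> e" by (rule AE_I2) (simp add: space_surf)
  ultimately show ?thesis
    by eventually_elim (use facet_boundary(1)[OF K e] in blast)
qed

text \<open>
  Distinct faces of the mesh overlap in null sets of the surface measure only, so functions on the skeleton can be prescribed face by face.
\<close>

lemma AE_surf_other_face:
  assumes m: "mesh \<Omega> T" and e: "e \<in> faces T" "e' \<in> faces T" "e \<noteq> e'"
  shows "AE x in surf e. x \<notin> e'"
proof -
  obtain K where K: "K \<in> T" "e facet_of K" using e by (auto simp: faces_def)
  show ?thesis
    using AE_surf_rel_interior[OF mesh_solid[OF m K(1)] K(2)]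
    by eventually_elim (use mesh_faces_disjoint[OF m e] in blast)
qed

section \<open>Piecewise fields on a conforming mesh\<close>

text \<open>
  The combination with coefficients \<open>a\<close> of the local functions \<open>b K e\<close> of the cell \<open>K\<close>.
\<close>

definition cell_comb ::
    "((real^'n) set \<Rightarrow> (real^'n) set \<Rightarrow> real^'n \<Rightarrow> real^'n) \<Rightarrow> (real^'n) set \<Rightarrow>
     ((real^'n) set \<Rightarrow> real) \<Rightarrow> real^'n \<Rightarrow> real^'n" where
  "cell_comb b K a x = (\<Sum>e\<in>facets K. a e *\<^sub>R b K e x)"

lemma cell_comb_diff: "cell_comb b K (\<lambda>e. a e - a' e) x = cell_comb b K a x - cell_comb b K a' x"
  by (simp add: cell_comb_def scaleR_diff_left sum_subtractf)

lemma cell_comb_cong: "(\<And>e. e \<in> facets K \<Longrightarrow> a e = a' e) \<Longrightarrow> cell_comb b K a = cell_comb b K a'"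
  unfolding cell_comb_def[abs_def] by (intro ext sum.cong) auto

lemma RT0_L2:
  fixes U :: "(real^'n) set"
  assumes r: "r \<in> RT0 L" and U: "bounded U" "U \<in> sets lebesgue"
  shows "L2 (lebesgue_on U) r"
proof -
  have c: "continuous_on UNIV r" by (rule RT0_continuous[OF r])
  have "compact (r ` closure U)"
    using U(1) by (intro compact_continuous_image[OF continuous_on_subset[OF c]]) (simp_all add: compact_closure)
  then obtain B where B: "\<forall>x\<in>closure U. norm (r x) \<le> B"
    using compact_imp_bounded[of "r ` closure U"] by (auto simp: bounded_iff)
  show ?thesis
  proof (rule L2_bounded[OF finite_measure_lebesgue_on[OF U]])
    have "r \<in> borel_measurable lebesgue"
      using borel_measurable_continuous_onI[OF c] by (intro measurable_completion) simp
    then show "r \<in> borel_measurable (lebesgue_on U)" by (rule measurable_restrict_space1)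
    show "norm (r x) \<le> B" if "x \<in> space (lebesgue_on U)" for x
      using that B closure_subset[of U] by (auto simp: space_restrict_space)
  qed
qed

text \<open>
  A conforming mesh with the Raviart--Thomas basis on each cell.
\<close>

locale conforming_mesh =
  fixes \<Omega> :: "(real^'n) set" and T :: "(real^'n) set set"
    and rt :: "(real^'n) set \<Rightarrow> (real^'n) set \<Rightarrow> real^'n \<Rightarrow> real^'n"
  assumes bounded_domain: "bounded \<Omega>" and open_domain: "open \<Omega>"
    and mesh: "mesh \<Omega> T"
    and basis: "\<And>K. K \<in> T \<Longrightarrow> rt0_basis K (rt K)"
    and interior_cell_subset: "\<And>K. K \<in> T \<Longrightarrow> interior K \<subseteq> \<Omega>"
begin

lemma domain_sets: "\<Omega> \<in> sets lebesgue"
  using open_domain by simp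

lemma finite_mesh: "finite T"
  using mesh by (simp add: mesh_def)

lemma solid: "K \<in> T \<Longrightarrow> solid_polytope K"
  by (rule mesh_solid[OF mesh])

lemma finite_cell_facets: "K \<in> T \<Longrightarrow> finite (facets K)"
  by (rule finite_facets[OF solid])

lemma finite_faces: "finite (faces T)"
proof -
  have "faces T = (\<Union>K\<in>T. facets K)" by (auto simp: faces_def)
  then show ?thesis using finite_mesh finite_cell_facets by simp
qed

lemma faceI: "K \<in> T \<Longrightarrow> e facet_of K \<Longrightarrow> e \<in> faces T"
  by (auto simp: faces_def)

lemma bounded_cell: "K \<in> T \<Longrightarrow> bounded (interior K)"
  using bounded_subset[OF solid_polytope_bounded[OF solid] interior_subset] .

lemma interiors_disjoint:
  assumes "K \<in> T" "K' \<in> T" "x \<in> interior K" "x \<in> interior K'"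
  shows "K = K'"
proof (rule ccontr)
  assume "K \<noteq> K'"
  then have F: "(K \<inter> K') face_of K" "(K \<inter> K') face_of K'" using mesh assms by (auto simp: mesh_def)
  have x: "x \<in> K \<inter> K'" using assms interior_subset by blast
  have ri: "rel_interior L = interior L" if "L \<in> T" for L
    using solid[OF that] by (intro rel_interior_nonempty_interior) (simp add: solid_polytope_def)
  have "K \<subseteq> K \<inter> K'" by (rule subset_of_face_of[OF F(1)]) (use x assms ri in auto)
  moreover have "K' \<subseteq> K \<inter> K'" by (rule subset_of_face_of[OF F(2)]) (use x assms ri in auto)
  ultimately show False using \<open>K \<noteq> K'\<close> by blast
qed

lemma AE_domain_cells: "AE x in lebesgue. x \<in> \<Omega> \<longrightarrow> (\<exists>K\<in>T. x \<in> interior K)"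
proof -
  have "AE x in lebesgue. \<forall>K\<in>T. x \<notin> K - interior K"
    by (intro AE_finite_allI finite_mesh AE_not_in null_boundary_polytope solid)
  then show ?thesis
  proof eventually_elim
    case (elim x)
    have "\<Union>T = closure \<Omega>" using mesh unfolding mesh_def by blast
    then have "\<Omega> \<subseteq> \<Union>T" by (simp add: closure_subset)
    then show ?case using elim by blast
  qed
qed

lemma sum_indicator_cells:
  fixes h :: "(real^'n) set \<Rightarrow> 'b::real_vector"
  assumes "K \<in> T" "x \<in> interior K"
  shows "(\<Sum>L\<in>T. indicator (interior L) x *\<^sub>R h L) = h K"
proof -
  have "(\<Sum>L\<in>T. indicator (interior L) x *\<^sub>R h L) = (\<Sum>L\<in>T. if L = K then h K else 0)"
  proof (rule sum.cong[OF refl])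
    fix L assume L: "L \<in> T"
    show "indicator (interior L) x *\<^sub>R h L = (if L = K then h K else 0)"
    proof (cases "L = K")
      case False
      then have "x \<notin> interior L" using interiors_disjoint[OF L assms(1) _ assms(2)] by blast
      then show ?thesis using False by simp
    qed (use assms(2) in simp)
  qed
  then show ?thesis using finite_mesh assms by simp
qed

lemma AE_domain_sum_indicator:
  fixes h :: "real^'n \<Rightarrow> 'b::real_vector"
  shows "AE x in lebesgue. indicator \<Omega> x *\<^sub>R h x = (\<Sum>K\<in>T. indicator (interior K) x *\<^sub>R h x)"
  using AE_domain_cells
proof eventually_elim
  case (elim x)
  show ?case
  proof (cases "x \<in> \<Omega>")
    case True
    then obtain K where "K \<in> T" "x \<in> interior K" using elim by blast
    then show ?thesis using sum_indicator_cells[of K x "\<lambda>_. h x"] True by simp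
  next
    case False
    then have "\<forall>K\<in>T. x \<notin> interior K" using interior_cell_subset by blast
    then show ?thesis using False by simp
  qed
qed

lemma ae_eq_domainI:
  assumes "\<And>K. K \<in> T \<Longrightarrow> ae_eq (interior K) u v"
  shows "ae_eq \<Omega> u v"
proof -
  have "AE x in lebesgue. x \<in> interior K \<longrightarrow> u x = v x" if "K \<in> T" for K
    using assms[OF that] by (simp add: ae_eq_def AE_lebesgue_on_iff)
  then have "AE x in lebesgue. \<forall>K\<in>T. x \<in> interior K \<longrightarrow> u x = v x"
    by (intro AE_finite_allI finite_mesh)
  with AE_domain_cells have "AE x in lebesgue. x \<in> \<Omega> \<longrightarrow> u x = v x"
    by eventually_elim blast
  then show ?thesis by (simp add: ae_eq_def AE_lebesgue_on_iff domain_sets)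
qed

lemma ip_cells:
  fixes u v :: "real^'n \<Rightarrow> 'b::euclidean_space"
  assumes uv: "integrable (lebesgue_on \<Omega>) (\<lambda>x. u x \<bullet> v x)"
  shows "ip \<Omega> u v = (\<Sum>K\<in>T. ip (interior K) u v)"
proof -
  have i: "integrable lebesgue (\<lambda>x. indicator (interior K) x *\<^sub>R (u x \<bullet> v x))" if "K \<in> T" for K
  proof -
    have "integrable lebesgue (\<lambda>x. indicator (interior K) x *\<^sub>R (indicator \<Omega> x *\<^sub>R (u x \<bullet> v x)))"
      using uv unfolding integrable_lebesgue_on[OF domain_sets] by (intro integrable_mult_indicator[where f="\<lambda>x. indicator \<Omega> x *\<^sub>R (u x \<bullet> v x)"]) simp_all
    moreover have "(\<lambda>x. indicator (interior K) x *\<^sub>R (indicator \<Omega> x *\<^sub>R (u x \<bullet> v x))) =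
        (\<lambda>x. indicator (interior K) x *\<^sub>R (u x \<bullet> v x))"
      using interior_cell_subset[OF that] by (auto simp: fun_eq_iff indicator_def)
    ultimately show ?thesis by simp
  qed
  have "ip \<Omega> u v = (LINT x|lebesgue. indicator \<Omega> x *\<^sub>R (u x \<bullet> v x))"
    unfolding ip_def by (rule integral_lebesgue_on[OF domain_sets])
  also have "\<dots> = (LINT x|lebesgue. (\<Sum>K\<in>T. indicator (interior K) x *\<^sub>R (u x \<bullet> v x)))"
    by (rule integral_lebesgue_cong_AE(2)[OF AE_domain_sum_indicator])
  also have "\<dots> = (\<Sum>K\<in>T. LINT x|lebesgue. indicator (interior K) x *\<^sub>R (u x \<bullet> v x))"
    by (rule Bochner_Integration.integral_sum) (rule i)
  also have "\<dots> = (\<Sum>K\<in>T. ip (interior K) u v)"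
    unfolding ip_def by (simp add: integral_lebesgue_on)
  finally show ?thesis .
qed

lemma ip_cells_L2:
  fixes u v :: "real^'n \<Rightarrow> 'b::euclidean_space"
  shows "L2 (lebesgue_on \<Omega>) u \<Longrightarrow> L2 (lebesgue_on \<Omega>) v \<Longrightarrow> ip \<Omega> u v = (\<Sum>K\<in>T. ip (interior K) u v)"
  by (rule ip_cells[OF L2_inner_integrable])

lemma L2_cells:
  fixes h :: "(real^'n) set \<Rightarrow> real^'n \<Rightarrow> 'b::euclidean_space"
  assumes h: "\<And>K. K \<in> T \<Longrightarrow> L2 (lebesgue_on (interior K)) (h K)"
  shows "L2 (lebesgue_on \<Omega>) (\<lambda>x. \<Sum>K\<in>T. indicator (interior K) x *\<^sub>R h K x)"
proof -
  have "L2 (lebesgue_on \<Omega>) (\<lambda>x. indicator (interior K) x *\<^sub>R h K x)" if "K \<in> T" for K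
    unfolding L2_def
  proof
    have m: "h K \<in> borel_measurable (lebesgue_on (interior K))" using h[OF that] by (simp add: L2_def)
    have "(\<lambda>x. if x \<in> interior K then h K x else 0) \<in> borel_measurable lebesgue"
      using m by (subst borel_measurable_if) simp_all
    moreover have "(\<lambda>x. if x \<in> interior K then h K x else 0) = (\<lambda>x. indicator (interior K) x *\<^sub>R h K x)"
      by (auto simp: fun_eq_iff)
    ultimately have "(\<lambda>x. indicator (interior K) x *\<^sub>R h K x) \<in> borel_measurable lebesgue" by simp
    then show "(\<lambda>x. indicator (interior K) x *\<^sub>R h K x) \<in> borel_measurable (lebesgue_on \<Omega>)"
      by (rule measurable_restrict_space1)
    have "integrable (lebesgue_on (interior K)) (\<lambda>x. (norm (h K x))\<^sup>2)"
      using h[OF that] by (simp add: L2_def)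
    then have "integrable lebesgue (\<lambda>x. indicator (interior K) x *\<^sub>R (norm (h K x))\<^sup>2)"
      by (simp add: integrable_lebesgue_on)
    moreover have "(\<lambda>x. indicator (interior K) x *\<^sub>R (norm (h K x))\<^sup>2) =
        (\<lambda>x. indicator \<Omega> x *\<^sub>R (norm (indicator (interior K) x *\<^sub>R h K x))\<^sup>2)"
      using interior_cell_subset[OF that] by (auto simp: fun_eq_iff indicator_def)
    ultimately have "integrable lebesgue (\<lambda>x. indicator \<Omega> x *\<^sub>R (norm (indicator (interior K) x *\<^sub>R h K x))\<^sup>2)" by simp
    then show "integrable (lebesgue_on \<Omega>) (\<lambda>x. (norm (indicator (interior K) x *\<^sub>R h K x))\<^sup>2)"
      unfolding integrable_lebesgue_on[OF domain_sets] .
  qed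
  then have "L2 (lebesgue_on \<Omega>) (\<lambda>x. \<Sum>K\<in>T. 1 *\<^sub>R (indicator (interior K) x *\<^sub>R h K x))"
    by (intro L2_sum finite_mesh)
  then show ?thesis by simp
qed

text \<open>
  The field that is on each cell the combination with the coefficients \<open>a K\<close>, and 0 on the skeleton.
\<close>

definition glue ::
    "((real^'n) set \<Rightarrow> (real^'n) set \<Rightarrow> real^'n \<Rightarrow> real^'n) \<Rightarrow>
     ((real^'n) set \<Rightarrow> (real^'n) set \<Rightarrow> real) \<Rightarrow> real^'n \<Rightarrow> real^'n" where
  "glue b a x = (\<Sum>K\<in>T. indicator (interior K) x *\<^sub>R cell_comb b K (a K) x)"

lemma glue_ae_cell: "K \<in> T \<Longrightarrow> ae_eq (interior K) (glue b a) (cell_comb b K (a K))"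
  using sum_indicator_cells[of K _ "\<lambda>L. cell_comb b L (a L) _"]
  by (auto simp: ae_eq_def glue_def space_restrict_space intro!: AE_I2)

lemma glue_L2:
  "(\<And>K. K \<in> T \<Longrightarrow> L2 (lebesgue_on (interior K)) (cell_comb b K (a K))) \<Longrightarrow> L2 (lebesgue_on \<Omega>) (glue b a)"
  unfolding glue_def[abs_def] by (rule L2_cells)

subsection \<open>Fluxes through faces and normal continuity\<close>

text \<open>
  The coefficient \<open>a K e\<close> is the flux through the facet \<open>e\<close> out of \<open>K\<close>, so the sum over the cells with this facet is the jump of the flux; \<open>balanced\<close> says
  that the fluxes match at all interior faces.
\<close>

definition flux_jump :: "((real^'n) set \<Rightarrow> (real^'n) set \<Rightarrow> real) \<Rightarrow> (real^'n) set \<Rightarrow> real" where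
  "flux_jump a e = (\<Sum>K\<in>{K\<in>T. e facet_of K}. a K e)"

definition balanced :: "((real^'n) set \<Rightarrow> (real^'n) set \<Rightarrow> real) \<Rightarrow> bool" where
  "balanced a \<longleftrightarrow> (\<forall>e\<in>interior_faces \<Omega> T. flux_jump a e = 0)"

lemma sum_cells_facets: "(\<Sum>K\<in>T. \<Sum>e\<in>facets K. a K e * m e) = (\<Sum>e\<in>faces T. flux_jump a e * m e)"
proof -
  have "(\<Sum>K\<in>T. \<Sum>e\<in>facets K. a K e * m e) = (\<Sum>K\<in>T. \<Sum>e\<in>{e\<in>faces T. e facet_of K}. a K e * m e)"
    by (intro sum.cong refl) (auto simp: faces_def)
  also have "\<dots> = (\<Sum>e\<in>faces T. \<Sum>K\<in>{K\<in>T. e facet_of K}. a K e * m e)"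
    by (rule sum.swap_restrict[OF finite_mesh finite_faces])
  finally show ?thesis by (simp add: flux_jump_def sum_distrib_right)
qed

lemma face_facet: "e \<in> faces T \<Longrightarrow> \<exists>K\<in>T. e facet_of K"
  by (auto simp: faces_def)

lemma face_closed:
  assumes "e \<in> faces T"
  shows "closed e"
proof -
  obtain K where "K \<in> T" "e facet_of K" using assms by (auto simp: faces_def)
  then show ?thesis by (intro compact_imp_closed facet_compact[OF solid])
qed

lemma facet_mean_boundary_face:
  assumes \<phi>: "\<phi> \<in> test_fun \<Omega>" and e: "e \<subseteq> frontier \<Omega>"
  shows "facet_mean e \<phi> = 0"
proof -
  have "(LINT x|surf e. \<phi> x) = (LINT x|surf e. 0)"
    using test_fun_outside[OF \<phi>] e open_domain
    by (intro Bochner_Integration.integral_cong) (auto simp: space_surf frontier_def interior_open)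
  then show ?thesis by (simp add: facet_mean_def)
qed

lemma rt_L2: "K \<in> T \<Longrightarrow> e \<in> facets K \<Longrightarrow> L2 (lebesgue_on (interior K)) (rt K e)"
  using basis[of K] by (intro RT0_L2[of "rt K e" K] bounded_cell) (auto simp: rt0_basis_def)

lemma rt_comb_L2: "K \<in> T \<Longrightarrow> L2 (lebesgue_on (interior K)) (cell_comb rt K a)"
  unfolding cell_comb_def[abs_def] by (intro L2_sum finite_cell_facets rt_L2)

text \<open>
  The divergence on \<open>K\<close> of the field with fluxes \<open>a\<close>.
\<close>

definition cell_div :: "(real^'n) set \<Rightarrow> ((real^'n) set \<Rightarrow> real) \<Rightarrow> real" where
  "cell_div K a = (\<Sum>e\<in>facets K. a e) / measure lebesgue K"

lemma rt_comb_green: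
  assumes K: "K \<in> T" and \<phi>: "\<phi> \<in> test_fun U"
  shows "ip (interior K) (cell_comb rt K a) (grad \<phi>) + ip (interior K) (\<lambda>x. cell_div K a) \<phi> =
    (\<Sum>e\<in>facets K. a e * facet_mean e \<phi>)"
proof -
  have m: "interior K \<in> sets lebesgue" by simp
  have "ip (interior K) (cell_comb rt K a) (grad \<phi>) = (\<Sum>e\<in>facets K. a e * ip (interior K) (rt K e) (grad \<phi>))"
    unfolding cell_comb_def[abs_def]
    by (intro ip_sum_left finite_cell_facets[OF K] rt_L2[OF K] grad_L2[OF bounded_cell[OF K] m \<phi>])
  moreover have "ip (interior K) (\<lambda>x. cell_div K a) \<phi> =
      (\<Sum>e\<in>facets K. a e * ip (interior K) (\<lambda>x. 1 / measure lebesgue K) \<phi>)"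
  proof -
    have "(\<lambda>x::real^'n. cell_div K a) = (\<lambda>x. \<Sum>e\<in>facets K. a e *\<^sub>R (1 / measure lebesgue K))"
      by (simp add: cell_div_def sum_divide_distrib)
    then show ?thesis
      by (simp only:) (intro ip_sum_left finite_cell_facets[OF K] L2_const[OF bounded_cell[OF K] m]
          test_fun_L2[OF bounded_cell[OF K] m \<phi>])
  qed
  moreover have "ip (interior K) (rt K e) (grad \<phi>) + ip (interior K) (\<lambda>x. 1 / measure lebesgue K) \<phi> = facet_mean e \<phi>"
    if "e \<in> facets K" for e
    using that by (intro rt0_basis_green[OF solid[OF K] basis[OF K] _ test_fun_Ck[OF \<phi>]]) simp
  ultimately show ?thesis
    by (simp add: sum.distrib[symmetric] distrib_left[symmetric])
qed

lemma weak_div_rt_comb: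
  assumes K: "K \<in> T"
  shows "weak_div (interior K) (cell_comb rt K a) (\<lambda>x. cell_div K a)"
  unfolding weak_div_def
proof
  fix \<phi> assume \<phi>: "\<phi> \<in> test_fun (interior K)"
  have "facet_mean e \<phi> = 0" if e: "e \<in> facets K" for e
  proof -
    have "e \<inter> interior K = {}" using frontier_solid_polytope[OF solid[OF K]] e by blast
    then have "(LINT x|surf e. \<phi> x) = (LINT x|surf e. 0)"
      using test_fun_outside[OF \<phi>] by (intro Bochner_Integration.integral_cong) (auto simp: space_surf)
    then show ?thesis by (simp add: facet_mean_def)
  qed
  then show "ip (interior K) (cell_comb rt K a) (grad \<phi>) = - ip (interior K) (\<lambda>x. cell_div K a) \<phi>"
    using rt_comb_green[OF K \<phi>, of a] by simp
qed

abbreviation rt_field :: "((real^'n) set \<Rightarrow> (real^'n) set \<Rightarrow> real) \<Rightarrow> real^'n \<Rightarrow> real^'n" where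
  "rt_field \<equiv> glue rt"

lemma rt_field_L2: "L2 (lebesgue_on \<Omega>) (rt_field a)"
  by (rule glue_L2[OF rt_comb_L2])

text \<open>
  The piecewise constant function of the cell divergences.
\<close>

definition div_field :: "((real^'n) set \<Rightarrow> (real^'n) set \<Rightarrow> real) \<Rightarrow> real^'n \<Rightarrow> real" where
  "div_field a x = (\<Sum>K\<in>T. indicator (interior K) x *\<^sub>R cell_div K (a K))"

lemma div_field_ae_cell: "K \<in> T \<Longrightarrow> ae_eq (interior K) (div_field a) (\<lambda>x. cell_div K (a K))"
  using sum_indicator_cells[of K _ "\<lambda>L. cell_div L (a L)"]
  by (auto simp: ae_eq_def div_field_def space_restrict_space intro!: AE_I2)

lemma div_field_L2: "L2 (lebesgue_on \<Omega>) (div_field a)"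
  unfolding div_field_def[abs_def] by (intro L2_cells L2_const bounded_cell) simp_all

lemma rt_field_green:
  assumes \<phi>: "\<phi> \<in> test_fun \<Omega>"
  shows "ip \<Omega> (rt_field a) (grad \<phi>) + ip \<Omega> (div_field a) \<phi> =
    (\<Sum>e\<in>interior_faces \<Omega> T. flux_jump a e * facet_mean e \<phi>)"
proof -
  have "ip \<Omega> (rt_field a) (grad \<phi>) + ip \<Omega> (div_field a) \<phi> =
      (\<Sum>K\<in>T. ip (interior K) (rt_field a) (grad \<phi>)) + (\<Sum>K\<in>T. ip (interior K) (div_field a) \<phi>)"
    using ip_cells_L2[OF rt_field_L2 grad_L2[OF bounded_domain domain_sets \<phi>]]
      ip_cells_L2[OF div_field_L2 test_fun_L2[OF bounded_domain domain_sets \<phi>]] by simp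
  also have "\<dots> = (\<Sum>K\<in>T. ip (interior K) (cell_comb rt K (a K)) (grad \<phi>) + ip (interior K) (\<lambda>x. cell_div K (a K)) \<phi>)"
    unfolding sum.distrib[symmetric]
    by (intro sum.cong refl arg_cong2[where f="(+)"] ip_cong_AE ae_eq_refl glue_ae_cell div_field_ae_cell) simp_all
  also have "\<dots> = (\<Sum>K\<in>T. \<Sum>e\<in>facets K. a K e * facet_mean e \<phi>)"
    by (intro sum.cong refl rt_comb_green[OF _ \<phi>])
  also have "\<dots> = (\<Sum>e\<in>faces T. flux_jump a e * facet_mean e \<phi>)" by (rule sum_cells_facets)
  also have "\<dots> = (\<Sum>e\<in>interior_faces \<Omega> T. flux_jump a e * facet_mean e \<phi>)"
    by (rule sum.mono_neutral_right[OF finite_faces])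
      (auto simp: interior_faces_def facet_mean_boundary_face[OF \<phi>])
  finally show ?thesis .
qed

text \<open>
  A bump around a point of the face that lies on no other face separates the flux jumps.
\<close>

lemma interior_face_bump:
  assumes e: "e \<in> interior_faces \<Omega> T"
  obtains \<phi> where "\<phi> \<in> test_fun \<Omega>" "facet_mean e \<phi> \<noteq> 0"
    "\<And>e'. e' \<in> faces T \<Longrightarrow> e' \<noteq> e \<Longrightarrow> facet_mean e' \<phi> = 0"
proof -
  have ef: "e \<in> faces T" and nb: "\<not> e \<subseteq> frontier \<Omega>" using e by (auto simp: interior_faces_def)
  obtain K where K: "K \<in> T" "e facet_of K" using ef by (auto simp: faces_def)
  note sK = solid[OF K(1)]
  obtain z where z: "z \<in> rel_interior e" "z \<in> \<Omega>"
    using mesh_interior_facet_shared(1)[OF mesh open_domain K nb] by blast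
  note cl = face_closed
  define O' where "O' = \<Omega> - \<Union>(faces T - {e})"
  have "open O'"
    unfolding O'_def using open_domain finite_faces cl by (intro open_Diff closed_Union) auto
  moreover have "z \<in> O'"
    using z mesh_faces_disjoint[OF mesh ef] by (auto simp: O'_def)
  ultimately obtain c d where cd: "z \<in> box c d" "cbox c d \<subseteq> O'"
    by (metis open_contains_cbox)
  define \<phi> where "\<phi> = box_bump c d 0"
  have \<phi>: "\<phi> \<in> test_fun \<Omega>"
    unfolding \<phi>_def by (rule box_bump_test_fun) (use cd in \<open>auto simp: O'_def\<close>)
  have "facet_mean e' \<phi> = 0" if "e' \<in> faces T" "e' \<noteq> e" for e'
  proof -
    have "\<phi> x = 0" if "x \<in> e'" for x
      unfolding \<phi>_def using that \<open>e' \<in> faces T\<close> \<open>e' \<noteq> e\<close> cd(2) box_subset_cbox[of c d]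
      by (intro box_bump_zero) (auto simp: O'_def)
    then have "(LINT x|surf e'. \<phi> x) = (LINT x|surf e'. 0)"
      by (intro Bochner_Integration.integral_cong) (auto simp: space_surf)
    then show ?thesis by (simp add: facet_mean_def)
  qed
  moreover have "facet_mean e \<phi> \<noteq> 0"
  proof
    assume "facet_mean e \<phi> = 0"
    obtain r where r: "0 < r" "ball z r \<inter> affine hull e \<subseteq> e" using z(1) by (auto simp: mem_rel_interior_ball)
    obtain r' where r': "0 < r'" "ball z r' \<subseteq> box c d" using cd(1) open_contains_ball[of "box c d"] by auto
    have ze: "z \<in> affine hull e" using z(1) rel_interior_subset[of e] by (intro hull_inc) blast
    have B: "e \<inter> box c d \<in> sets borel" using cl[OF ef] by simp
    have "0 < emeasure (surf e) (e \<inter> box c d)"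
      by (rule emeasure_surf_pos[OF sK K(2) B _ ze, of "min r r'"]) (use r r' in auto)
    moreover have "0 < emeasure (surf e) e"
      by (rule emeasure_surf_pos[OF sK K(2) _ _ ze r]) (use cl[OF ef] in auto)
    then have "measure (surf e) e \<noteq> 0"
      using finite_surf[OF sK K(2)] by (auto simp: measure_def enn2real_eq_0_iff)
    then have "(LINT x|surf e. \<phi> x) = 0" using \<open>facet_mean e \<phi> = 0\<close> by (simp add: facet_mean_def)
    moreover have "integrable (surf e) \<phi>"
      by (rule integrable_surf_continuous[OF sK K(2) test_fun_continuous[OF \<phi>]])
    ultimately have "AE x in surf e. \<phi> x = 0"
      by (subst (asm) integral_nonneg_eq_0_iff_AE) (auto simp: \<phi>_def box_bump_nonneg)
    then have "AE x in surf e. x \<notin> e \<inter> box c d"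
    proof eventually_elim
      case (elim x)
      then show ?case using box_bump_pos[of x c d 0] by (auto simp: \<phi>_def)
    qed
    moreover have "e \<inter> box c d \<in> sets (surf e)"
      using B cl[OF ef] by (simp add: sets_surf sets_restrict_space_iff)
    ultimately have "e \<inter> box c d \<in> null_sets (surf e)"
      by (subst AE_iff_null_sets)
    then have "emeasure (surf e) (e \<inter> box c d) = 0" by auto
    then show False using \<open>0 < emeasure (surf e) (e \<inter> box c d)\<close> by simp
  qed
  ultimately show thesis using \<phi> that by blast
qed

text \<open>
  Normal continuity is membership in \<open>H(div)\<close>. If the field has a weak divergence, it coincides with the piecewise divergence by uniqueness on each cell,
  and Green's formula leaves the flux jumps tested with arbitrary face means.
\<close>

lemma rt_field_Hdiv_iff: "rt_field a \<in> Hdiv \<Omega> \<longleftrightarrow> balanced a"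
proof
  assume "balanced a"
  have "weak_div \<Omega> (rt_field a) (div_field a)"
    unfolding weak_div_def
  proof
    fix \<phi> assume "\<phi> \<in> test_fun \<Omega>"
    from rt_field_green[OF this, of a] \<open>balanced a\<close>
    show "ip \<Omega> (rt_field a) (grad \<phi>) = - ip \<Omega> (div_field a) \<phi>" by (simp add: balanced_def)
  qed
  then show "rt_field a \<in> Hdiv \<Omega>" unfolding Hdiv_def using rt_field_L2 div_field_L2 by blast
next
  assume "rt_field a \<in> Hdiv \<Omega>"
  then obtain g where g: "L2 (lebesgue_on \<Omega>) g" "weak_div \<Omega> (rt_field a) g" by (auto simp: Hdiv_def)
  have "ae_eq \<Omega> g (div_field a)"
  proof (rule ae_eq_domainI)
    fix K assume K: "K \<in> T"
    have m: "interior K \<in> sets lebesgue" by simp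
    have "weak_div (interior K) (rt_field a) g"
      by (rule weak_div_subset[OF g(2) interior_cell_subset[OF K] m domain_sets])
    then have "weak_div (interior K) (cell_comb rt K (a K)) g"
      by (rule weak_div_cong_AE[OF m glue_ae_cell[OF K] ae_eq_refl])
    then have "ae_eq (interior K) g (\<lambda>x. cell_div K (a K))"
      using L2_subset[OF g(1) interior_cell_subset[OF K] m domain_sets] weak_div_rt_comb[OF K]
      by (intro weak_div_unique[OF bounded_cell[OF K]] L2_const[OF bounded_cell[OF K] m]) auto
    then show "ae_eq (interior K) g (div_field a)"
      using ae_eq_sym[OF div_field_ae_cell[OF K]] ae_eq_trans by blast
  qed
  then have wd: "weak_div \<Omega> (rt_field a) (div_field a)"
    using weak_div_cong_AE[OF domain_sets ae_eq_refl _ g(2)] by blast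
  show "balanced a"
    unfolding balanced_def
  proof
    fix e assume e: "e \<in> interior_faces \<Omega> T"
    obtain \<phi> where \<phi>: "\<phi> \<in> test_fun \<Omega>" "facet_mean e \<phi> \<noteq> 0"
      "\<And>e'. e' \<in> faces T \<Longrightarrow> e' \<noteq> e \<Longrightarrow> facet_mean e' \<phi> = 0" using interior_face_bump[OF e] by blast
    have "0 = (\<Sum>e'\<in>interior_faces \<Omega> T. flux_jump a e' * facet_mean e' \<phi>)"
      using rt_field_green[OF \<phi>(1), of a] wd \<phi>(1) by (simp add: weak_div_def)
    also have "\<dots> = (\<Sum>e'\<in>interior_faces \<Omega> T. if e' = e then flux_jump a e * facet_mean e \<phi> else 0)"
      by (intro sum.cong refl) (use \<phi>(3) in \<open>auto simp: interior_faces_def\<close>)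
    also have "\<dots> = flux_jump a e * facet_mean e \<phi>"
      using e finite_faces by (simp add: interior_faces_def)
    finally show "flux_jump a e = 0" using \<phi>(2) by simp
  qed
qed

lemma rt_field_Vh_iff:
  assumes cells: "\<And>K. K \<in> T \<Longrightarrow> cell K"
  shows "rt_field a \<in> Vh \<Omega> T \<longleftrightarrow> balanced a"
proof -
  have "\<exists>r\<in>RT0 K. ae_eq K (rt_field a) r" if K: "K \<in> T" for K
  proof
    show "cell_comb rt K (a K) \<in> RT0 K"
      unfolding cell_comb_def[abs_def] by (rule RT0_combination[OF cells[OF K] basis[OF K]])
    show "ae_eq K (rt_field a) (cell_comb rt K (a K))"
      using glue_ae_cell[OF K] by (simp add: ae_eq_interior_iff[OF solid[OF K]])
  qed
  then show ?thesis unfolding Vh_def using rt_field_Hdiv_iff by blast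
qed

subsection \<open>Multipliers\<close>

text \<open>
  The multiplier \<open>\<pi>\<close> has the constant value \<open>m e\<close> on each face \<open>e\<close>, and the value 0 on boundary faces.
\<close>

definition face_values :: "(real^'n \<Rightarrow> real) \<Rightarrow> ((real^'n) set \<Rightarrow> real) \<Rightarrow> bool" where
  "face_values \<pi> m \<longleftrightarrow> (\<forall>e\<in>faces T. AE x in surf e. \<pi> x = m e) \<and> (\<forall>e\<in>faces T. e \<subseteq> frontier \<Omega> \<longrightarrow> m e = 0)"

lemma Pi_h_face_values:
  assumes "\<pi> \<in> Pi_h \<Omega> T"
  shows "\<exists>m. face_values \<pi> m"
proof -
  have "\<exists>c. (AE x in surf e. \<pi> x = c) \<and> (e \<subseteq> frontier \<Omega> \<longrightarrow> c = 0)" if "e \<in> faces T" for e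
  proof (cases "e \<subseteq> frontier \<Omega>")
    case True
    then show ?thesis using assms that unfolding Pi_h_def by blast
  next
    case False
    then have "e \<in> interior_faces \<Omega> T" using that by (simp add: interior_faces_def)
    then show ?thesis using assms False unfolding Pi_h_def by blast
  qed
  then obtain m where "\<forall>e\<in>faces T. (AE x in surf e. \<pi> x = m e) \<and> (e \<subseteq> frontier \<Omega> \<longrightarrow> m e = 0)"
    by metis
  then show ?thesis unfolding face_values_def by blast
qed

lemma face_surf:
  assumes e: "e \<in> faces T"
  shows "finite_measure (surf e)" "measure (surf e) e \<noteq> 0"
proof -
  obtain K where K: "K \<in> T" "e facet_of K" using e face_facet by blast
  note sK = solid[OF K(1)]
  show "finite_measure (surf e)" by (rule finite_measure_surf[OF sK K(2)])
  have "e \<noteq> {}" using K(2) by (auto simp: facet_of_def)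
  then obtain z where z: "z \<in> rel_interior e"
    using rel_interior_eq_empty[OF facet_convex[OF sK K(2)]] by blast
  obtain r where r: "0 < r" "ball z r \<inter> affine hull e \<subseteq> e" using z by (auto simp: mem_rel_interior_ball)
  have "z \<in> affine hull e" using z rel_interior_subset[of e] by (intro hull_inc) blast
  moreover have "closed e" by (rule face_closed[OF e])
  ultimately have "0 < emeasure (surf e) e"
    by (intro emeasure_surf_pos[OF sK K(2) _ _ _ r]) auto
  then show "measure (surf e) e \<noteq> 0"
    using finite_surf[OF sK K(2)] by (auto simp: measure_def enn2real_eq_0_iff)
qed

text \<open>
  A function on the skeleton with prescribed values on the interior faces; the values are attained off the intersections of faces.
\<close>

definition face_fun :: "((real^'n) set \<Rightarrow> real) \<Rightarrow> real^'n \<Rightarrow> real" where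
  "face_fun m x = (\<Sum>e\<in>interior_faces \<Omega> T. m e * indicator e x)"

lemma face_fun_values:
  assumes m0: "\<And>e. e \<in> faces T \<Longrightarrow> e \<subseteq> frontier \<Omega> \<Longrightarrow> m e = 0"
  shows "face_values (face_fun m) m"
proof -
  have "AE x in surf e. face_fun m x = m e" if e: "e \<in> faces T" for e
  proof -
    have "AE x in surf e. \<forall>e'\<in>faces T - {e}. x \<notin> e'"
      by (intro AE_finite_allI) (use finite_faces AE_surf_other_face[OF mesh e] in auto)
    moreover have "AE x in surf e. x \<in> e" by (rule AE_I2) (simp add: space_surf)
    ultimately show ?thesis
    proof eventually_elim
      case (elim x)
      have fin: "finite (interior_faces \<Omega> T)" using finite_faces by (simp add: interior_faces_def)
      have "face_fun m x = (\<Sum>e'\<in>interior_faces \<Omega> T. if e' = e then m e else 0)"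
        unfolding face_fun_def
        by (intro sum.cong refl) (use elim in \<open>auto simp: interior_faces_def indicator_def\<close>)
      then show ?case using fin m0[OF e] e by (auto simp: interior_faces_def)
    qed
  qed
  then show ?thesis using m0 by (simp add: face_values_def)
qed

lemma face_fun_Pi_h:
  assumes m0: "\<And>e. e \<in> faces T \<Longrightarrow> e \<subseteq> frontier \<Omega> \<Longrightarrow> m e = 0"
  shows "face_fun m \<in> Pi_h \<Omega> T"
proof -
  have v: "face_values (face_fun m) m" by (rule face_fun_values[OF m0])
  have "L2 (surf e) (face_fun m)" if e: "e \<in> interior_faces \<Omega> T" for e
  proof (rule L2_bounded)
    have ef: "e \<in> faces T" using e by (simp add: interior_faces_def)
    show "finite_measure (surf e)" by (rule face_surf(1)[OF ef])
    have "e' \<in> sets borel" if "e' \<in> faces T" for e'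
      using face_closed[OF that] by simp
    then have "face_fun m \<in> borel_measurable borel"
      unfolding face_fun_def[abs_def] by (intro borel_measurable_sum borel_measurable_times)
        (auto simp: interior_faces_def)
    then show "face_fun m \<in> borel_measurable (surf e)"
      unfolding measurable_cong_sets[OF sets_surf refl] by (rule measurable_restrict_space1)
    show "norm (face_fun m x) \<le> (\<Sum>e\<in>interior_faces \<Omega> T. \<bar>m e\<bar>)" for x
      unfolding face_fun_def real_norm_def
      by (rule order_trans[OF sum_abs]) (intro sum_mono, simp add: indicator_def)
  qed
  moreover have ae: "AE x in surf e. face_fun m x = m e" if "e \<in> faces T" for e
    using v that by (simp add: face_values_def)
  moreover have "AE x in surf e. face_fun m x = 0" if "e \<in> faces T" "e \<subseteq> frontier \<Omega>" for e
    using ae[OF that(1)] m0[OF that] by simp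
  moreover have "e \<in> faces T" if "e \<in> interior_faces \<Omega> T" for e
    using that by (simp add: interior_faces_def)
  ultimately show ?thesis unfolding Pi_h_def by blast
qed

end

section \<open>The oversampling discretisation\<close>

text \<open>
  The data of the oversampling method: a uniformly positive coefficient, for each cell a block with local solutions, and the coefficients \<open>c\<close> that express the Raviart--Thomas basis of the
  cell by that of the block.
\<close>

locale oversampling = conforming_mesh \<Omega> T rt
  for \<Omega> :: "(real^'n) set" and T and rt +
  fixes k :: "real^'n \<Rightarrow> real^'n^'n" and kmin :: real
    and S :: "(real^'n) set \<Rightarrow> (real^'n) set"
    and \<eta> \<psi> :: "(real^'n) set \<Rightarrow> (real^'n) set \<Rightarrow> real^'n \<Rightarrow> real^'n"
    and \<phi> :: "(real^'n) set \<Rightarrow> (real^'n) set \<Rightarrow> real^'n \<Rightarrow> real"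
    and c :: "(real^'n) set \<Rightarrow> (real^'n) set \<Rightarrow> (real^'n) set \<Rightarrow> real"
    and \<eta>b \<psi>b :: "(real^'n) set \<Rightarrow> (real^'n) set \<Rightarrow> real^'n \<Rightarrow> real^'n"
  assumes cells: "\<And>K. K \<in> T \<Longrightarrow> cell K"
    and kmin_pos: "0 < kmin"
    and k_lower: "\<And>x \<zeta>. x \<in> \<Omega> \<Longrightarrow> kmin * (norm \<zeta>)\<^sup>2 \<le> \<zeta> \<bullet> (k x *v \<zeta>)"
    and block: "\<And>K. K \<in> T \<Longrightarrow> cell (S K) \<and> K \<subseteq> S K"
    and basis_S: "\<And>K. K \<in> T \<Longrightarrow> rt0_basis (S K) (rt (S K))"
    and local_solutions: "\<And>K l. K \<in> T \<Longrightarrow> l facet_of S K \<Longrightarrow>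
                  local_problem k (S K) (rt (S K) l) (\<eta> (S K) l) (\<psi> (S K) l) (\<phi> (S K) l)"
    and rt_os: "\<And>K e x. K \<in> T \<Longrightarrow> e facet_of K \<Longrightarrow> x \<in> K \<Longrightarrow> rt K e x = os_bar S c rt K e x"
    and \<eta>b: "\<eta>b = os_bar S c \<eta>"
    and \<psi>b: "\<psi>b = os_bar S c \<psi>"
    and independent: "cellwise_independent T \<psi>b"
begin

subsection \<open>The multiscale basis on a cell\<close>

lemma interior_sets: "interior L \<in> sets lebesgue"
  by simp

context
  fixes K assumes K: "K \<in> T"
begin

lemma block_solid: "solid_polytope (S K)"
  using block[OF K] cell_solid_polytope by blast

lemma block_bounded: "bounded (interior (S K))"
  using bounded_subset[OF solid_polytope_bounded[OF block_solid] interior_subset] .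

lemma cell_subset_block: "interior K \<subseteq> interior (S K)"
  using block[OF K] by (simp add: interior_mono)

lemma finite_block_facets: "finite (facets (S K))"
  by (rule finite_facets[OF block_solid])

text \<open>
  The local problem prescribes the divergence of \<open>\<psi>\<close> only through chosen representatives of weak divergences; both are determined almost everywhere.
\<close>

lemma weak_div_psi_block:
  assumes l: "l \<in> facets (S K)"
  shows "L2 (lebesgue_on (interior (S K))) (\<psi> (S K) l)"
    "weak_div (interior (S K)) (\<psi> (S K) l) (\<lambda>x. 1 / measure lebesgue (S K))"
proof -
  let ?U = "interior (S K)"
  have lp: "local_problem k (S K) (rt (S K) l) (\<eta> (S K) l) (\<psi> (S K) l) (\<phi> (S K) l)"
    using local_solutions[OF K] l by simp
  then have H: "\<psi> (S K) l \<in> Hdiv ?U" and ae: "ae_eq ?U (wdiv ?U (\<psi> (S K) l)) (wdiv ?U (rt (S K) l))"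
    by (simp_all add: local_problem_def)
  show "L2 (lebesgue_on ?U) (\<psi> (S K) l)" using H by (simp add: Hdiv_def)
  have rtd: "weak_div ?U (rt (S K) l) (\<lambda>x. 1 / measure lebesgue (S K))"
    using basis_S[OF K] l by (simp add: rt0_basis_def)
  have "ae_eq ?U (wdiv ?U (rt (S K) l)) (\<lambda>x. 1 / measure lebesgue (S K))"
    by (rule wdiv_ae_eq[OF block_bounded open_interior rtd L2_const[OF block_bounded interior_sets]])
  with ae have ae': "ae_eq ?U (wdiv ?U (\<psi> (S K) l)) (\<lambda>x. 1 / measure lebesgue (S K))"
    by (rule ae_eq_trans)
  obtain g where g: "L2 (lebesgue_on ?U) g" "weak_div ?U (\<psi> (S K) l) g" using H by (auto simp: Hdiv_def)
  show "weak_div ?U (\<psi> (S K) l) (\<lambda>x. 1 / measure lebesgue (S K))"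
    by (rule weak_div_cong_AE[OF interior_sets ae_eq_refl ae' wdiv_weak_div(1)[OF g(2,1)]])
qed

lemma eta_block_L2: "l \<in> facets (S K) \<Longrightarrow> L2 (lebesgue_on (interior (S K))) (\<eta> (S K) l)"
  using local_solutions[OF K, of l] by (simp add: local_problem_def)

lemma block_to_cell_L2:
  fixes u :: "real^'n \<Rightarrow> real^'n"
  shows "L2 (lebesgue_on (interior (S K))) u \<Longrightarrow> L2 (lebesgue_on (interior K)) u"
  by (rule L2_subset[OF _ cell_subset_block interior_sets interior_sets])

lemma psib_L2: "L2 (lebesgue_on (interior K)) (\<psi>b K e)"
  unfolding \<psi>b os_bar_def[abs_def]
  by (intro L2_sum finite_block_facets block_to_cell_L2 weak_div_psi_block(1))

lemma etab_L2: "L2 (lebesgue_on (interior K)) (\<eta>b K e)"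
  unfolding \<eta>b os_bar_def[abs_def]
  by (intro L2_sum finite_block_facets block_to_cell_L2 eta_block_L2)

lemma weak_div_os_bar:
  fixes F :: "(real^'n) set \<Rightarrow> (real^'n) set \<Rightarrow> real^'n \<Rightarrow> real^'n"
  assumes F: "\<And>l. l \<in> facets (S K) \<Longrightarrow> L2 (lebesgue_on (interior (S K))) (F (S K) l)"
    and d: "\<And>l. l \<in> facets (S K) \<Longrightarrow>
      weak_div (interior (S K)) (F (S K) l) (\<lambda>x. 1 / measure lebesgue (S K))"
  shows "weak_div (interior K) (os_bar S c F K e) (\<lambda>x. \<Sum>l\<in>facets (S K). c K e l * (1 / measure lebesgue (S K)))"
proof -
  have "weak_div (interior (S K)) (os_bar S c F K e) (\<lambda>x. \<Sum>l\<in>facets (S K). c K e l * (1 / measure lebesgue (S K)))"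
    unfolding os_bar_def[abs_def]
    by (intro weak_div_sum[OF block_bounded interior_sets finite_block_facets] F d
        L2_const[OF block_bounded interior_sets])
  then show ?thesis
    by (rule weak_div_subset[OF _ cell_subset_block interior_sets interior_sets])
qed

text \<open>
  The combination of the constants \<open>1 / |S|\<close> with the coefficients \<open>c K e l\<close> is \<open>1 / |K|\<close>, since the same combination of Raviart--Thomas fields is \<open>rt K e\<close>.
\<close>

lemma weak_div_psib:
  assumes e: "e \<in> facets K"
  shows "weak_div (interior K) (\<psi>b K e) (\<lambda>x. 1 / measure lebesgue K)"
proof -
  let ?d = "\<Sum>l\<in>facets (S K). c K e l * (1 / measure lebesgue (S K))"
  have "weak_div (interior K) (os_bar S c rt K e) (\<lambda>x. ?d)"
  proof (rule weak_div_os_bar)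
    fix l assume l: "l \<in> facets (S K)"
    then have R: "rt (S K) l \<in> RT0 (S K)" using basis_S[OF K] by (auto simp: rt0_basis_def)
    show "L2 (lebesgue_on (interior (S K))) (rt (S K) l)" by (rule RT0_L2[OF R block_bounded interior_sets])
    show "weak_div (interior (S K)) (rt (S K) l) (\<lambda>x. 1 / measure lebesgue (S K))"
      using basis_S[OF K] l by (simp add: rt0_basis_def)
  qed
  moreover have "ae_eq (interior K) (os_bar S c rt K e) (rt K e)"
    using rt_os[OF K] e interior_subset[of K]
    by (auto simp: ae_eq_def space_restrict_space intro!: AE_I2)
  ultimately have "weak_div (interior K) (rt K e) (\<lambda>x. ?d)"
    using weak_div_cong_AE[OF interior_sets _ ae_eq_refl] by blast
  moreover have "weak_div (interior K) (rt K e) (\<lambda>x. 1 / measure lebesgue K)"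
    using basis[OF K] e by (simp add: rt0_basis_def)
  ultimately have "ae_eq (interior K) (\<lambda>x. ?d) (\<lambda>x. 1 / measure lebesgue K)"
    by (intro weak_div_unique[OF bounded_cell[OF K] open_interior] L2_const[OF bounded_cell[OF K] interior_sets])
  moreover have "interior K \<noteq> {}" using solid[OF K] by (simp add: solid_polytope_def)
  ultimately have "?d = 1 / measure lebesgue K" by (intro open_ae_const[OF open_interior])
  moreover have "weak_div (interior K) (\<psi>b K e) (\<lambda>x. ?d)"
    unfolding \<psi>b by (rule weak_div_os_bar[where F=\<psi>, OF weak_div_psi_block])
  ultimately show ?thesis by simp
qed

lemma psi_comb_L2: "L2 (lebesgue_on (interior K)) (cell_comb \<psi>b K a)"
  unfolding cell_comb_def[abs_def] by (intro L2_sum finite_cell_facets[OF K] psib_L2)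

lemma eta_comb_L2: "L2 (lebesgue_on (interior K)) (cell_comb \<eta>b K a)"
  unfolding cell_comb_def[abs_def] by (intro L2_sum finite_cell_facets[OF K] etab_L2)

lemma weak_div_psi_comb: "weak_div (interior K) (cell_comb \<psi>b K a) (\<lambda>x. cell_div K a)"
proof -
  have "weak_div (interior K) (cell_comb \<psi>b K a) (\<lambda>x. \<Sum>e\<in>facets K. a e * (1 / measure lebesgue K))"
    unfolding cell_comb_def[abs_def]
    by (intro weak_div_sum[OF bounded_cell[OF K] interior_sets finite_cell_facets[OF K]] psib_L2
        weak_div_psib L2_const[OF bounded_cell[OF K] interior_sets])
  then show ?thesis by (simp add: cell_div_def sum_divide_distrib)
qed

text \<open>
  The relation \<open>\<psi> = - k \<eta>\<close> is inherited by all combinations.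
\<close>

lemma constitutive_law:
  "ae_eq (interior K) (cell_comb \<psi>b K a) (\<lambda>x. - (k x *v cell_comb \<eta>b K a x))"
proof -
  have "AE x in lebesgue. x \<in> interior K \<longrightarrow> \<psi> (S K) l x + k x *v \<eta> (S K) l x = 0" if l: "l \<in> facets (S K)" for l
  proof -
    have "ae_eq (interior (S K)) (\<lambda>x. \<psi> (S K) l x + k x *v \<eta> (S K) l x) (\<lambda>x. 0)"
      using local_solutions[OF K, of l] l by (simp add: local_problem_def)
    then have "ae_eq (interior K) (\<lambda>x. \<psi> (S K) l x + k x *v \<eta> (S K) l x) (\<lambda>x. 0)"
      by (rule ae_eq_subset[OF _ cell_subset_block interior_sets interior_sets])
    then show ?thesis unfolding ae_eq_def AE_lebesgue_on_iff[OF interior_sets] .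
  qed
  then have "AE x in lebesgue. \<forall>l\<in>facets (S K). x \<in> interior K \<longrightarrow> \<psi> (S K) l x + k x *v \<eta> (S K) l x = 0"
    by (intro AE_finite_allI finite_block_facets)
  then have "AE x in lebesgue. x \<in> interior K \<longrightarrow> cell_comb \<psi>b K a x = - (k x *v cell_comb \<eta>b K a x)"
  proof eventually_elim
    case (elim x)
    show ?case
    proof
      assume x: "x \<in> interior K"
      have sumk: "k x *v (\<Sum>i\<in>A. f i) = (\<Sum>i\<in>A. k x *v f i)" for A :: "'i set" and f
        by (induction A rule: infinite_finite_induct) (simp_all add: matrix_vector_right_distrib)
      have \<psi>\<eta>: "\<psi> (S K) l x = - (k x *v \<eta> (S K) l x)" if "l \<in> facets (S K)" for l
        using elim x that by (metis add_eq_0_iff2)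
      have "\<psi>b K e x = - (k x *v \<eta>b K e x)" for e
        unfolding \<psi>b \<eta>b os_bar_def
        by (simp add: sumk matrix_vector_mult_scaleR sum_negf[symmetric] \<psi>\<eta>)
      then show "cell_comb \<psi>b K a x = - (k x *v cell_comb \<eta>b K a x)"
        by (simp add: cell_comb_def sumk matrix_vector_mult_scaleR sum_negf)
    qed
  qed
  then show ?thesis unfolding ae_eq_def AE_lebesgue_on_iff[OF interior_sets] .
qed

text \<open>
  The local bilinear form \<open>(\<theta>, \<tau>)\<^sub>K\<close> in coefficients; it is negative definite, see \<open>bil_energy\<close> and \<open>bil_definite\<close>.
\<close>

definition bil :: "((real^'n) set \<Rightarrow> real) \<Rightarrow> ((real^'n) set \<Rightarrow> real) \<Rightarrow> real" where
  "bil a b = ip (interior K) (cell_comb \<eta>b K a) (cell_comb \<psi>b K b)"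

lemma bil_expand:
  "bil a b = (\<Sum>e'\<in>facets K. \<Sum>e\<in>facets K. a e' * b e * ip (interior K) (\<eta>b K e') (\<psi>b K e))"
proof -
  have comm: "ip U u v = ip U v u" for U :: "(real^'n) set" and u v :: "real^'n \<Rightarrow> real^'n"
    by (simp add: ip_def inner_commute)
  have "bil a b = (\<Sum>e'\<in>facets K. a e' * ip (interior K) (\<eta>b K e') (cell_comb \<psi>b K b))"
    unfolding bil_def by (subst cell_comb_def[abs_def]) (intro ip_sum_left finite_cell_facets[OF K] etab_L2 psi_comb_L2)
  also have "\<dots> = (\<Sum>e'\<in>facets K. a e' * (\<Sum>e\<in>facets K. b e * ip (interior K) (\<eta>b K e') (\<psi>b K e)))"
  proof (intro sum.cong refl arg_cong2[where f="(*)"])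
    fix e'
    have "ip (interior K) (cell_comb \<psi>b K b) (\<eta>b K e') = (\<Sum>e\<in>facets K. b e * ip (interior K) (\<psi>b K e) (\<eta>b K e'))"
      unfolding cell_comb_def[abs_def] by (intro ip_sum_left finite_cell_facets[OF K] etab_L2 psib_L2)
    then show "ip (interior K) (\<eta>b K e') (cell_comb \<psi>b K b) = (\<Sum>e\<in>facets K. b e * ip (interior K) (\<eta>b K e') (\<psi>b K e))"
      by (simp add: comm[of _ "\<eta>b K e'"])
  qed
  finally show ?thesis by (simp add: sum_distrib_left mult.assoc)
qed

lemma bil_energy: "bil a a \<le> - kmin * (LINT x|lebesgue_on (interior K). (norm (cell_comb \<eta>b K a x))\<^sup>2)"
proof -
  let ?M = "lebesgue_on (interior K)"
  let ?\<Theta> = "cell_comb \<eta>b K a" and ?U = "cell_comb \<psi>b K a"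
  have "bil a a \<le> (LINT x|?M. - kmin * (norm (?\<Theta> x))\<^sup>2)"
    unfolding bil_def ip_def
  proof (rule integral_mono_AE)
    show "integrable ?M (\<lambda>x. ?\<Theta> x \<bullet> ?U x)" by (rule L2_inner_integrable[OF eta_comb_L2 psi_comb_L2])
    show "integrable ?M (\<lambda>x. - kmin * (norm (?\<Theta> x))\<^sup>2)" using eta_comb_L2[of a] by (simp add: L2_def)
    have "AE x in ?M. x \<in> interior K" by (rule AE_I2) (simp add: space_restrict_space)
    with constitutive_law[of a, unfolded ae_eq_def]
    show "AE x in ?M. ?\<Theta> x \<bullet> ?U x \<le> - kmin * (norm (?\<Theta> x))\<^sup>2"
    proof eventually_elim
      case (elim x)
      then have "x \<in> \<Omega>" using interior_cell_subset[OF K] by blast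
      from k_lower[OF this, of "?\<Theta> x"] show ?case using elim by simp
    qed
  qed
  then show ?thesis by simp
qed

lemma bil_nonpos: "bil a a \<le> 0"
proof -
  have "0 \<le> kmin * (LINT x|lebesgue_on (interior K). (norm (cell_comb \<eta>b K a x))\<^sup>2)"
    using kmin_pos by (intro mult_nonneg_nonneg Bochner_Integration.integral_nonneg) simp_all
  then show ?thesis using bil_energy[of a] by simp
qed

lemma comb_zero_coeff_zero:
  assumes "ae_eq (interior K) (cell_comb \<psi>b K a) (\<lambda>x. 0)" "e \<in> facets K"
  shows "a e = 0"
proof -
  have "ae_eq K (\<lambda>x. \<Sum>e\<in>facets K. a e *\<^sub>R \<psi>b K e x) (\<lambda>x. 0)"
    using assms(1) unfolding ae_eq_interior_iff[OF solid[OF K]] cell_comb_def .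
  then show ?thesis using independent K assms(2) unfolding cellwise_independent_def by blast
qed

lemma bil_definite:
  assumes "bil a a = 0" "e \<in> facets K"
  shows "a e = 0"
proof -
  let ?M = "lebesgue_on (interior K)"
  let ?\<Theta> = "cell_comb \<eta>b K a"
  have "kmin * (LINT x|?M. (norm (?\<Theta> x))\<^sup>2) \<le> 0" using bil_energy[of a] assms(1) by simp
  then have "(LINT x|?M. (norm (?\<Theta> x))\<^sup>2) \<le> 0"
    using kmin_pos by (simp add: mult_le_0_iff)
  then have "(LINT x|?M. (norm (?\<Theta> x))\<^sup>2) = 0"
    by (rule order_antisym) (rule Bochner_Integration.integral_nonneg, simp)
  moreover have "integrable ?M (\<lambda>x. (norm (?\<Theta> x))\<^sup>2)" using eta_comb_L2[of a] by (simp add: L2_def)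
  ultimately have "AE x in ?M. (norm (?\<Theta> x))\<^sup>2 = 0"
    by (subst (asm) integral_nonneg_eq_0_iff_AE) simp_all
  with constitutive_law[of a, unfolded ae_eq_def] have "AE x in ?M. cell_comb \<psi>b K a x = 0"
    by eventually_elim simp
  then show ?thesis by (intro comb_zero_coeff_zero[OF _ assms(2)]) (simp add: ae_eq_def)
qed

end

subsection \<open>Coordinates of discrete functions\<close>

text \<open>
  The coefficients \<open>a\<close> represent the piecewise field \<open>u\<close> with respect to the local functions \<open>b\<close>.
\<close>

definition reps ::
    "((real^'n) set \<Rightarrow> (real^'n) set \<Rightarrow> real^'n \<Rightarrow> real^'n) \<Rightarrow> (real^'n \<Rightarrow> real^'n) \<Rightarrow>
     ((real^'n) set \<Rightarrow> (real^'n) set \<Rightarrow> real) \<Rightarrow> bool" where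
  "reps b u a \<longleftrightarrow> (\<forall>K\<in>T. ae_eq (interior K) u (cell_comb b K (a K)))"

lemma reps_glue: "reps b (glue b a) a"
  by (simp add: reps_def glue_ae_cell)

lemma span_iff: "u \<in> cellwise_span \<Omega> T b \<longleftrightarrow> L2 (lebesgue_on \<Omega>) u \<and> (\<exists>a. reps b u a)"
proof -
  have "(\<forall>K\<in>T. \<exists>a. ae_eq K u (\<lambda>x. \<Sum>e\<in>facets K. a e *\<^sub>R b K e x)) \<longleftrightarrow>
      (\<forall>K\<in>T. \<exists>a. ae_eq (interior K) u (cell_comb b K a))"
    by (simp add: ae_eq_interior_iff[OF solid] cell_comb_def[abs_def])
  also have "\<dots> \<longleftrightarrow> (\<exists>a. reps b u a)"
    unfolding reps_def by (rule bchoice_iff)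
  finally show ?thesis by (simp add: cellwise_span_def)
qed

lemma reps_cong:
  assumes "reps b u a" "\<And>K e. K \<in> T \<Longrightarrow> e \<in> facets K \<Longrightarrow> a K e = a' K e"
  shows "reps b u a'"
  unfolding reps_def
proof
  fix K assume K: "K \<in> T"
  have "cell_comb b K (a' K) = cell_comb b K (a K)"
    by (rule cell_comb_cong) (use assms(2)[OF K] in simp)
  then show "ae_eq (interior K) u (cell_comb b K (a' K))" using assms(1) K by (simp add: reps_def)
qed

lemma reps_unique_ae:
  assumes "reps b u a" "reps b u' a"
  shows "ae_eq \<Omega> u u'"
proof (rule ae_eq_domainI)
  fix K assume "K \<in> T"
  then show "ae_eq (interior K) u u'"
    using assms ae_eq_trans[OF _ ae_eq_sym] unfolding reps_def by blast
qed

lemma psi_coeff_unique: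
  assumes K: "K \<in> T" and e: "e \<in> facets K"
    and ae: "ae_eq (interior K) u (cell_comb \<psi>b K a)" "ae_eq (interior K) u (cell_comb \<psi>b K a')"
  shows "a e = a' e"
proof -
  have "ae_eq (interior K) (cell_comb \<psi>b K (\<lambda>e. a e - a' e)) (\<lambda>x. 0)"
    using ae unfolding ae_eq_def cell_comb_diff by eventually_elim simp
  from comb_zero_coeff_zero[OF K this e] show ?thesis by simp
qed

lemma psi_glue_L2: "L2 (lebesgue_on \<Omega>) (glue \<psi>b a)"
  by (rule glue_L2[OF psi_comb_L2])

lemma eta_glue_L2: "L2 (lebesgue_on \<Omega>) (glue \<eta>b a)"
  by (rule glue_L2[OF eta_comb_L2])

text \<open>
  The coefficients chosen in the definition of \<open>M_cell\<close> are the representing ones, by independence.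
\<close>

lemma M_cell_eq:
  assumes u: "reps \<psi>b u a" and K: "K \<in> T"
  shows "M_cell \<psi>b rt u K = cell_comb rt K (a K)"
proof -
  define s where "s = (SOME a. ae_eq K u (\<lambda>x. \<Sum>e\<in>facets K. a e *\<^sub>R \<psi>b K e x))"
  have "ae_eq K u (\<lambda>x. \<Sum>e\<in>facets K. a K e *\<^sub>R \<psi>b K e x)"
    using u K unfolding reps_def ae_eq_interior_iff[OF solid[OF K]] cell_comb_def[abs_def] by blast
  then have "ae_eq K u (\<lambda>x. \<Sum>e\<in>facets K. s e *\<^sub>R \<psi>b K e x)"
    unfolding s_def by (rule someI[where P="\<lambda>a. ae_eq K u (\<lambda>x. \<Sum>e\<in>facets K. a e *\<^sub>R \<psi>b K e x)"])
  then have s: "ae_eq (interior K) u (cell_comb \<psi>b K s)"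
    unfolding ae_eq_interior_iff[OF solid[OF K]] cell_comb_def[abs_def] .
  have "ae_eq (interior K) u (cell_comb \<psi>b K (a K))" using u K by (simp add: reps_def)
  then have "s e = a K e" if "e \<in> facets K" for e
    using psi_coeff_unique[OF K that s] by simp
  then have "cell_comb rt K s = cell_comb rt K (a K)" by (rule cell_comb_cong)
  then show ?thesis unfolding M_cell_def[abs_def] Let_def s_def[symmetric] cell_comb_def[abs_def] .
qed

lemma M_h_eq:
  assumes u: "reps \<psi>b u a"
  shows "M_h T \<psi>b rt u = rt_field a"
proof
  fix x
  show "M_h T \<psi>b rt u x = rt_field a x"
    unfolding M_h_def glue_def by (intro sum.cong refl) (simp add: M_cell_eq[OF u] indicator_def)
qed

lemma X2_iff:
  assumes u: "reps \<psi>b u a" "L2 (lebesgue_on \<Omega>) u"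
  shows "u \<in> X2 \<Omega> T \<psi>b rt \<longleftrightarrow> balanced a"
proof -
  have "u \<in> cellwise_span \<Omega> T \<psi>b" using u span_iff by blast
  moreover have "rt_field a \<in> Vh \<Omega> T \<longleftrightarrow> balanced a" by (rule rt_field_Vh_iff) (rule cells)
  ultimately show ?thesis by (simp add: X2_def M_h_eq[OF u(1)])
qed

lemma C_h_eq:
  assumes u: "reps \<psi>b u a" and \<pi>: "\<pi> \<in> Pi_h \<Omega> T" and m: "face_values \<pi> m"
  shows "C_h T \<psi>b rt u \<pi> = (\<Sum>K\<in>T. \<Sum>e\<in>facets K. a K e * m e)"
  unfolding C_h_def
proof (intro sum.cong refl)
  fix K e assume K: "K \<in> T" and e: "e \<in> facets K"
  have ef: "e \<in> faces T" using faceI[OF K] e by simp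
  have ae: "AE x in surf e. \<pi> x = m e" using m ef by (simp add: face_values_def)
  have flux: "M_cell \<psi>b rt u K x \<bullet> outer_normal K e = a K e / measure (surf e) e" if "x \<in> e" for x
    unfolding M_cell_eq[OF u K] cell_comb_def
    by (rule rt0_combination_flux[OF basis[OF K] solid[OF K] _ that]) (use e in simp)
  have "(LINT x|surf e. (M_cell \<psi>b rt u K x \<bullet> outer_normal K e) * \<pi> x) =
      (LINT x|surf e. a K e / measure (surf e) e * \<pi> x)"
    by (rule Bochner_Integration.integral_cong[OF refl]) (simp add: flux space_surf)
  also have "\<dots> = a K e / measure (surf e) e * (LINT x|surf e. \<pi> x)" by (rule integral_mult_right_zero)
  also have "(LINT x|surf e. \<pi> x) = measure (surf e) e * m e"
  proof (cases "e \<subseteq> frontier \<Omega>")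
    case True
    then have "m e = 0" using m ef by (simp add: face_values_def)
    with ae show ?thesis by (simp add: integral_eq_zero_AE)
  next
    case False
    then have "L2 (surf e) \<pi>" using \<pi> ef by (simp add: Pi_h_def interior_faces_def)
    then have "(LINT x|surf e. \<pi> x) = (LINT x|surf e. m e)"
      using ae by (intro integral_cong_AE) (auto simp: L2_def)
    then show ?thesis by (simp add: space_surf)
  qed
  finally show "(LINT x|surf e. (M_cell \<psi>b rt u K x \<bullet> outer_normal K e) * \<pi> x) = a K e * m e"
    using face_surf(2)[OF ef] by simp
qed

text \<open>
  The function \<open>q\<close> has the constant value \<open>d K\<close> on each cell \<open>K\<close>.
\<close>

definition cell_values :: "(real^'n \<Rightarrow> real) \<Rightarrow> ((real^'n) set \<Rightarrow> real) \<Rightarrow> bool" where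
  "cell_values q d \<longleftrightarrow> (\<forall>K\<in>T. ae_eq (interior K) q (\<lambda>x. d K))"

text \<open>
  The piecewise constant function with the values \<open>d\<close>.
\<close>

definition cell_fun :: "((real^'n) set \<Rightarrow> real) \<Rightarrow> real^'n \<Rightarrow> real" where
  "cell_fun d x = (\<Sum>K\<in>T. indicator (interior K) x *\<^sub>R d K)"

lemma cell_fun_values: "cell_values (cell_fun d) d"
  unfolding cell_values_def ae_eq_def cell_fun_def
  using sum_indicator_cells[of _ _ d] by (auto simp: space_restrict_space intro!: AE_I2)

lemma cell_fun_L2: "L2 (lebesgue_on \<Omega>) (cell_fun d)"
  unfolding cell_fun_def[abs_def] by (intro L2_cells L2_const bounded_cell) simp_all

lemma Qh_iff: "q \<in> Qh T \<longleftrightarrow> (\<exists>d. cell_values q d)"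
proof -
  have "q \<in> Qh T \<longleftrightarrow> (\<forall>K\<in>T. \<exists>c. ae_eq (interior K) q (\<lambda>x. c))"
    by (simp add: Qh_def ae_eq_interior_iff[OF solid])
  then show ?thesis unfolding cell_values_def by (simp add: bchoice_iff)
qed

lemma cell_values_ae:
  assumes "cell_values q d" "cell_values q' d'" "\<And>K. K \<in> T \<Longrightarrow> d K = d' K"
  shows "ae_eq \<Omega> q q'"
proof (rule ae_eq_domainI)
  fix K assume K: "K \<in> T"
  have "ae_eq (interior K) q (\<lambda>x. d K)" "ae_eq (interior K) q' (\<lambda>x. d K)"
    using assms K by (auto simp: cell_values_def)
  then show "ae_eq (interior K) q q'" using ae_eq_trans[OF _ ae_eq_sym] by blast
qed

lemma ip_cell_div:
  assumes u: "reps \<psi>b u a" and q: "cell_values q d" and K: "K \<in> T"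
  shows "ip K q (wdiv (interior K) u) = d K * (\<Sum>e\<in>facets K. a K e)"
proof -
  have ae: "ae_eq (interior K) u (cell_comb \<psi>b K (a K))" using u K by (simp add: reps_def)
  have "weak_div (interior K) u (\<lambda>x. cell_div K (a K))"
    by (rule weak_div_cong_AE[OF interior_sets ae_eq_sym[OF ae] ae_eq_refl weak_div_psi_comb[OF K]])
  then have "ae_eq (interior K) (wdiv (interior K) u) (\<lambda>x. cell_div K (a K))"
    by (rule wdiv_ae_eq[OF bounded_cell[OF K] open_interior _ L2_const[OF bounded_cell[OF K] interior_sets]])
  moreover have "ae_eq (interior K) q (\<lambda>x. d K)" using q K by (simp add: cell_values_def)
  ultimately have "ip (interior K) q (wdiv (interior K) u) = ip (interior K) (\<lambda>x. d K) (\<lambda>x. cell_div K (a K))"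
    by (intro ip_cong_AE[OF interior_sets])
  also have "\<dots> = d K * (measure lebesgue (interior K) * cell_div K (a K))"
    unfolding ip_def using interior_sets by (simp add: space_restrict_space measure_restrict_space)
  also have "measure lebesgue (interior K) = measure lebesgue K"
    using measure_interior solid_polytope_bounded[OF solid[OF K]] negligible_convex_frontier[OF solid_polytope_convex[OF solid[OF K]]]
    by blast
  also have "measure lebesgue K * cell_div K (a K) = (\<Sum>e\<in>facets K. a K e)"
  proof -
    have "interior K \<noteq> {}" using solid[OF K] by (simp add: solid_polytope_def)
    then have "\<not> negligible (interior K)" using open_not_negligible[OF open_interior] by blast
    moreover have "interior K \<in> lmeasurable"
      by (rule bounded_set_imp_lmeasurable[OF bounded_cell[OF K] interior_sets])
    ultimately have "measure lebesgue (interior K) \<noteq> 0"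
      using negligible_iff_measure0 by blast
    then have "measure lebesgue K \<noteq> 0" using \<open>measure lebesgue (interior K) = measure lebesgue K\<close> by simp
    then show ?thesis by (simp add: cell_div_def)
  qed
  finally show ?thesis by (simp add: ip_interior[OF solid[OF K]])
qed

lemma ip_cell_values:
  assumes f: "L2 (lebesgue_on \<Omega>) f" and q: "cell_values q d"
  shows "ip \<Omega> f q = (\<Sum>K\<in>T. d K * (LINT x|lebesgue_on (interior K). f x))"
proof -
  have "ip \<Omega> f q = ip \<Omega> f (cell_fun d)"
    by (rule ip_cong_AE[OF domain_sets ae_eq_refl]) (rule cell_values_ae[OF q cell_fun_values], rule refl)
  also have "\<dots> = (\<Sum>K\<in>T. ip (interior K) f (cell_fun d))" by (rule ip_cells_L2[OF f cell_fun_L2])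
  also have "\<dots> = (\<Sum>K\<in>T. ip (interior K) f (\<lambda>x. d K))"
    by (intro sum.cong refl ip_cong_AE ae_eq_refl interior_sets)
      (use cell_fun_values in \<open>auto simp: cell_values_def\<close>)
  also have "\<dots> = (\<Sum>K\<in>T. d K * (LINT x|lebesgue_on (interior K). f x))"
    by (simp add: ip_def mult.commute)
  finally show ?thesis .
qed

subsection \<open>The variational equations in coordinates\<close>

lemma ip_theta_tau:
  assumes "L2 (lebesgue_on \<Omega>) \<theta>" "reps \<eta>b \<theta> a" "L2 (lebesgue_on \<Omega>) \<tau>" "reps \<psi>b \<tau> b"
  shows "ip \<Omega> \<theta> \<tau> = (\<Sum>K\<in>T. bil K (a K) (b K))"
proof -
  have "ip \<Omega> \<theta> \<tau> = (\<Sum>K\<in>T. ip (interior K) \<theta> \<tau>)" by (rule ip_cells_L2[OF assms(1,3)])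
  also have "\<dots> = (\<Sum>K\<in>T. bil K (a K) (b K))"
  proof (intro sum.cong refl)
    fix K assume K: "K \<in> T"
    show "ip (interior K) \<theta> \<tau> = bil K (a K) (b K)"
      unfolding bil_def[OF K] by (rule ip_cong_AE) (use assms(2,4) K in \<open>auto simp: reps_def\<close>)
  qed
  finally show ?thesis .
qed

text \<open>
  Since \<open>k \<theta>\<close> is minus the flux with the coefficients of \<open>\<theta>\<close>, the residual of the first equation is the form \<open>bil\<close> at the difference of the coefficients.
\<close>

lemma residual_law:
  assumes \<theta>: "L2 (lebesgue_on \<Omega>) \<theta>" "reps \<eta>b \<theta> a'" and u: "L2 (lebesgue_on \<Omega>) u" "reps \<psi>b u a"
    and \<xi>: "L2 (lebesgue_on \<Omega>) \<xi>" "reps \<eta>b \<xi> b"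
  shows "ip \<Omega> (\<lambda>x. k x *v \<theta> x) \<xi> + ip \<Omega> u \<xi> = (\<Sum>K\<in>T. bil K (b K) (a K) - bil K (b K) (a' K))"
proof -
  have comm: "ip U u v = ip U v u" for U :: "(real^'n) set" and u v :: "real^'n \<Rightarrow> real^'n"
    by (simp add: ip_def inner_commute)
  let ?w = "glue \<psi>b a'"
  have "ae_eq \<Omega> (\<lambda>x. k x *v \<theta> x) (\<lambda>x. - ?w x)"
  proof (rule ae_eq_domainI)
    fix K assume K: "K \<in> T"
    have "ae_eq (interior K) \<theta> (cell_comb \<eta>b K (a' K))" using \<theta>(2) K by (simp add: reps_def)
    with constitutive_law[OF K, of "a' K"] glue_ae_cell[OF K, of \<psi>b a']
    show "ae_eq (interior K) (\<lambda>x. k x *v \<theta> x) (\<lambda>x. - ?w x)"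
      unfolding ae_eq_def by eventually_elim simp
  qed
  then have "ip \<Omega> (\<lambda>x. k x *v \<theta> x) \<xi> = ip \<Omega> (\<lambda>x. - ?w x) \<xi>"
    by (rule ip_cong_AE[OF domain_sets _ ae_eq_refl])
  also have "\<dots> = - ip \<Omega> \<xi> ?w"
    by (simp add: ip_def inner_commute)
  finally show ?thesis
    unfolding ip_theta_tau[OF \<xi> psi_glue_L2 reps_glue] comm[of \<Omega> u \<xi>] ip_theta_tau[OF \<xi> u]
    by (simp add: sum_subtractf)
qed

lemma bil_diff_left: "K \<in> T \<Longrightarrow> bil K (\<lambda>e. a e - a' e) b = bil K a b - bil K a' b"
  by (simp add: bil_expand left_diff_distrib sum_subtractf)

lemma bil_diff_right: "K \<in> T \<Longrightarrow> bil K b (\<lambda>e. a e - a' e) = bil K b a - bil K b a'"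
  by (simp add: bil_expand left_diff_distrib right_diff_distrib sum_subtractf)

lemma bil_cong:
  "K \<in> T \<Longrightarrow> (\<And>e. e \<in> facets K \<Longrightarrow> a e = a' e) \<Longrightarrow> (\<And>e. e \<in> facets K \<Longrightarrow> b e = b' e) \<Longrightarrow> bil K a b = bil K a' b'"
  by (simp add: bil_expand)

lemma sum_bil_definite:
  assumes "(\<Sum>K\<in>T. bil K (a K) (a K)) = 0" "K \<in> T" "e \<in> facets K"
  shows "a K e = 0"
proof -
  have "(\<Sum>K\<in>T. - bil K (a K) (a K)) = 0" using assms(1) by (simp add: sum_negf)
  then have "\<forall>K\<in>T. - bil K (a K) (a K) = 0"
    by (subst (asm) sum_nonneg_eq_0_iff[OF finite_mesh]) (simp_all add: bil_nonpos)
  then show ?thesis using bil_definite[OF assms(2) _ assms(3)] assms(2) by simp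
qed

text \<open>
  Testing with the difference of the coefficients of \<open>u\<close> and \<open>\<theta>\<close> and using definiteness shows that they agree.
\<close>

lemma first_equation_iff:
  assumes \<theta>: "L2 (lebesgue_on \<Omega>) \<theta>" "reps \<eta>b \<theta> a'" and u: "L2 (lebesgue_on \<Omega>) u" "reps \<psi>b u a"
  shows "(\<forall>\<xi>\<in>cellwise_span \<Omega> T \<eta>b. ip \<Omega> (\<lambda>x. k x *v \<theta> x) \<xi> + ip \<Omega> u \<xi> = 0) \<longleftrightarrow>
    (\<forall>K\<in>T. \<forall>e\<in>facets K. a' K e = a K e)"
proof
  assume eq: "\<forall>\<xi>\<in>cellwise_span \<Omega> T \<eta>b. ip \<Omega> (\<lambda>x. k x *v \<theta> x) \<xi> + ip \<Omega> u \<xi> = 0"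
  define d where "d K e = a K e - a' K e" for K e
  have "glue \<eta>b d \<in> cellwise_span \<Omega> T \<eta>b" using span_iff eta_glue_L2 reps_glue by blast
  then have "(\<Sum>K\<in>T. bil K (d K) (a K) - bil K (d K) (a' K)) = 0"
    using eq residual_law[OF \<theta> u eta_glue_L2[of d] reps_glue[of \<eta>b d]] by simp
  then have "(\<Sum>K\<in>T. bil K (d K) (d K)) = 0"
    by (simp add: bil_diff_right[symmetric] d_def[abs_def])
  from sum_bil_definite[OF this] show "\<forall>K\<in>T. \<forall>e\<in>facets K. a' K e = a K e"
    by (simp add: d_def)
next
  assume eq: "\<forall>K\<in>T. \<forall>e\<in>facets K. a' K e = a K e"
  show "\<forall>\<xi>\<in>cellwise_span \<Omega> T \<eta>b. ip \<Omega> (\<lambda>x. k x *v \<theta> x) \<xi> + ip \<Omega> u \<xi> = 0"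
  proof
    fix \<xi> assume "\<xi> \<in> cellwise_span \<Omega> T \<eta>b"
    then obtain b where \<xi>: "L2 (lebesgue_on \<Omega>) \<xi>" "reps \<eta>b \<xi> b" using span_iff by blast
    have "bil K (b K) (a K) = bil K (b K) (a' K)" if "K \<in> T" for K
      using eq that by (intro bil_cong) auto
    then show "ip \<Omega> (\<lambda>x. k x *v \<theta> x) \<xi> + ip \<Omega> u \<xi> = 0"
      unfolding residual_law[OF \<theta> u \<xi>] by simp
  qed
qed

end

context oversampling
begin

section \<open>The algebraic systems\<close>

text \<open>
  The hybrid problem in coefficients: \<open>a\<close> for the flux and its gradient variable, \<open>p\<close> for the pressure, \<open>m\<close> for the multiplier, and the
  load \<open>F\<close>.
\<close>

definition hos_system ::
    "((real^'n) set \<Rightarrow> (real^'n) set \<Rightarrow> real) \<Rightarrow> ((real^'n) set \<Rightarrow> real) \<Rightarrow> ((real^'n) set \<Rightarrow> real) \<Rightarrow>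
     ((real^'n) set \<Rightarrow> real) \<Rightarrow> bool" where
  "hos_system a p m F \<longleftrightarrow>
     (\<forall>b. (\<Sum>K\<in>T. bil K (a K) (b K) + p K * (\<Sum>e\<in>facets K. b K e)) = (\<Sum>K\<in>T. \<Sum>e\<in>facets K. b K e * m e)) \<and>
     (\<forall>K\<in>T. (\<Sum>e\<in>facets K. a K e) = F K) \<and> balanced a \<and>
     (\<forall>e\<in>faces T. e \<subseteq> frontier \<Omega> \<longrightarrow> m e = 0)"

text \<open>
  The conforming problem in coefficients, where fluxes and test functions are balanced.
\<close>

definition os_system ::
    "((real^'n) set \<Rightarrow> (real^'n) set \<Rightarrow> real) \<Rightarrow> ((real^'n) set \<Rightarrow> real) \<Rightarrow> ((real^'n) set \<Rightarrow> real) \<Rightarrow> bool" where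
  "os_system a p F \<longleftrightarrow>
     (\<forall>b. balanced b \<longrightarrow> (\<Sum>K\<in>T. bil K (a K) (b K) + p K * (\<Sum>e\<in>facets K. b K e)) = 0) \<and>
     (\<forall>K\<in>T. (\<Sum>e\<in>facets K. a K e) = F K) \<and> balanced a"

lemma flux_jump_diff: "flux_jump (\<lambda>K e. a K e - a' K e) e = flux_jump a e - flux_jump a' e"
  by (simp add: flux_jump_def sum_subtractf)

lemma balanced_diff: "balanced a \<Longrightarrow> balanced a' \<Longrightarrow> balanced (\<lambda>K e. a K e - a' K e)"
  by (simp add: balanced_def flux_jump_diff)

lemma balanced_pairing:
  assumes "balanced a" "\<And>e. e \<in> faces T \<Longrightarrow> e \<subseteq> frontier \<Omega> \<Longrightarrow> m e = 0"
  shows "(\<Sum>K\<in>T. \<Sum>e\<in>facets K. a K e * m e) = 0"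
  unfolding sum_cells_facets
  by (rule sum.neutral) (use assms in \<open>auto simp: balanced_def interior_faces_def\<close>)

lemma hos_imp_os: "hos_system a p m F \<Longrightarrow> os_system a p F"
  unfolding hos_system_def os_system_def using balanced_pairing[of _ m] by simp

lemma hos_system_diff:
  assumes "hos_system a p m F" "hos_system a' p' m' F'"
  shows "hos_system (\<lambda>K e. a K e - a' K e) (\<lambda>K. p K - p' K) (\<lambda>e. m e - m' e) (\<lambda>K. F K - F' K)"
proof -
  have "(\<Sum>K\<in>T. bil K (\<lambda>e. a K e - a' K e) (b K) + (p K - p' K) * (\<Sum>e\<in>facets K. b K e)) =
      (\<Sum>K\<in>T. bil K (a K) (b K) + p K * (\<Sum>e\<in>facets K. b K e)) -
      (\<Sum>K\<in>T. bil K (a' K) (b K) + p' K * (\<Sum>e\<in>facets K. b K e))" for b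
    unfolding sum_subtractf[symmetric]
    by (rule sum.cong[OF refl]) (simp add: bil_diff_left algebra_simps)
  moreover have "(\<Sum>K\<in>T. \<Sum>e\<in>facets K. b K e * (m e - m' e)) =
      (\<Sum>K\<in>T. \<Sum>e\<in>facets K. b K e * m e) - (\<Sum>K\<in>T. \<Sum>e\<in>facets K. b K e * m' e)" for b
    by (simp add: right_diff_distrib sum_subtractf)
  ultimately show ?thesis
    using assms unfolding hos_system_def by (simp add: balanced_diff sum_subtractf)
qed

lemma os_system_diff:
  assumes "os_system a p F" "os_system a' p' F'"
  shows "os_system (\<lambda>K e. a K e - a' K e) (\<lambda>K. p K - p' K) (\<lambda>K. F K - F' K)"
proof -
  have "(\<Sum>K\<in>T. bil K (\<lambda>e. a K e - a' K e) (b K) + (p K - p' K) * (\<Sum>e\<in>facets K. b K e)) =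
      (\<Sum>K\<in>T. bil K (a K) (b K) + p K * (\<Sum>e\<in>facets K. b K e)) -
      (\<Sum>K\<in>T. bil K (a' K) (b K) + p' K * (\<Sum>e\<in>facets K. b K e))" for b
    unfolding sum_subtractf[symmetric]
    by (rule sum.cong[OF refl]) (simp add: bil_diff_left algebra_simps)
  then show ?thesis
    using assms unfolding os_system_def by (simp add: balanced_diff sum_subtractf)
qed

lemma os_system_zero_flux:
  assumes "os_system a p (\<lambda>K. 0)" "K \<in> T" "e \<in> facets K"
  shows "a K e = 0"
proof -
  have "(\<Sum>K\<in>T. bil K (a K) (a K) + p K * (\<Sum>e\<in>facets K. a K e)) = 0"
    using assms(1) unfolding os_system_def by blast
  then have "(\<Sum>K\<in>T. bil K (a K) (a K)) = 0"
    using assms(1) unfolding os_system_def by simp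
  from sum_bil_definite[OF this assms(2,3)] show ?thesis .
qed

lemma bil_zero_left: "K \<in> T \<Longrightarrow> (\<And>e. e \<in> facets K \<Longrightarrow> a e = 0) \<Longrightarrow> bil K a b = 0"
  by (simp add: bil_expand)

text \<open>
  Uniqueness. Once \<open>a\<close> vanishes, testing with a single coefficient gives \<open>p K = m e\<close> for all facets \<open>e\<close> of \<open>K\<close>.
\<close>

lemma hos_system_zero:
  assumes h: "hos_system a p m (\<lambda>K. 0)"
  shows "\<And>K e. K \<in> T \<Longrightarrow> e \<in> facets K \<Longrightarrow> a K e = 0" and "\<And>K. K \<in> T \<Longrightarrow> p K = 0"
    and "\<And>e. e \<in> faces T \<Longrightarrow> m e = 0"
proof -
  show a0: "a K e = 0" if "K \<in> T" "e \<in> facets K" for K e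
    by (rule os_system_zero_flux[OF hos_imp_os[OF h] that])
  have pm: "p K = m e" if K: "K \<in> T" and e: "e facet_of K" for K e
  proof -
    let ?b = "\<lambda>L e'. if L = K \<and> e' = e then 1 else 0 :: real"
    have b: "(\<Sum>e'\<in>facets L. ?b L e' * g e') = (if L = K then g e else 0)" if "L \<in> T" for L and g :: "_ \<Rightarrow> real"
    proof (cases "L = K")
      case True
      have "(\<Sum>e'\<in>facets L. ?b L e' * g e') = (\<Sum>e'\<in>facets K. if e' = e then g e else 0)"
        using True by (intro sum.cong) auto
      then show ?thesis using True e finite_cell_facets[OF K] by simp
    qed simp
    have "(\<Sum>L\<in>T. bil L (a L) (?b L) + p L * (\<Sum>e'\<in>facets L. ?b L e')) = (\<Sum>L\<in>T. \<Sum>e'\<in>facets L. ?b L e' * m e')"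
      by (rule spec[OF conjunct1[OF h[unfolded hos_system_def]], of ?b])
    also have "\<dots> = (\<Sum>L\<in>T. if L = K then m e else 0)" by (rule sum.cong[OF refl]) (rule b)
    also have "\<dots> = m e" using K finite_mesh by simp
    also have "(\<Sum>L\<in>T. bil L (a L) (?b L) + p L * (\<Sum>e'\<in>facets L. ?b L e')) = (\<Sum>L\<in>T. if L = K then p K else 0)"
    proof (intro sum.cong refl)
      fix L assume L: "L \<in> T"
      have "bil L (a L) (?b L) = 0" by (rule bil_zero_left[OF L a0[OF L]])
      moreover have "(\<Sum>e'\<in>facets L. ?b L e') = (if L = K then 1 else 0)" using b[OF L, of "\<lambda>_. 1"] by simp
      ultimately show "bil L (a L) (?b L) + p L * (\<Sum>e'\<in>facets L. ?b L e') = (if L = K then p K else 0)" by simp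
    qed
    also have "\<dots> = p K" using K finite_mesh by simp
    finally show ?thesis .
  qed
  show p0: "p K = 0" if K: "K \<in> T" for K
    by (rule mesh_facet_constants_zero[OF mesh open_domain pm _ K]) (use h in \<open>auto simp: hos_system_def\<close>)
  show "m e = 0" if "e \<in> faces T" for e
    using face_facet[OF that] pm p0 by metis
qed

text \<open>
  The unknowns are indexed by the pairs of a cell and a facet, the cells, and the interior faces, and so are the equations: the test coefficients, the
  divergence on each cell, and the balance at each interior face. Hence the system is square.
\<close>

lemma hos_system_exists: "\<exists>a p m. hos_system a p m F"
proof -
  define Fi where "Fi = interior_faces \<Omega> T"
  have fFi: "finite Fi" using finite_faces by (simp add: Fi_def interior_faces_def)
  define E where "E = (SIGMA K:T. facets K)"
  have fE: "finite E" unfolding E_def using finite_mesh finite_cell_facets by (intro finite_SigmaI) auto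
  define J where "J = E <+> (T <+> Fi)"
  have fJ: "finite J" unfolding J_def using fE fFi finite_mesh by simp
  define M where "M i j = (case i of
      Inl (K, e) \<Rightarrow> (case j of Inl (K', e') \<Rightarrow> if K' = K then ip (interior K) (\<eta>b K e') (\<psi>b K e) else 0
                    | Inr (Inl K') \<Rightarrow> if K' = K then 1 else 0
                    | Inr (Inr e') \<Rightarrow> if e' = e then - 1 else 0)
    | Inr (Inl K) \<Rightarrow> (case j of Inl (K', e') \<Rightarrow> if K' = K then 1 else 0 | Inr _ \<Rightarrow> 0)
    | Inr (Inr e) \<Rightarrow> (case j of Inl (K', e') \<Rightarrow> if e' = e then 1 else 0 | Inr _ \<Rightarrow> (0::real)))"
    for i j :: "(real^'n) set \<times> (real^'n) set + (real^'n) set + (real^'n) set"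
  define aa where "aa x K e = (x (Inl (K, e)) :: real)" for x :: "(real^'n) set \<times> (real^'n) set + (real^'n) set + (real^'n) set \<Rightarrow> real" and K e
  define pp where "pp x K = (x (Inr (Inl K)) :: real)" for x :: "(real^'n) set \<times> (real^'n) set + (real^'n) set + (real^'n) set \<Rightarrow> real" and K
  define mm where "mm x e = (if e \<in> Fi then x (Inr (Inr e)) else 0 :: real)" for x :: "(real^'n) set \<times> (real^'n) set + (real^'n) set + (real^'n) set \<Rightarrow> real" and e
  have split: "(\<Sum>j\<in>J. M i j * x j) = (\<Sum>K\<in>T. \<Sum>e\<in>facets K. M i (Inl (K, e)) * aa x K e) +
      ((\<Sum>K\<in>T. M i (Inr (Inl K)) * pp x K) + (\<Sum>e\<in>Fi. M i (Inr (Inr e)) * mm x e))" for i x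
  proof -
    have "(\<Sum>j\<in>E. M i (Inl j) * x (Inl j)) = (\<Sum>K\<in>T. \<Sum>e\<in>facets K. M i (Inl (K, e)) * aa x K e)"
      unfolding E_def using finite_mesh finite_cell_facets by (subst sum.Sigma) (auto simp: aa_def case_prod_unfold)
    then show ?thesis
      unfolding J_def using fE fFi finite_mesh by (simp add: sum.Plus pp_def mm_def)
  qed
  have row1: "(\<Sum>j\<in>J. M (Inl (K, e)) j * x j) =
      (\<Sum>e'\<in>facets K. ip (interior K) (\<eta>b K e') (\<psi>b K e) * aa x K e') + pp x K - mm x e"
    if K: "K \<in> T" for K e x
  proof -
    have "(\<Sum>L\<in>T. \<Sum>e'\<in>facets L. M (Inl (K, e)) (Inl (L, e')) * aa x L e') =
      (\<Sum>L\<in>T. if L = K then (\<Sum>e'\<in>facets K. ip (interior K) (\<eta>b K e') (\<psi>b K e) * aa x K e') else 0)"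
      by (intro sum.cong refl) (simp add: M_def)
    moreover have "(\<Sum>L\<in>T. M (Inl (K, e)) (Inr (Inl L)) * pp x L) = (\<Sum>L\<in>T. if L = K then pp x K else 0)"
      by (intro sum.cong refl) (simp add: M_def)
    moreover have "(\<Sum>e'\<in>Fi. M (Inl (K, e)) (Inr (Inr e')) * mm x e') = (\<Sum>e'\<in>Fi. if e' = e then - mm x e else 0)"
      by (intro sum.cong refl) (simp add: M_def)
    moreover have "mm x e = 0" if "e \<notin> Fi" using that by (simp add: mm_def)
    ultimately show ?thesis unfolding split using K finite_mesh fFi by auto
  qed
  have row2: "(\<Sum>j\<in>J. M (Inr (Inl K)) j * x j) = (\<Sum>e\<in>facets K. aa x K e)" if K: "K \<in> T" for K x
  proof -
    have "(\<Sum>L\<in>T. \<Sum>e'\<in>facets L. M (Inr (Inl K)) (Inl (L, e')) * aa x L e') =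
      (\<Sum>L\<in>T. if L = K then (\<Sum>e\<in>facets K. aa x K e) else 0)"
      by (intro sum.cong refl) (simp add: M_def)
    then show ?thesis unfolding split using K finite_mesh by (simp add: M_def)
  qed
  have row3: "(\<Sum>j\<in>J. M (Inr (Inr e)) j * x j) = flux_jump (aa x) e" if e: "e \<in> faces T" for e x
  proof -
    have "(\<Sum>L\<in>T. \<Sum>e'\<in>facets L. M (Inr (Inr e)) (Inl (L, e')) * aa x L e') =
      (\<Sum>L\<in>T. \<Sum>e'\<in>facets L. aa x L e' * (if e' = e then 1 else 0))"
      by (intro sum.cong refl) (simp add: M_def)
    also have "\<dots> = (\<Sum>e'\<in>faces T. flux_jump (aa x) e' * (if e' = e then 1 else 0))"
      by (rule sum_cells_facets)
    also have "\<dots> = (\<Sum>e'\<in>faces T. if e' = e then flux_jump (aa x) e else 0)"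
      by (intro sum.cong refl) simp
    also have "\<dots> = flux_jump (aa x) e" using e finite_faces by simp
    finally show ?thesis unfolding split by (simp add: M_def)
  qed
  have sys: "hos_system (aa x) (pp x) (mm x) G"
    if x: "\<forall>i\<in>J. (\<Sum>j\<in>J. M i j * x j) = (case i of Inl _ \<Rightarrow> 0 | Inr (Inl K) \<Rightarrow> G K | Inr (Inr e) \<Rightarrow> 0)" for x G
    unfolding hos_system_def
  proof (intro conjI allI)
    fix b
    have r1: "(\<Sum>e'\<in>facets K. ip (interior K) (\<eta>b K e') (\<psi>b K e) * aa x K e') + pp x K = mm x e"
      if "K \<in> T" "e \<in> facets K" for K e
    proof -
      have "Inl (K, e) \<in> J" using that by (auto simp: J_def E_def)
      from x[rule_format, OF this] show ?thesis unfolding row1[OF that(1)] by simp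
    qed
    show "(\<Sum>K\<in>T. bil K (aa x K) (b K) + pp x K * (\<Sum>e\<in>facets K. b K e)) =
        (\<Sum>K\<in>T. \<Sum>e\<in>facets K. b K e * mm x e)"
    proof (intro sum.cong refl)
      fix K assume K: "K \<in> T"
      have "(\<Sum>e\<in>facets K. b K e * mm x e) =
        (\<Sum>e\<in>facets K. b K e * ((\<Sum>e'\<in>facets K. ip (interior K) (\<eta>b K e') (\<psi>b K e) * aa x K e') + pp x K))"
        by (intro sum.cong refl) (simp add: r1[OF K])
      also have "\<dots> = (\<Sum>e\<in>facets K. \<Sum>e'\<in>facets K. aa x K e' * b K e * ip (interior K) (\<eta>b K e') (\<psi>b K e))
          + pp x K * (\<Sum>e\<in>facets K. b K e)"
        by (simp add: distrib_left sum.distrib sum_distrib_left ac_simps)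
      also have "(\<Sum>e\<in>facets K. \<Sum>e'\<in>facets K. aa x K e' * b K e * ip (interior K) (\<eta>b K e') (\<psi>b K e)) = bil K (aa x K) (b K)"
        unfolding bil_expand[OF K] by (rule sum.swap)
      finally show "bil K (aa x K) (b K) + pp x K * (\<Sum>e\<in>facets K. b K e) = (\<Sum>e\<in>facets K. b K e * mm x e)" by simp
    qed
    show "\<forall>K\<in>T. (\<Sum>e\<in>facets K. aa x K e) = G K"
    proof
      fix K assume K: "K \<in> T"
      then have "Inr (Inl K) \<in> J" by (auto simp: J_def)
      from x[rule_format, OF this] show "(\<Sum>e\<in>facets K. aa x K e) = G K" unfolding row2[OF K] by simp
    qed
    show "balanced (aa x)"
      unfolding balanced_def
    proof
      fix e assume e: "e \<in> interior_faces \<Omega> T"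
      then have ef: "e \<in> faces T" by (simp add: interior_faces_def)
      have "Inr (Inr e) \<in> J" using e by (auto simp: J_def Fi_def)
      from x[rule_format, OF this] show "flux_jump (aa x) e = 0" unfolding row3[OF ef] by simp
    qed
    show "\<forall>e\<in>faces T. e \<subseteq> frontier \<Omega> \<longrightarrow> mm x e = 0"
      by (simp add: mm_def Fi_def interior_faces_def)
  qed
  have "\<exists>x. \<forall>i\<in>J. (\<Sum>j\<in>J. M i j * x j) = (case i of Inl _ \<Rightarrow> 0 | Inr (Inl K) \<Rightarrow> F K | Inr (Inr e) \<Rightarrow> 0)"
  proof (rule square_system_solvable[OF fJ fJ refl])
    fix x assume "\<forall>i\<in>J. (\<Sum>j\<in>J. M i j * x j) = 0"
    then have "\<forall>i\<in>J. (\<Sum>j\<in>J. M i j * x j) = (case i of Inl _ \<Rightarrow> 0 | Inr (Inl K) \<Rightarrow> 0 | Inr (Inr e) \<Rightarrow> 0)"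
      by (simp split: sum.splits)
    note z = hos_system_zero[OF sys[OF this]]
    have "x (Inl (K, e)) = 0" if "K \<in> T" "e \<in> facets K" for K e
      using z(1)[OF that] by (simp add: aa_def)
    moreover have "x (Inr (Inl K)) = 0" if "K \<in> T" for K
      using z(2)[OF that] by (simp add: pp_def)
    moreover have "x (Inr (Inr e)) = 0" if "e \<in> Fi" for e
      using z(3)[of e] that by (simp add: mm_def Fi_def interior_faces_def)
    ultimately show "\<forall>j\<in>J. x j = 0"
      unfolding J_def E_def by blast
  qed
  then show ?thesis using sys by blast
qed

text \<open>
  The hybrid system with load \<open>p\<close> provides a balanced test flux with divergences \<open>p\<close>.
\<close>

lemma os_system_zero_pressure:
  assumes os: "os_system a p (\<lambda>K. 0)" and K: "K \<in> T"
  shows "p K = 0"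
proof -
  obtain b q m where h: "hos_system b q m p" using hos_system_exists by blast
  then have b: "balanced b" "\<And>K. K \<in> T \<Longrightarrow> (\<Sum>e\<in>facets K. b K e) = p K" by (auto simp: hos_system_def)
  have "(\<Sum>K\<in>T. bil K (a K) (b K) + p K * (\<Sum>e\<in>facets K. b K e)) = 0"
    using os b(1) by (simp add: os_system_def)
  moreover have "bil K (a K) (b K) = 0" if "K \<in> T" for K
    by (rule bil_zero_left[OF that os_system_zero_flux[OF os that]])
  ultimately have "(\<Sum>K\<in>T. p K * p K) = 0" using b(2) by simp
  then have "\<forall>K\<in>T. p K * p K = 0" by (subst (asm) sum_nonneg_eq_0_iff[OF finite_mesh]) simp_all
  then show ?thesis using K by simp
qed

section \<open>The discrete problems as algebraic systems\<close>

lemma divergence_equation_iff: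
  assumes f: "L2 (lebesgue_on \<Omega>) f" and u: "reps \<psi>b u a"
  shows "(\<forall>q\<in>Qh T. (\<Sum>K\<in>T. ip K (wdiv (interior K) u) q) = ip \<Omega> f q) \<longleftrightarrow>
    (\<forall>K\<in>T. (\<Sum>e\<in>facets K. a K e) = (LINT x|lebesgue_on (interior K). f x))"
proof -
  have lhs: "(\<Sum>K\<in>T. ip K (wdiv (interior K) u) q) = (\<Sum>K\<in>T. d K * (\<Sum>e\<in>facets K. a K e))"
    if "cell_values q d" for q d
  proof (intro sum.cong refl)
    fix K assume "K \<in> T"
    from ip_cell_div[OF u that this]
    show "ip K (wdiv (interior K) u) q = d K * (\<Sum>e\<in>facets K. a K e)"
      by (simp add: ip_def mult.commute)
  qed
  show ?thesis
  proof
    assume eq: "\<forall>q\<in>Qh T. (\<Sum>K\<in>T. ip K (wdiv (interior K) u) q) = ip \<Omega> f q"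
    show "\<forall>K\<in>T. (\<Sum>e\<in>facets K. a K e) = (LINT x|lebesgue_on (interior K). f x)"
    proof
      fix K assume K: "K \<in> T"
      let ?d = "\<lambda>L. if L = K then 1 else 0 :: real"
      have del: "(\<Sum>L\<in>T. ?d L * g L) = g K" for g
      proof -
        have "(\<Sum>L\<in>T. ?d L * g L) = (\<Sum>L\<in>T. if L = K then g K else 0)" by (intro sum.cong refl) simp
        then show ?thesis using K finite_mesh by simp
      qed
      have "cell_fun ?d \<in> Qh T" using Qh_iff cell_fun_values by blast
      then have "(\<Sum>L\<in>T. ?d L * (\<Sum>e\<in>facets L. a L e)) = (\<Sum>L\<in>T. ?d L * (LINT x|lebesgue_on (interior L). f x))"
        using eq lhs[OF cell_fun_values[of ?d]] ip_cell_values[OF f cell_fun_values[of ?d]] by simp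
      then show "(\<Sum>e\<in>facets K. a K e) = (LINT x|lebesgue_on (interior K). f x)" unfolding del .
    qed
  next
    assume eq: "\<forall>K\<in>T. (\<Sum>e\<in>facets K. a K e) = (LINT x|lebesgue_on (interior K). f x)"
    show "\<forall>q\<in>Qh T. (\<Sum>K\<in>T. ip K (wdiv (interior K) u) q) = ip \<Omega> f q"
    proof
      fix q assume "q \<in> Qh T"
      then obtain d where d: "cell_values q d" using Qh_iff by blast
      show "(\<Sum>K\<in>T. ip K (wdiv (interior K) u) q) = ip \<Omega> f q"
        unfolding lhs[OF d] ip_cell_values[OF f d] using eq by simp
    qed
  qed
qed

lemma second_equation_lhs:
  assumes "L2 (lebesgue_on \<Omega>) \<theta>" "reps \<eta>b \<theta> a" "L2 (lebesgue_on \<Omega>) \<tau>" "reps \<psi>b \<tau> b" "cell_values p d"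
  shows "ip \<Omega> \<theta> \<tau> + (\<Sum>K\<in>T. ip K p (wdiv (interior K) \<tau>)) =
    (\<Sum>K\<in>T. bil K (a K) (b K) + d K * (\<Sum>e\<in>facets K. b K e))"
  using ip_theta_tau[OF assms(1-4)] ip_cell_div[OF assms(4,5)] by (simp add: sum.distrib)

lemma multiplier_equation_iff:
  assumes u: "reps \<psi>b u a"
  shows "(\<forall>\<pi>\<in>Pi_h \<Omega> T. C_h T \<psi>b rt u \<pi> = 0) \<longleftrightarrow> balanced a"
proof
  assume eq: "\<forall>\<pi>\<in>Pi_h \<Omega> T. C_h T \<psi>b rt u \<pi> = 0"
  show "balanced a"
    unfolding balanced_def
  proof
    fix e assume e: "e \<in> interior_faces \<Omega> T"
    then have ef: "e \<in> faces T" "\<not> e \<subseteq> frontier \<Omega>" by (auto simp: interior_faces_def)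
    let ?m = "\<lambda>e'. if e' = e then 1 else 0 :: real"
    have m0: "\<And>e'. e' \<in> faces T \<Longrightarrow> e' \<subseteq> frontier \<Omega> \<Longrightarrow> ?m e' = 0" using ef by auto
    have "0 = (\<Sum>K\<in>T. \<Sum>e\<in>facets K. a K e * ?m e)"
      using eq face_fun_Pi_h[of ?m, OF m0] C_h_eq[OF u face_fun_Pi_h[of ?m, OF m0] face_fun_values[of ?m, OF m0]] by simp
    also have "\<dots> = (\<Sum>e'\<in>faces T. flux_jump a e' * ?m e')" by (rule sum_cells_facets)
    also have "\<dots> = (\<Sum>e'\<in>faces T. if e' = e then flux_jump a e else 0)" by (intro sum.cong refl) simp
    also have "\<dots> = flux_jump a e" using ef finite_faces by simp
    finally show "flux_jump a e = 0" by simp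
  qed
next
  assume b: "balanced a"
  show "\<forall>\<pi>\<in>Pi_h \<Omega> T. C_h T \<psi>b rt u \<pi> = 0"
  proof
    fix \<pi> assume \<pi>: "\<pi> \<in> Pi_h \<Omega> T"
    obtain m where m: "face_values \<pi> m" using Pi_h_face_values[OF \<pi>] by blast
    show "C_h T \<psi>b rt u \<pi> = 0"
      unfolding C_h_eq[OF u \<pi> m] by (rule balanced_pairing[OF b]) (use m in \<open>simp add: face_values_def\<close>)
  qed
qed

text \<open>
  The integrals of the right-hand side over the cells.
\<close>

definition load :: "(real^'n \<Rightarrow> real) \<Rightarrow> (real^'n) set \<Rightarrow> real" where
  "load f K = (LINT x|lebesgue_on (interior K). f x)"

lemma HOS_iff:
  assumes f: "L2 (lebesgue_on \<Omega>) f"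
  shows "HOS_solution \<Omega> T k f \<eta>b \<psi>b rt \<theta> u p \<mu> \<longleftrightarrow>
    L2 (lebesgue_on \<Omega>) \<theta> \<and> L2 (lebesgue_on \<Omega>) u \<and> \<mu> \<in> Pi_h \<Omega> T \<and>
    (\<exists>a d m. reps \<eta>b \<theta> a \<and> reps \<psi>b u a \<and> cell_values p d \<and> face_values \<mu> m \<and> hos_system a d m (load f))"
    (is "?L \<longleftrightarrow> ?R")
proof
  assume L: ?L
  then obtain a' a where \<theta>: "L2 (lebesgue_on \<Omega>) \<theta>" "reps \<eta>b \<theta> a'" and u: "L2 (lebesgue_on \<Omega>) u" "reps \<psi>b u a"
    unfolding HOS_solution_def span_iff by blast
  have aa: "\<forall>K\<in>T. \<forall>e\<in>facets K. a' K e = a K e"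
    using L first_equation_iff[OF \<theta> u] unfolding HOS_solution_def by blast
  have \<theta>a: "reps \<eta>b \<theta> a" by (rule reps_cong[OF \<theta>(2)]) (use aa in blast)
  have \<mu>: "\<mu> \<in> Pi_h \<Omega> T" using L unfolding HOS_solution_def by blast
  obtain d where d: "cell_values p d" using L Qh_iff unfolding HOS_solution_def by blast
  obtain m where m: "face_values \<mu> m" using Pi_h_face_values[OF \<mu>] by blast
  have "hos_system a d m (load f)"
    unfolding hos_system_def
  proof (intro conjI allI)
    fix b
    have "glue \<psi>b b \<in> cellwise_span \<Omega> T \<psi>b" using span_iff psi_glue_L2 reps_glue by blast
    then have "ip \<Omega> \<theta> (glue \<psi>b b) + (\<Sum>K\<in>T. ip K p (wdiv (interior K) (glue \<psi>b b))) = C_h T \<psi>b rt (glue \<psi>b b) \<mu>"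
      using L unfolding HOS_solution_def by blast
    then show "(\<Sum>K\<in>T. bil K (a K) (b K) + d K * (\<Sum>e\<in>facets K. b K e)) = (\<Sum>K\<in>T. \<Sum>e\<in>facets K. b K e * m e)"
      unfolding second_equation_lhs[OF \<theta>(1) \<theta>a psi_glue_L2 reps_glue d] C_h_eq[OF reps_glue \<mu> m] .
    show "\<forall>K\<in>T. (\<Sum>e\<in>facets K. a K e) = load f K"
      using L divergence_equation_iff[OF f u(2)] unfolding HOS_solution_def load_def by blast
    show "balanced a" using L multiplier_equation_iff[OF u(2)] unfolding HOS_solution_def by blast
    show "\<forall>e\<in>faces T. e \<subseteq> frontier \<Omega> \<longrightarrow> m e = 0" using m by (simp add: face_values_def)
  qed
  then show ?R using \<theta>(1) \<theta>a u \<mu> d m by blast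
next
  assume ?R
  then obtain a d m where \<theta>: "L2 (lebesgue_on \<Omega>) \<theta>" "reps \<eta>b \<theta> a" and u: "L2 (lebesgue_on \<Omega>) u" "reps \<psi>b u a"
    and \<mu>: "\<mu> \<in> Pi_h \<Omega> T" and d: "cell_values p d" and m: "face_values \<mu> m" and h: "hos_system a d m (load f)"
    by blast
  show ?L
    unfolding HOS_solution_def
  proof (intro conjI)
    show "\<theta> \<in> cellwise_span \<Omega> T \<eta>b" "u \<in> cellwise_span \<Omega> T \<psi>b" using \<theta> u span_iff by blast+
    show "p \<in> Qh T" using d Qh_iff by blast
    show "\<mu> \<in> Pi_h \<Omega> T" by fact
    show "\<forall>\<xi>\<in>cellwise_span \<Omega> T \<eta>b. ip \<Omega> (\<lambda>x. k x *v \<theta> x) \<xi> + ip \<Omega> u \<xi> = 0"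
      using first_equation_iff[OF \<theta> u] by blast
    show "\<forall>\<tau>\<in>cellwise_span \<Omega> T \<psi>b. ip \<Omega> \<theta> \<tau> + (\<Sum>K\<in>T. ip K p (wdiv (interior K) \<tau>)) = C_h T \<psi>b rt \<tau> \<mu>"
    proof
      fix \<tau> assume "\<tau> \<in> cellwise_span \<Omega> T \<psi>b"
      then obtain b where \<tau>: "L2 (lebesgue_on \<Omega>) \<tau>" "reps \<psi>b \<tau> b" using span_iff by blast
      show "ip \<Omega> \<theta> \<tau> + (\<Sum>K\<in>T. ip K p (wdiv (interior K) \<tau>)) = C_h T \<psi>b rt \<tau> \<mu>"
        unfolding second_equation_lhs[OF \<theta> \<tau> d] C_h_eq[OF \<tau>(2) \<mu> m]
        using h unfolding hos_system_def by blast
    qed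
    show "\<forall>q\<in>Qh T. (\<Sum>K\<in>T. ip K (wdiv (interior K) u) q) = ip \<Omega> f q"
      using h divergence_equation_iff[OF f u(2)] unfolding hos_system_def load_def by blast
    show "\<forall>\<pi>\<in>Pi_h \<Omega> T. C_h T \<psi>b rt u \<pi> = 0"
      using h multiplier_equation_iff[OF u(2)] unfolding hos_system_def by blast
  qed
qed

lemma OS_iff:
  assumes f: "L2 (lebesgue_on \<Omega>) f"
  shows "OS_solution \<Omega> T k f \<eta>b \<psi>b rt \<theta> u p \<longleftrightarrow>
    L2 (lebesgue_on \<Omega>) \<theta> \<and> L2 (lebesgue_on \<Omega>) u \<and>
    (\<exists>a d. reps \<eta>b \<theta> a \<and> reps \<psi>b u a \<and> cell_values p d \<and> os_system a d (load f))"
    (is "?L \<longleftrightarrow> ?R")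
proof
  assume L: ?L
  have "u \<in> cellwise_span \<Omega> T \<psi>b" using L unfolding OS_solution_def X2_def by blast
  then obtain a where u: "L2 (lebesgue_on \<Omega>) u" "reps \<psi>b u a" using span_iff by blast
  obtain a' where \<theta>: "L2 (lebesgue_on \<Omega>) \<theta>" "reps \<eta>b \<theta> a'"
    using L unfolding OS_solution_def span_iff by blast
  have aa: "\<forall>K\<in>T. \<forall>e\<in>facets K. a' K e = a K e"
    using L first_equation_iff[OF \<theta> u] unfolding OS_solution_def by blast
  have \<theta>a: "reps \<eta>b \<theta> a" by (rule reps_cong[OF \<theta>(2)]) (use aa in blast)
  obtain d where d: "cell_values p d" using L Qh_iff unfolding OS_solution_def by blast
  have "os_system a d (load f)"
    unfolding os_system_def
  proof (intro conjI allI impI)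
    fix b assume b: "balanced b"
    have "glue \<psi>b b \<in> X2 \<Omega> T \<psi>b rt" using X2_iff[OF reps_glue psi_glue_L2] b by blast
    then have "ip \<Omega> \<theta> (glue \<psi>b b) + (\<Sum>K\<in>T. ip K p (wdiv (interior K) (glue \<psi>b b))) = 0"
      using L unfolding OS_solution_def by blast
    then show "(\<Sum>K\<in>T. bil K (a K) (b K) + d K * (\<Sum>e\<in>facets K. b K e)) = 0"
      unfolding second_equation_lhs[OF \<theta>(1) \<theta>a psi_glue_L2 reps_glue d] .
  next
    show "\<forall>K\<in>T. (\<Sum>e\<in>facets K. a K e) = load f K"
      using L divergence_equation_iff[OF f u(2)] unfolding OS_solution_def load_def by blast
    show "balanced a" using L X2_iff[OF u(2,1)] unfolding OS_solution_def by blast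
  qed
  then show ?R using \<theta>(1) \<theta>a u d by blast
next
  assume ?R
  then obtain a d where \<theta>: "L2 (lebesgue_on \<Omega>) \<theta>" "reps \<eta>b \<theta> a" and u: "L2 (lebesgue_on \<Omega>) u" "reps \<psi>b u a"
    and d: "cell_values p d" and h: "os_system a d (load f)"
    by blast
  show ?L
    unfolding OS_solution_def
  proof (intro conjI)
    show "\<theta> \<in> cellwise_span \<Omega> T \<eta>b" using \<theta> span_iff by blast
    show "u \<in> X2 \<Omega> T \<psi>b rt" using X2_iff[OF u(2,1)] h unfolding os_system_def by blast
    show "p \<in> Qh T" using d Qh_iff by blast
    show "\<forall>\<xi>\<in>cellwise_span \<Omega> T \<eta>b. ip \<Omega> (\<lambda>x. k x *v \<theta> x) \<xi> + ip \<Omega> u \<xi> = 0"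
      using first_equation_iff[OF \<theta> u] by blast
    show "\<forall>\<tau>\<in>X2 \<Omega> T \<psi>b rt. ip \<Omega> \<theta> \<tau> + (\<Sum>K\<in>T. ip K p (wdiv (interior K) \<tau>)) = 0"
    proof
      fix \<tau> assume \<tau>2: "\<tau> \<in> X2 \<Omega> T \<psi>b rt"
      then have "\<tau> \<in> cellwise_span \<Omega> T \<psi>b" unfolding X2_def by blast
      then obtain b where \<tau>: "L2 (lebesgue_on \<Omega>) \<tau>" "reps \<psi>b \<tau> b" using span_iff by blast
      have "balanced b" using X2_iff[OF \<tau>(2,1)] \<tau>2 by blast
      then show "ip \<Omega> \<theta> \<tau> + (\<Sum>K\<in>T. ip K p (wdiv (interior K) \<tau>)) = 0"
        unfolding second_equation_lhs[OF \<theta> \<tau> d]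
        using h unfolding os_system_def by blast
    qed
    show "\<forall>q\<in>Qh T. (\<Sum>K\<in>T. ip K (wdiv (interior K) u) q) = ip \<Omega> f q"
      using h divergence_equation_iff[OF f u(2)] unfolding os_system_def load_def by blast
  qed
qed

lemma HOS_imp_OS:
  assumes f: "L2 (lebesgue_on \<Omega>) f" and h: "HOS_solution \<Omega> T k f \<eta>b \<psi>b rt \<theta> u p \<mu>"
  shows "OS_solution \<Omega> T k f \<eta>b \<psi>b rt \<theta> u p"
  using h hos_imp_os unfolding HOS_iff[OF f] OS_iff[OF f] by blast

lemma HOS_exists:
  assumes f: "L2 (lebesgue_on \<Omega>) f"
  shows "\<exists>\<theta> u p \<mu>. HOS_solution \<Omega> T k f \<eta>b \<psi>b rt \<theta> u p \<mu>"
proof -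
  obtain a d m where h: "hos_system a d m (load f)" using hos_system_exists by blast
  then have m0: "\<And>e. e \<in> faces T \<Longrightarrow> e \<subseteq> frontier \<Omega> \<Longrightarrow> m e = 0" by (simp add: hos_system_def)
  have \<mu>: "face_fun m \<in> Pi_h \<Omega> T" "face_values (face_fun m) m"
    by (rule face_fun_Pi_h, erule m0, assumption) (rule face_fun_values, erule m0, assumption)
  have "HOS_solution \<Omega> T k f \<eta>b \<psi>b rt (glue \<eta>b a) (glue \<psi>b a) (cell_fun d) (face_fun m)"
    unfolding HOS_iff[OF f]
    using eta_glue_L2 psi_glue_L2 \<mu> reps_glue cell_fun_values h by blast
  then show ?thesis by blast
qed

lemma OS_unique:
  assumes f: "L2 (lebesgue_on \<Omega>) f"
    and 1: "OS_solution \<Omega> T k f \<eta>b \<psi>b rt \<theta> u p" and 2: "OS_solution \<Omega> T k f \<eta>b \<psi>b rt \<theta>' u' p'"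
  shows "ae_eq \<Omega> \<theta> \<theta>'" "ae_eq \<Omega> u u'" "ae_eq \<Omega> p p'"
proof -
  obtain a d where a: "reps \<eta>b \<theta> a" "reps \<psi>b u a" "cell_values p d" "os_system a d (load f)"
    using 1 OS_iff[OF f] by blast
  obtain a' d' where a': "reps \<eta>b \<theta>' a'" "reps \<psi>b u' a'" "cell_values p' d'" "os_system a' d' (load f)"
    using 2 OS_iff[OF f] by blast
  have os: "os_system (\<lambda>K e. a K e - a' K e) (\<lambda>K. d K - d' K) (\<lambda>K. 0)"
    using os_system_diff[OF a(4) a'(4)] by simp
  have aa: "a' K e = a K e" if "K \<in> T" "e \<in> facets K" for K e
    using os_system_zero_flux[OF os that] by simp
  show "ae_eq \<Omega> \<theta> \<theta>'" by (rule reps_unique_ae[OF a(1) reps_cong[OF a'(1) aa]])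
  show "ae_eq \<Omega> u u'" by (rule reps_unique_ae[OF a(2) reps_cong[OF a'(2) aa]])
  show "ae_eq \<Omega> p p'"
    by (rule cell_values_ae[OF a(3) a'(3)]) (use os_system_zero_pressure[OF os] in simp)
qed

lemma HOS_multiplier_unique:
  assumes f: "L2 (lebesgue_on \<Omega>) f"
    and 1: "HOS_solution \<Omega> T k f \<eta>b \<psi>b rt \<theta> u p \<mu>" and 2: "HOS_solution \<Omega> T k f \<eta>b \<psi>b rt \<theta>' u' p' \<mu>'"
    and e: "e \<in> faces T"
  shows "AE x in surf e. \<mu> x = \<mu>' x"
proof -
  obtain a d m where m: "face_values \<mu> m" "hos_system a d m (load f)" using 1 HOS_iff[OF f] by blast
  obtain a' d' m' where m': "face_values \<mu>' m'" "hos_system a' d' m' (load f)" using 2 HOS_iff[OF f] by blast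
  have "hos_system (\<lambda>K e. a K e - a' K e) (\<lambda>K. d K - d' K) (\<lambda>e. m e - m' e) (\<lambda>K. 0)"
    using hos_system_diff[OF m(2) m'(2)] by simp
  then have "m e - m' e = 0" by (rule hos_system_zero(3)[OF _ e])
  moreover have "AE x in surf e. \<mu> x = m e" "AE x in surf e. \<mu>' x = m' e"
    using m(1) m'(1) e by (simp_all add: face_values_def)
  ultimately show ?thesis by (auto elim: eventually_elim2)
qed

end

section \<open>Well-posedness and equivalence\<close>

theorem theorem4p5:
  fixes \<Omega> :: "(real^'n) set"
    and T :: "(real^'n) set set"
    and k :: "real^'n \<Rightarrow> real^'n^'n"
    and f :: "real^'n \<Rightarrow> real"
    and kmin kmax \<sigma> :: real
    and rt :: "(real^'n) set \<Rightarrow> (real^'n) set \<Rightarrow> real^'n \<Rightarrow> real^'n"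
    and S :: "(real^'n) set \<Rightarrow> (real^'n) set"
    and \<eta> \<psi> :: "(real^'n) set \<Rightarrow> (real^'n) set \<Rightarrow> real^'n \<Rightarrow> real^'n"
    and \<phi> :: "(real^'n) set \<Rightarrow> (real^'n) set \<Rightarrow> real^'n \<Rightarrow> real"
    and c :: "(real^'n) set \<Rightarrow> (real^'n) set \<Rightarrow> (real^'n) set \<Rightarrow> real"
    and \<eta>b \<psi>b :: "(real^'n) set \<Rightarrow> (real^'n) set \<Rightarrow> real^'n \<Rightarrow> real^'n"
  assumes dim: "CARD('n) = 2 \<or> CARD('n) = 3"
    and domain: "bounded \<Omega>" "lipschitz_domain \<Omega>"
    and f: "L2 (lebesgue_on \<Omega>) f"
    and k_measurable: "k \<in> borel_measurable (lebesgue_on \<Omega>)"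
    and k_symmetric: "\<And>x. x \<in> \<Omega> \<Longrightarrow> transpose (k x) = k x"
    and k_consts: "0 < kmin" "kmin \<le> kmax"
    and k_bounds: "\<And>x \<zeta>. x \<in> \<Omega> \<Longrightarrow> kmin * (norm \<zeta>)\<^sup>2 \<le> \<zeta> \<bullet> (k x *v \<zeta>) \<and>
                                    \<zeta> \<bullet> (k x *v \<zeta>) \<le> kmax * (norm \<zeta>)\<^sup>2"
    and mesh: "mesh \<Omega> T" "quasi_uniform \<sigma> T"
    and basis_K: "\<And>K. K \<in> T \<Longrightarrow> rt0_basis K (rt K)"
    and block: "\<And>K. K \<in> T \<Longrightarrow> cell (S K) \<and> K \<subseteq> S K \<and> interior (S K) \<subseteq> \<Omega>"
    and basis_S: "\<And>K. K \<in> T \<Longrightarrow> rt0_basis (S K) (rt (S K))"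
    and local_solutions: "\<And>K l. K \<in> T \<Longrightarrow> l facet_of S K \<Longrightarrow>
                  local_problem k (S K) (rt (S K) l) (\<eta> (S K) l) (\<psi> (S K) l) (\<phi> (S K) l)"
    and c: "\<And>K e x. K \<in> T \<Longrightarrow> e facet_of K \<Longrightarrow> x \<in> K \<Longrightarrow> rt K e x = os_bar S c rt K e x"
    and \<eta>b: "\<eta>b = os_bar S c \<eta>"
    and \<psi>b: "\<psi>b = os_bar S c \<psi>"
    and independent: "cellwise_independent T \<psi>b"
  shows "(\<exists>\<theta> u p \<mu>. HOS_solution \<Omega> T k f \<eta>b \<psi>b rt \<theta> u p \<mu>) \<and>
         (\<forall>\<theta> u p \<mu> \<theta>' u' p' \<mu>'.
            HOS_solution \<Omega> T k f \<eta>b \<psi>b rt \<theta> u p \<mu> \<and> HOS_solution \<Omega> T k f \<eta>b \<psi>b rt \<theta>' u' p' \<mu>' \<longrightarrow>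
            ae_eq \<Omega> \<theta> \<theta>' \<and> ae_eq \<Omega> u u' \<and> ae_eq \<Omega> p p' \<and> (\<forall>e\<in>faces T. AE x in surf e. \<mu> x = \<mu>' x)) \<and>
         (\<exists>\<theta> u p. OS_solution \<Omega> T k f \<eta>b \<psi>b rt \<theta> u p) \<and>
         (\<forall>\<theta> u p \<theta>' u' p'.
            OS_solution \<Omega> T k f \<eta>b \<psi>b rt \<theta> u p \<and> OS_solution \<Omega> T k f \<eta>b \<psi>b rt \<theta>' u' p' \<longrightarrow>
            ae_eq \<Omega> \<theta> \<theta>' \<and> ae_eq \<Omega> u u' \<and> ae_eq \<Omega> p p') \<and>
         (\<forall>\<theta> u p \<mu> \<theta>' u' p'.
            HOS_solution \<Omega> T k f \<eta>b \<psi>b rt \<theta> u p \<mu> \<and> OS_solution \<Omega> T k f \<eta>b \<psi>b rt \<theta>' u' p' \<longrightarrow>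
            ae_eq \<Omega> \<theta> \<theta>' \<and> ae_eq \<Omega> u u' \<and> ae_eq \<Omega> p p')"
proof -
  interpret oversampling \<Omega> T rt k kmin S \<eta> \<psi> \<phi> c \<eta>b \<psi>b
  proof unfold_locales
    show "bounded \<Omega>" by (rule domain(1))
    show "open \<Omega>" using domain(2) by (simp add: lipschitz_domain_def)
    show "mesh \<Omega> T" by (rule mesh(1))
    show "rt0_basis K (rt K)" if "K \<in> T" for K by (rule basis_K[OF that])
    show "interior K \<subseteq> \<Omega>" if "K \<in> T" for K
      using block[OF that] interior_mono[of K "S K"] by blast
    show "cell K" if "K \<in> T" for K using mesh(1) that by (simp add: mesh_def)
    show "0 < kmin" by (rule k_consts(1))
    show "kmin * (norm \<zeta>)\<^sup>2 \<le> \<zeta> \<bullet> (k x *v \<zeta>)" if "x \<in> \<Omega>" for x \<zeta> using k_bounds[OF that] by blast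
    show "cell (S K) \<and> K \<subseteq> S K" if "K \<in> T" for K using block[OF that] by blast
    show "rt0_basis (S K) (rt (S K))" if "K \<in> T" for K by (rule basis_S[OF that])
    show "local_problem k (S K) (rt (S K) l) (\<eta> (S K) l) (\<psi> (S K) l) (\<phi> (S K) l)"
      if "K \<in> T" "l facet_of S K" for K l by (rule local_solutions[OF that])
    show "rt K e x = os_bar S c rt K e x" if "K \<in> T" "e facet_of K" "x \<in> K" for K e x by (rule c[OF that])
    show "\<eta>b = os_bar S c \<eta>" by (rule \<eta>b)
    show "\<psi>b = os_bar S c \<psi>" by (rule \<psi>b)
    show "cellwise_independent T \<psi>b" by (rule independent)
  qed
  show ?thesis
  proof (intro conjI)
    show "\<exists>\<theta> u p \<mu>. HOS_solution \<Omega> T k f \<eta>b \<psi>b rt \<theta> u p \<mu>" by (rule HOS_exists[OF f])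
    then show "\<exists>\<theta> u p. OS_solution \<Omega> T k f \<eta>b \<psi>b rt \<theta> u p" using HOS_imp_OS[OF f] by blast
  next
    show "\<forall>\<theta> u p \<mu> \<theta>' u' p' \<mu>'.
        HOS_solution \<Omega> T k f \<eta>b \<psi>b rt \<theta> u p \<mu> \<and> HOS_solution \<Omega> T k f \<eta>b \<psi>b rt \<theta>' u' p' \<mu>' \<longrightarrow>
        ae_eq \<Omega> \<theta> \<theta>' \<and> ae_eq \<Omega> u u' \<and> ae_eq \<Omega> p p' \<and> (\<forall>e\<in>faces T. AE x in surf e. \<mu> x = \<mu>' x)"
      by (intro allI impI conjI ballI; elim conjE)
        (rule OS_unique[OF f HOS_imp_OS[OF f] HOS_imp_OS[OF f]] HOS_multiplier_unique[OF f]; assumption)+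
  next
    show "\<forall>\<theta> u p \<theta>' u' p'.
        OS_solution \<Omega> T k f \<eta>b \<psi>b rt \<theta> u p \<and> OS_solution \<Omega> T k f \<eta>b \<psi>b rt \<theta>' u' p' \<longrightarrow>
        ae_eq \<Omega> \<theta> \<theta>' \<and> ae_eq \<Omega> u u' \<and> ae_eq \<Omega> p p'"
      using OS_unique[OF f] by blast
  next
    show "\<forall>\<theta> u p \<mu> \<theta>' u' p'.
        HOS_solution \<Omega> T k f \<eta>b \<psi>b rt \<theta> u p \<mu> \<and> OS_solution \<Omega> T k f \<eta>b \<psi>b rt \<theta>' u' p' \<longrightarrow>
        ae_eq \<Omega> \<theta> \<theta>' \<and> ae_eq \<Omega> u u' \<and> ae_eq \<Omega> p p'"
      by (intro allI impI conjI; elim conjE)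
        (rule OS_unique[OF f HOS_imp_OS[OF f]]; assumption)+
  qed
qed

end
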